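(* Let $(\mathcal A,U)$ be a $C^*$-dynamical system on a Hilbert space $H$, let $\delta(a)=UaU^*$, $\delta_*(a)=U^*aU$ for $a\in L(H)$, let $(M,\Delta,\alpha)$ be the partial dynamical system generated by $U$ on the maximal ideal space $M$ of $\mathcal A$, and let $\mathcal B=C^*\big(\bigcup_{n=0}^\infty U^{*n}\mathcal A U^n\big)$ (a commutative unital $C^*$-algebra on which both $\delta$ and $\delta_*$ restrict to endomorphisms). Let $Y=\mathrm{hull}(U^*U\mathcal A\cap\mathcal A)$, a closed subset of $M$ containing $M\setminus\alpha(\Delta)$. To a character $\widetilde x$ of $\mathcal B$ associate the sequence $(x_0,x_1,\dots)$ of functionals on $\mathcal A$, $x_n(a)=\widetilde x(\delta_*^n(a))$, $a\in\mathcal A$; each $x_n$ is either a point of $M$ or the zero functional $0$. Then the mapping $\widetilde x\mapsto(x_0,x_1,\dots)$ is a homeomorphism of the maximal ideal space of $\mathcal B$ onto $$\widetilde M=\bigcup_{N=0}^\infty M_N\cup M_\infty ,$$ where $$M_N=\{(x_0,x_1,\dots,x_N,0,\dots): x_n\in\Delta,\ \alpha(x_n)=x_{n-1},\ n=1,\dots,N,\ x_N\in Y\},$$ $$M_\infty=\{(x_0,x_1,\dots): x_n\in\Delta,\ \alpha(x_n)=x_{n-1},\ n\ge 1\},$$ with the topology inherited from the product topology on $\prod_{n\in\mathbb N}(M\cup\{0\})$, where $\{0\}$ is a clopen singleton. Furthermore, under this identification the partial homeomorphisms dual to the partial automorphisms $\delta,\delta_*:\mathcal B\to\mathcal B$ are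 defined respectively on the clopen sets $$\widetilde\Delta=\{(x_0,x_1,\dots)\in\widetilde M: x_0\in\Delta\},\qquad \widetilde\alpha(\widetilde\Delta)=\{(x_0,x_1,\dots)\in\widetilde M: x_1\ne 0\},$$ and act by $$\widetilde\alpha(x_0,x_1,\dots)=(\alpha(x_0),x_0,x_1,\dots),\qquad \widetilde\alpha^{-1}(x_0,x_1,\dots)=(x_1,x_2,\dots).$$
   Context: $\mathbb N=\{0,1,2,\dots\}$. A $C^*$-dynamical system is a pair $(\mathcal A,U)$ where $\mathcal A\subset L(H)$ is a commutative $C^*$-algebra of bounded operators on a Hilbert space $H$ with $1\in\mathcal A$, and $U\in L(H)$ is a partial isometry with $U\mathcal A U^*\subset\mathcal A$ and $U^*U\in\mathcal A'$ (the commutant of $\mathcal A$). Then $\delta(a)=UaU^*$ is an endomorphism of $\mathcal A$. For an endomorphism $\delta$ of a unital commutative $C^*$-algebra $\mathcal A=C(M)$ ($M$ the maximal ideal space), its dual partial map is $\alpha:\Delta\to M$, where $\Delta=\{x\in M: x(\delta(1))\neq0\}$ (clopen) and $\alpha(x)=x\circ\delta$; thus $\delta(a)(x)=a(\alpha(x))$ for $x\in\Delta$ and $\delta(a)(x)=0$ for $x\notin\Delta$. The triple $(M,\Delta,\alpha)$ is the partial dynamical system generated by $U$ when $\delta(a)=UaU^*$. For $I\subset\mathcal A$, $\mathrm{hull}(I)=\{x\in M: x(I)=0\}$; $U^*U\mathcal A\cap\mathcal A=\{a\in\mathcal A: U^*Ua=a\}$. A partial automorphism is an endomorphism whose kernel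 is unital and whose image is an ideal. *)

theory Defs
  imports "HOL-Analysis.Analysis"
begin

text \<open>The inner product is linear in the first argument. Positive definiteness is not a separate
  axiom: it follows from the last axiom, since \<open>norm\<close> is a norm (see \<open>cinner_self\<close> below).\<close>

class complex_hilbert_space = banach +
  fixes scaleC :: "complex \<Rightarrow> 'a \<Rightarrow> 'a" (infixr "*\<^sub>C" 75)
    and cinner :: "'a \<Rightarrow> 'a \<Rightarrow> complex"
  assumes scaleR_scaleC: "r *\<^sub>R x = complex_of_real r *\<^sub>C x"
    and scaleC_add_right: "c *\<^sub>C (x + y) = c *\<^sub>C x + c *\<^sub>C y"
    and scaleC_add_left: "(c + d) *\<^sub>C x = c *\<^sub>C x + d *\<^sub>C x"
    and scaleC_scaleC: "c *\<^sub>C d *\<^sub>C x = (c * d) *\<^sub>C x"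
    and cinner_commute: "cinner x y = cnj (cinner y x)"
    and cinner_add_left: "cinner (x + y) z = cinner x z + cinner y z"
    and cinner_scaleC_left: "cinner (c *\<^sub>C x) y = c * cinner x y"
    and norm_eq_sqrt_cinner: "norm x = sqrt (Re (cinner x x))"

lemma cinner_self: "cinner x x = complex_of_real ((norm x)\<^sup>2)"
  for x :: "'a::complex_hilbert_space"
proof -
  have "Im (cinner x x) = 0"
    using cinner_commute[of x x] by (metis complex_cnj add.inverse_neutral
        cnj.simps(2) equal_neg_zero)
  moreover have "sqrt (Re (cinner x x)) \<ge> 0"
    using norm_eq_sqrt_cinner[of x] norm_ge_zero[of x] by simp
  then have "Re (cinner x x) = (norm x)\<^sup>2"
    by (simp add: norm_eq_sqrt_cinner)
  ultimately show ?thesis by (simp add: complex_eq_iff)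
qed

lemma norm_scaleC: "norm (c *\<^sub>C x) = cmod c * norm x"
  for x :: "'a::complex_hilbert_space"
proof -
  have "cinner (c *\<^sub>C x) (c *\<^sub>C x) = c * cnj c * cinner x x"
    by (metis (no_types, lifting) cinner_commute cinner_scaleC_left complex_cnj_mult mult.assoc
        mult.commute)
  then have "complex_of_real ((norm (c *\<^sub>C x))\<^sup>2) = complex_of_real ((cmod c * norm x)\<^sup>2)"
    unfolding cinner_self complex_norm_square[symmetric] by (simp add: power_mult_distrib)
  then have "(norm (c *\<^sub>C x))\<^sup>2 = (cmod c * norm x)\<^sup>2"
    using of_real_eq_iff by blast
  then show ?thesis by (simp add: power2_eq_iff_nonneg)
qed

lemma bounded_linear_scaleC: "bounded_linear (\<lambda>x::'a::complex_hilbert_space. c *\<^sub>C x)"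
proof (rule bounded_linear_intro)
  show "c *\<^sub>C (x + y) = c *\<^sub>C x + c *\<^sub>C y" for x y :: 'a by (rule scaleC_add_right)
  show "c *\<^sub>C (r *\<^sub>R x) = r *\<^sub>R (c *\<^sub>C x)" for r and x :: 'a
    by (simp add: scaleR_scaleC scaleC_scaleC mult.commute)
  show "norm (c *\<^sub>C x) \<le> norm x * cmod c" for x :: 'a by (simp add: norm_scaleC)
qed

instantiation complex :: complex_hilbert_space
begin
definition "scaleC_complex (c::complex) (x::complex) = c * x"
definition "cinner_complex (x::complex) (y::complex) = x * cnj y"
instance
  by standard
    (auto simp: scaleC_complex_def cinner_complex_def algebra_simps scaleR_conv_of_real
      cmod_def power2_eq_square)
end

text \<open>Operators live in the library type of bounded real-linear maps, which supplies the operator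
  norm and composition; \<open>L(H)\<close> is the set of those that are complex linear.\<close>

type_synonym 'h op = "'h \<Rightarrow>\<^sub>L 'h"

definition bounded_ops :: "('h::complex_hilbert_space) op set" where
  "bounded_ops = {T. \<forall>c x. blinfun_apply T (c *\<^sub>C x) = c *\<^sub>C blinfun_apply T x}"

definition op_scale :: "complex \<Rightarrow> ('h::complex_hilbert_space) op \<Rightarrow> 'h op" where
  "op_scale c T = Blinfun (\<lambda>x. c *\<^sub>C blinfun_apply T x)"

lemma op_scale_apply: "blinfun_apply (op_scale c T) x = c *\<^sub>C blinfun_apply T x"
  unfolding op_scale_def
  by (simp add: bounded_linear_Blinfun_apply
      bounded_linear_compose[OF bounded_linear_scaleC blinfun.bounded_linear_right])

definition adj :: "('h::complex_hilbert_space) op \<Rightarrow> 'h op" where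
  "adj T = (THE S. S \<in> bounded_ops \<and>
     (\<forall>x y. cinner (blinfun_apply T x) y = cinner x (blinfun_apply S y)))"

definition op_pow :: "('h::complex_hilbert_space) op \<Rightarrow> nat \<Rightarrow> 'h op" where
  "op_pow T n = (((o\<^sub>L) T) ^^ n) id_blinfun"

definition partial_isometry :: "('h::complex_hilbert_space) op \<Rightarrow> bool" where
  "partial_isometry T \<longleftrightarrow> T \<in> bounded_ops \<and>
     (\<forall>x. (\<forall>y. blinfun_apply T y = 0 \<longrightarrow> cinner x y = 0) \<longrightarrow> norm (blinfun_apply T x) = norm x)"

definition commutant :: "('h::complex_hilbert_space) op set \<Rightarrow> 'h op set" where
  "commutant A = {T \<in> bounded_ops. \<forall>a\<in>A. T o\<^sub>L a = a o\<^sub>L T}"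

definition op_subspace :: "('h::complex_hilbert_space) op set \<Rightarrow> bool" where
  "op_subspace A \<longleftrightarrow> A \<subseteq> bounded_ops \<and> 0 \<in> A \<and>
     (\<forall>a\<in>A. \<forall>b\<in>A. a + b \<in> A) \<and> (\<forall>c. \<forall>a\<in>A. op_scale c a \<in> A)"

definition cstar_algebra :: "('h::complex_hilbert_space) op set \<Rightarrow> bool" where
  "cstar_algebra A \<longleftrightarrow> op_subspace A \<and> closed A \<and>
     (\<forall>a\<in>A. \<forall>b\<in>A. a o\<^sub>L b \<in> A) \<and> (\<forall>a\<in>A. adj a \<in> A)"

definition unital_comm_cstar_algebra :: "('h::complex_hilbert_space) op set \<Rightarrow> bool" where
  "unital_comm_cstar_algebra A \<longleftrightarrow> cstar_algebra A \<and> id_blinfun \<in> A \<and>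
     (\<forall>a\<in>A. \<forall>b\<in>A. a o\<^sub>L b = b o\<^sub>L a)"

definition endomorphism ::
  "('h::complex_hilbert_space) op set \<Rightarrow> ('h op \<Rightarrow> 'h op) \<Rightarrow> bool" where
  "endomorphism A \<phi> \<longleftrightarrow> (\<forall>a\<in>A. \<phi> a \<in> A) \<and>
     (\<forall>a\<in>A. \<forall>b\<in>A. \<phi> (a + b) = \<phi> a + \<phi> b) \<and>
     (\<forall>c. \<forall>a\<in>A. \<phi> (op_scale c a) = op_scale c (\<phi> a)) \<and>
     (\<forall>a\<in>A. \<forall>b\<in>A. \<phi> (a o\<^sub>L b) = \<phi> a o\<^sub>L \<phi> b) \<and>
     (\<forall>a\<in>A. \<phi> (adj a) = adj (\<phi> a))"

text \<open>As usual for C*-algebras, ideals are closed and two-sided.\<close>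

definition cstar_ideal ::
  "('h::complex_hilbert_space) op set \<Rightarrow> 'h op set \<Rightarrow> bool" where
  "cstar_ideal A I \<longleftrightarrow> I \<subseteq> A \<and> op_subspace I \<and> closed I \<and>
     (\<forall>a\<in>A. \<forall>b\<in>I. a o\<^sub>L b \<in> I \<and> b o\<^sub>L a \<in> I)"

definition partial_automorphism ::
  "('h::complex_hilbert_space) op set \<Rightarrow> ('h op \<Rightarrow> 'h op) \<Rightarrow> bool" where
  "partial_automorphism A \<phi> \<longleftrightarrow> endomorphism A \<phi> \<and>
     (\<exists>e\<in>{a\<in>A. \<phi> a = 0}. \<forall>a\<in>{a\<in>A. \<phi> a = 0}. e o\<^sub>L a = a \<and> a o\<^sub>L e = a) \<and>
     cstar_ideal A (\<phi> ` A)"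

text \<open>Functionals on \<open>A\<close> are functions extensional on \<open>A\<close> (equal to \<open>undefined\<close> outside \<open>A\<close>), so that
  equality of functionals is equality on \<open>A\<close>. The points of the maximal ideal space are the
  characters, and its topology is that of pointwise convergence on \<open>A\<close> (the weak* topology).\<close>

definition characters ::
  "('h::complex_hilbert_space) op set \<Rightarrow> ('h op \<Rightarrow> complex) set" where
  "characters A = {x \<in> extensional A.
     (\<forall>a\<in>A. \<forall>b\<in>A. x (a + b) = x a + x b) \<and>
     (\<forall>c. \<forall>a\<in>A. x (op_scale c a) = c * x a) \<and>
     (\<forall>a\<in>A. \<forall>b\<in>A. x (a o\<^sub>L b) = x a * x b) \<and>
     (\<exists>a\<in>A. x a \<noteq> 0)}"

definition max_ideal_space ::
  "('h::complex_hilbert_space) op set \<Rightarrow> ('h op \<Rightarrow> complex) topology" where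
  "max_ideal_space A = subtopology (product_topology (\<lambda>_. euclidean) A) (characters A)"

definition zero_functional :: "('h::complex_hilbert_space) op set \<Rightarrow> 'h op \<Rightarrow> complex" where
  "zero_functional A = (\<lambda>a\<in>A. 0)"

text \<open>The space \<open>M \<union> {0}\<close>, in which \<open>{0}\<close> is a clopen singleton: a subset is open iff its trace
  on \<open>M\<close> is open.\<close>

definition max_ideal_space0 ::
  "('h::complex_hilbert_space) op set \<Rightarrow> ('h op \<Rightarrow> complex) topology" where
  "max_ideal_space0 A = topology (\<lambda>S. S \<subseteq> insert (zero_functional A) (characters A) \<and>
     openin (max_ideal_space A) (S \<inter> characters A))"

lemma openin_max_ideal_space0:
  "openin (max_ideal_space0 A) S \<longleftrightarrow>
     S \<subseteq> insert (zero_functional A) (characters A) \<and> openin (max_ideal_space A) (S \<inter> characters A)"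
proof -
  have "istopology (\<lambda>S. S \<subseteq> insert (zero_functional A) (characters A) \<and>
     openin (max_ideal_space A) (S \<inter> characters A))"
    unfolding istopology_def
  proof (intro conjI allI impI)
    fix S T
    assume S: "S \<subseteq> insert (zero_functional A) (characters A) \<and>
        openin (max_ideal_space A) (S \<inter> characters A)"
      and T: "T \<subseteq> insert (zero_functional A) (characters A) \<and>
        openin (max_ideal_space A) (T \<inter> characters A)"
    have "S \<inter> T \<inter> characters A = (S \<inter> characters A) \<inter> (T \<inter> characters A)" by blast
    with S T show "openin (max_ideal_space A) (S \<inter> T \<inter> characters A)"
      by (metis openin_Int)
    show "S \<inter> T \<subseteq> insert (zero_functional A) (characters A)" using S by blast
  next
    fix K
    assume K: "\<forall>S\<in>K. S \<subseteq> insert (zero_functional A) (characters A) \<and>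
        openin (max_ideal_space A) (S \<inter> characters A)"
    then show "\<Union>K \<subseteq> insert (zero_functional A) (characters A)" by blast
    have "\<Union>K \<inter> characters A = (\<Union>S\<in>K. S \<inter> characters A)" by blast
    then show "openin (max_ideal_space A) (\<Union>K \<inter> characters A)"
      using K by (metis (no_types, lifting) imageE openin_Union)
  qed
  then show ?thesis by (simp add: max_ideal_space0_def topology_inverse')
qed

definition dual_dom ::
  "('h::complex_hilbert_space) op set \<Rightarrow> ('h op \<Rightarrow> 'h op) \<Rightarrow> ('h op \<Rightarrow> complex) set" where
  "dual_dom A \<phi> = {x \<in> characters A. x (\<phi> id_blinfun) \<noteq> 0}"

text \<open>\<open>x \<circ> \<phi>\<close> as a functional on \<open>A\<close>; only meaningful as the dual partial map for
  \<open>x \<in> dual_dom A \<phi>\<close>.\<close>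

definition dual_map ::
  "('h::complex_hilbert_space) op set \<Rightarrow> ('h op \<Rightarrow> 'h op) \<Rightarrow> ('h op \<Rightarrow> complex) \<Rightarrow> 'h op \<Rightarrow> complex"
  where "dual_map A \<phi> x = restrict (x \<circ> \<phi>) A"

definition zero_hull ::
  "('h::complex_hilbert_space) op set \<Rightarrow> 'h op set \<Rightarrow> ('h op \<Rightarrow> complex) set" where
  "zero_hull A I = {x \<in> characters A. \<forall>a\<in>I. x a = 0}"

definition delta :: "('h::complex_hilbert_space) op \<Rightarrow> 'h op \<Rightarrow> 'h op" where
  "delta U a = U o\<^sub>L a o\<^sub>L adj U"

definition delta_star :: "('h::complex_hilbert_space) op \<Rightarrow> 'h op \<Rightarrow> 'h op" where
  "delta_star U a = adj U o\<^sub>L a o\<^sub>L U"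

definition cstar_dynamical_system ::
  "('h::complex_hilbert_space) op set \<Rightarrow> 'h op \<Rightarrow> bool" where
  "cstar_dynamical_system A U \<longleftrightarrow> unital_comm_cstar_algebra A \<and> partial_isometry U \<and>
     (\<forall>a\<in>A. U o\<^sub>L a o\<^sub>L adj U \<in> A) \<and> adj U o\<^sub>L U \<in> commutant A"

definition ext_algebra ::
  "('h::complex_hilbert_space) op set \<Rightarrow> 'h op \<Rightarrow> 'h op set" where
  "ext_algebra A U = cstar_algebra hull (\<Union>n. {op_pow (adj U) n o\<^sub>L a o\<^sub>L op_pow U n |a. a \<in> A})"

definition ext_Y ::
  "('h::complex_hilbert_space) op set \<Rightarrow> 'h op \<Rightarrow> ('h op \<Rightarrow> complex) set" where
  "ext_Y A U = zero_hull A ((\<lambda>a. adj U o\<^sub>L U o\<^sub>L a) ` A \<inter> A)"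

text \<open>Coordinate \<open>0\<close> is not required to lie in \<open>\<Delta>\<close>; it lies in \<open>M\<close> because \<open>x 0 \<in> Y\<close> or
  \<open>x 0 = \<alpha> (x 1)\<close>.\<close>

definition ext_M_fin ::
  "('h::complex_hilbert_space) op set \<Rightarrow> 'h op \<Rightarrow> nat \<Rightarrow> (nat \<Rightarrow> 'h op \<Rightarrow> complex) set" where
  "ext_M_fin A U N = {x.
     (\<forall>n\<in>{1..N}. x n \<in> dual_dom A (delta U) \<and> dual_map A (delta U) (x n) = x (n - 1)) \<and>
     x N \<in> ext_Y A U \<and> (\<forall>n>N. x n = zero_functional A)}"

definition ext_M_inf ::
  "('h::complex_hilbert_space) op set \<Rightarrow> 'h op \<Rightarrow> (nat \<Rightarrow> 'h op \<Rightarrow> complex) set" where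
  "ext_M_inf A U = {x.
     \<forall>n\<ge>1. x n \<in> dual_dom A (delta U) \<and> dual_map A (delta U) (x n) = x (n - 1)}"

definition ext_M ::
  "('h::complex_hilbert_space) op set \<Rightarrow> 'h op \<Rightarrow> (nat \<Rightarrow> 'h op \<Rightarrow> complex) set" where
  "ext_M A U = (\<Union>N. ext_M_fin A U N) \<union> ext_M_inf A U"

definition ext_space ::
  "('h::complex_hilbert_space) op set \<Rightarrow> 'h op \<Rightarrow> (nat \<Rightarrow> 'h op \<Rightarrow> complex) topology" where
  "ext_space A U = subtopology (product_topology (\<lambda>_. max_ideal_space0 A) UNIV) (ext_M A U)"

definition ext_seq ::
  "('h::complex_hilbert_space) op set \<Rightarrow> 'h op \<Rightarrow> ('h op \<Rightarrow> complex) \<Rightarrow> nat \<Rightarrow> 'h op \<Rightarrow> complex"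
  where "ext_seq A U x = (\<lambda>n. \<lambda>a\<in>A. x ((delta_star U ^^ n) a))"

definition ext_Delta ::
  "('h::complex_hilbert_space) op set \<Rightarrow> 'h op \<Rightarrow> (nat \<Rightarrow> 'h op \<Rightarrow> complex) set" where
  "ext_Delta A U = {x \<in> ext_M A U. x 0 \<in> dual_dom A (delta U)}"

definition ext_Delta_star ::
  "('h::complex_hilbert_space) op set \<Rightarrow> 'h op \<Rightarrow> (nat \<Rightarrow> 'h op \<Rightarrow> complex) set" where
  "ext_Delta_star A U = {x \<in> ext_M A U. x 1 \<noteq> zero_functional A}"

definition ext_alpha ::
  "('h::complex_hilbert_space) op set \<Rightarrow> 'h op \<Rightarrow>
     (nat \<Rightarrow> 'h op \<Rightarrow> complex) \<Rightarrow> nat \<Rightarrow> 'h op \<Rightarrow> complex" where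
  "ext_alpha A U x = case_nat (dual_map A (delta U) (x 0)) x"

definition ext_alpha_inv ::
  "(nat \<Rightarrow> ('h::complex_hilbert_space) op \<Rightarrow> complex) \<Rightarrow> nat \<Rightarrow> 'h op \<Rightarrow> complex" where
  "ext_alpha_inv x = (\<lambda>n. x (Suc n))"

end

theory Submission
  imports Defs
begin

text \<open>Since \<open>U a = \<delta>(a) U\<close> for \<open>a \<in> A\<close>, products of the elements \<open>U\<^sup>*\<^sup>n a U\<^sup>n\<close> are again of this form and these
  elements commute, so \<open>B\<close> is the closure of their linear span, and \<open>\<delta>\<^sup>N\<close> maps the partial sums with
  indices up to \<open>N\<close> into \<open>A\<close>. A chain \<open>x\<^sub>0, \<dots>, x\<^sub>N\<close> therefore defines a contractive multiplicative
  functional \<open>x\<^sub>N \<circ> \<delta>\<^sup>N\<close> on these partial sums, which settles the infinite sequences. If the sequence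
  stops at \<open>x\<^sub>N \<in> Y\<close>, the remaining summands lie in \<open>U\<^sup>* U B\<close> after applying \<open>\<delta>\<^sup>N\<close>, and contractivity
  amounts to \<open>\<bar>x\<^sub>N(a)\<bar> \<le> \<parallel>(1 - U\<^sup>* U) a\<parallel>\<close>, which holds because \<open>x\<^sub>N\<close> vanishes on the kernel of
  \<open>a \<mapsto> (1 - U\<^sup>* U) a\<close>. The Gelfand theory needed for this and for \<open>M - \<alpha>(\<Delta>) \<subseteq> Y\<close> only uses
  absolute values of self-adjoint operators, obtained from an iteration for the square root.\<close>

section \<open>Operators on a complex Hilbert space\<close>

subsection \<open>The inner product\<close>

text \<open>The obstacle is that U^*U commutes with A but may lie outside it, so a character of A
  has no value there. A sequence ending at index N stands for a character of B with value 1 at the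
  N-th conjugate \<open>U^*N (1 - U^*U) U^N\<close>, and Y consists of the points of M that tolerate
  this: those vanishing on the kernel of the homomorphism \<open>a \<mapsto> (1 - U^*U) a\<close> of
  A. The sequence forces all values on the span, but an element has many representations as a sum of
  generators, and norms of such sums are hard to reach. The candidate character is therefore a
  relation between elements and values; bounding values by norms makes it single-valued and extends
  it to the closure in one stroke. For Y the bound is an instance of the principle that injective
  homomorphisms of C*-algebras are isometric. Positive parts of self-adjoint elements give it
  directly for a single character, without forming a quotient algebra.\<close>

lemma scaleC_one [simp]: "1 *\<^sub>C x = x" for x :: "'a::complex_hilbert_space"
  using scaleR_scaleC[of 1 x] by simp

lemma scaleC_zero_left [simp]: "0 *\<^sub>C x = 0" for x :: "'a::complex_hilbert_space"
  using scaleR_scaleC[of 0 x] by simp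

lemma scaleC_zero_right [simp]: "c *\<^sub>C 0 = 0" for c and x :: "'a::complex_hilbert_space"
  using scaleC_add_right[of c 0 0] by simp

lemma scaleC_diff_right: "c *\<^sub>C (x - y) = c *\<^sub>C x - c *\<^sub>C y"
  for x y :: "'a::complex_hilbert_space"
  using scaleC_add_right[of c "x - y" y] by simp

lemma cinner_add_right: "cinner x (y + z) = cinner x y + cinner x z"
  by (metis cinner_add_left cinner_commute complex_cnj_add)

lemma cinner_zero_left [simp]: "cinner 0 x = 0"
  using cinner_add_left[of 0 0 x] by simp

lemma cinner_zero_right [simp]: "cinner x 0 = 0"
  using cinner_add_right[of x 0 0] by simp

lemma cinner_minus_left: "cinner (- x) y = - cinner x y"
  using cinner_add_left[of x "- x" y] by (simp add: eq_neg_iff_add_eq_0 add.commute)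

lemma cinner_minus_right: "cinner x (- y) = - cinner x y"
  using cinner_add_right[of x y "- y"] by (simp add: eq_neg_iff_add_eq_0 add.commute)

lemma cinner_diff_left: "cinner (x - y) z = cinner x z - cinner y z"
  using cinner_add_left[of x "- y" z] by (simp add: cinner_minus_left)

lemma cinner_diff_right: "cinner x (y - z) = cinner x y - cinner x z"
  using cinner_add_right[of x y "- z"] by (simp add: cinner_minus_right)

lemma cinner_scaleC_right: "cinner x (c *\<^sub>C y) = cnj c * cinner x y"
  by (metis cinner_commute cinner_scaleC_left complex_cnj_mult)

lemma cinner_scaleR_left: "cinner (r *\<^sub>R x) y = r * cinner x y"
  by (simp add: scaleR_scaleC cinner_scaleC_left)

lemma cinner_scaleR_right: "cinner x (r *\<^sub>R y) = r * cinner x y"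
  by (simp add: scaleR_scaleC cinner_scaleC_right)

lemmas cinner_simps = cinner_add_left cinner_add_right cinner_diff_left cinner_diff_right
  cinner_scaleC_left cinner_scaleC_right cinner_scaleR_left cinner_scaleR_right
  cinner_minus_left cinner_minus_right

lemma Re_cinner_self: "Re (cinner x x) = (norm x)\<^sup>2"
  by (simp add: cinner_self)

lemma cinner_self_eq_zero: "cinner x x = 0 \<longleftrightarrow> x = 0"
  by (simp add: cinner_self)

lemma Re_cinner_commute: "Re (cinner y x) = Re (cinner x y)"
  by (metis cinner_commute cnj.simps(1))

lemma norm_add_sq: "(norm (x + y))\<^sup>2 = (norm x)\<^sup>2 + 2 * Re (cinner x y) + (norm y)\<^sup>2"
  for x y :: "'a::complex_hilbert_space"
  using Re_cinner_commute[of x y] by (simp add: Re_cinner_self[symmetric] cinner_simps)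

lemma norm_diff_sq: "(norm (x - y))\<^sup>2 = (norm x)\<^sup>2 - 2 * Re (cinner x y) + (norm y)\<^sup>2"
  for x y :: "'a::complex_hilbert_space"
  using norm_add_sq[of x "- y"] by (simp add: cinner_minus_right)

lemma Re_cinner_le: "Re (cinner x y) \<le> norm x * norm y"
proof -
  have "(norm (x + y))\<^sup>2 \<le> (norm x + norm y)\<^sup>2"
    by (simp add: norm_triangle_ineq power_mono)
  then show ?thesis unfolding norm_add_sq by (simp add: power2_sum)
qed

lemma cinner_eqI: "x = y" if "\<And>z. cinner z x = cinner z y"
  using that[of "x - y"] cinner_self_eq_zero[of "x - y"] by (simp add: cinner_diff_right)

text \<open>Since \<open>Re (\<i> * c) = - Im c\<close>, the second premise supplies the imaginary
  part. This carries the real Riesz theorem over to complex inner products.\<close>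

lemma cinner_eq_of_Re: "cinner x y = cinner x' y'"
  if "Re (cinner x y) = Re (cinner x' y')"
    and "Re (cinner (\<i> *\<^sub>C x) y) = Re (cinner (\<i> *\<^sub>C x') y')"
  using that by (simp add: cinner_scaleC_left complex_eq_iff)

subsection \<open>Riesz representation and adjoints\<close>

text \<open>The representing vector minimises \<open>norm x ^ 2 - 2 * f x\<close>; minimising sequences are Cauchy by
  the parallelogram law.\<close>

lemma riesz_Re:
  fixes f :: "'a::complex_hilbert_space \<Rightarrow> real"
  assumes f: "bounded_linear f"
  obtains z where "\<And>x. f x = Re (cinner x z)"
proof -
  interpret f: bounded_linear f by (rule f)
  define J where "J x = (norm x)\<^sup>2 - 2 * f x" for x
  obtain K where K: "\<And>x. norm (f x) \<le> norm x * K" using f.bounded by blast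
  have lower: "- K\<^sup>2 \<le> J x" for x
  proof -
    have "0 \<le> (norm x - K)\<^sup>2" by simp
    then have "- K\<^sup>2 \<le> (norm x)\<^sup>2 - 2 * (norm x * K)" by (simp add: power2_diff)
    then show ?thesis unfolding J_def using K[of x] by (simp add: abs_le_iff)
  qed
  define m where "m = Inf (range J)"
  have bdd: "bdd_below (range J)" using lower by (auto simp: bdd_below_def)
  have mle: "m \<le> J x" for x unfolding m_def by (rule cInf_lower[OF _ bdd]) simp
  have "\<exists>x. J x < m + inverse (real (Suc n))" for n
    using cInf_lessD[of "range J" "m + inverse (real (Suc n))"] unfolding m_def[symmetric] by auto
  then obtain x where x: "\<And>n. J (x n) < m + inverse (real (Suc n))" by metis
  \<comment> \<open>The parallelogram law for \<open>J\<close>: the terms of the linear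
    \<open>f\<close> cancel. As \<open>J\<close> is at least \<open>m\<close> at the midpoint, two
    near-minimisers must be close to each other.\<close>
  have par: "(norm (u - v))\<^sup>2 = 2 * J u + 2 * J v - 4 * J ((1/2) *\<^sub>R (u + v))" for u v
  proof -
    have "(norm (u + v))\<^sup>2 + (norm (u - v))\<^sup>2 = 2 * (norm u)\<^sup>2 + 2 * (norm v)\<^sup>2"
      by (simp add: norm_add_sq norm_diff_sq)
    moreover have "(norm ((1/2) *\<^sub>R (u + v)))\<^sup>2 = (norm (u + v))\<^sup>2 / 4"
      unfolding norm_scaleR by (simp add: power_divide)
    moreover have "f ((1/2) *\<^sub>R (u + v)) = (f u + f v) / 2" by (simp add: f.scaleR f.add)
    ultimately show ?thesis unfolding J_def by (simp only:) argo
  qed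
  have close: "(norm (x i - x j))\<^sup>2 < 4 * e" if "inverse (real (Suc i)) < e" "inverse (real (Suc j)) < e" for i j e
    using par[of "x i" "x j"] mle[of "(1/2) *\<^sub>R (x i + x j)"] x[of i] x[of j] that by linarith
  have "Cauchy x"
  proof (rule CauchyI)
    fix e :: real assume e: "0 < e"
    obtain N where N: "inverse (real (Suc N)) < e\<^sup>2 / 4"
      using reals_Archimedean[of "e\<^sup>2/4"] e by auto
    have small: "inverse (real (Suc i)) < e\<^sup>2 / 4" if "N \<le> i" for i
      by (rule le_less_trans[OF _ N]) (use that in \<open>simp add: le_imp_inverse_le\<close>)
    have "norm (x i - x j) < e" if "N \<le> i" "N \<le> j" for i j
    proof -
      have "(norm (x i - x j))\<^sup>2 < e\<^sup>2"
        using close[OF small small, OF that] by simp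
      then show ?thesis using e by (simp add: power2_less_imp_less)
    qed
    then show "\<exists>M. \<forall>m\<ge>M. \<forall>n\<ge>M. norm (x m - x n) < e" by blast
  qed
  then obtain z where z: "x \<longlonglongrightarrow> z" using Cauchy_convergent_iff convergent_def by blast
  have "(\<lambda>n. J (x n)) \<longlonglongrightarrow> J z" unfolding J_def
    by (intro tendsto_intros z f.tendsto)
  moreover have "(\<lambda>n. m + inverse (real (Suc n))) \<longlonglongrightarrow> m + 0"
    by (intro tendsto_intros LIMSEQ_inverse_real_of_nat)
  ultimately have "J z \<le> m + 0"
    by (rule LIMSEQ_le) (use x less_imp_le in blast)
  then have min: "J z \<le> J y" for y using mle[of y] by simp
  have "f y = Re (cinner y z)" for y
  proof -
    define d where "d = Re (cinner y z) - f y"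
    have "0 \<le> t\<^sup>2 * (norm y)\<^sup>2 + 2 * t * d" for t
      using min[of "z + t *\<^sub>R y"]
      by (simp add: J_def norm_add_sq f.add f.scaleR cinner_simps d_def Re_cinner_commute
          algebra_simps power_mult_distrib)
    \<comment> \<open>This \<open>t\<close> lies near the minimum of the quadratic, where its value
      is negative unless \<open>d = 0\<close>; the summand 1 covers \<open>y = 0\<close>.\<close>
    from this[of "- d / ((norm y)\<^sup>2 + 1)"]
    have "0 \<le> d\<^sup>2 / ((norm y)\<^sup>2 + 1)\<^sup>2 * (norm y)\<^sup>2 - 2 * d\<^sup>2 / ((norm y)\<^sup>2 + 1)"
      by (simp add: power_divide power2_eq_square)
    also have "\<dots> = - d\<^sup>2 * ((norm y)\<^sup>2 + 2) / ((norm y)\<^sup>2 + 1)\<^sup>2"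
    proof -
      have p: "(norm y)\<^sup>2 + 1 \<noteq> 0" by (smt (verit) zero_le_power2)
      have "d\<^sup>2 / p\<^sup>2 * (p - 1) - 2 * d\<^sup>2 / p = - d\<^sup>2 * (p + 1) / p\<^sup>2" if "p \<noteq> 0" for p :: real
        using that by (simp add: field_simps power2_eq_square)
      from this[OF p] show ?thesis by (simp add: add.assoc)
    qed
    finally have "d\<^sup>2 * ((norm y)\<^sup>2 + 2) / ((norm y)\<^sup>2 + 1)\<^sup>2 \<le> 0" by simp
    moreover have "(norm y)\<^sup>2 + 2 > 0" "((norm y)\<^sup>2 + 1)\<^sup>2 > 0"
      by (smt (verit) zero_le_power2, smt (verit) zero_less_power2 zero_le_power2)
    ultimately have "d\<^sup>2 \<le> 0"
      by (simp add: divide_le_0_iff mult_le_0_iff)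
    then show ?thesis by (simp add: d_def)
  qed
  then show thesis by (rule that)
qed

section \<open>Existence, uniqueness and continuity of adjoints\<close>

lemma bounded_opsD: "T (c *\<^sub>C x) = c *\<^sub>C T x" if "T \<in> bounded_ops"
  using that by (simp add: bounded_ops_def)

text \<open>Riesz representation of \<open>x \<mapsto> Re (cinner (T x) y)\<close> yields a vector
  \<open>g y\<close>, and complex linearity of \<open>T\<close> removes the real part. Linearity of
  \<open>g\<close> follows from nondegeneracy, boundedness from
  \<open>norm (g y) ^ 2 = Re (cinner (T (g y)) y)\<close>.\<close>

lemma adj_exists:
  assumes T: "T \<in> bounded_ops"
  shows "\<exists>S\<in>bounded_ops. \<forall>x y. cinner (blinfun_apply T x) y = cinner x (blinfun_apply S y)"
proof -
  have bl: "bounded_linear (\<lambda>x. Re (cinner (T x) y))" for y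
  proof (rule bounded_linear_intro[where K = "norm T * norm y"])
    fix x
    have "\<bar>Re (cinner (T x) y)\<bar> \<le> norm (T x) * norm y"
      using Re_cinner_le[of "T x" y] Re_cinner_le[of "- T x" y] by (simp add: cinner_minus_left)
    also have "\<dots> \<le> norm T * norm x * norm y"
      by (simp add: mult_right_mono norm_blinfun)
    finally show "norm (Re (cinner (T x) y)) \<le> norm x * (norm T * norm y)"
      by (simp add: mult_ac)
  qed (simp_all add: blinfun.bilinear_simps cinner_simps)
  have "\<exists>z. \<forall>x. Re (cinner (T x) y) = Re (cinner x z)" for y
    using riesz_Re[OF bl[of y]] by metis
  then obtain g where g: "\<And>x y. Re (cinner (T x) y) = Re (cinner x (g y))" by metis
  have g: "cinner (T x) y = cinner x (g y)" for x y
    by (rule cinner_eq_of_Re) (simp_all add: g bounded_opsD[OF T, symmetric])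
  have add: "g (x + y) = g x + g y" for x y
    by (rule cinner_eqI) (simp add: g[symmetric] cinner_simps)
  have scaleC: "g (c *\<^sub>C x) = c *\<^sub>C g x" for c x
    by (rule cinner_eqI) (simp add: g[symmetric] cinner_simps)
  have "bounded_linear g"
  proof (rule bounded_linear_intro[where K = "norm T"])
    show "g (r *\<^sub>R x) = r *\<^sub>R g x" for r x by (simp add: scaleR_scaleC scaleC)
    fix y
    have "(norm (g y))\<^sup>2 = Re (cinner (T (g y)) y)" by (simp add: g Re_cinner_self)
    also have "\<dots> \<le> norm (T (g y)) * norm y" by (rule Re_cinner_le)
    also have "\<dots> \<le> norm T * norm (g y) * norm y" by (simp add: mult_right_mono norm_blinfun)
    finally have "norm (g y) * norm (g y) \<le> (norm y * norm T) * norm (g y)"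
      by (simp add: power2_eq_square mult_ac)
    then show "norm (g y) \<le> norm y * norm T"
      by (cases "norm (g y) = 0") (simp, metis mult_right_le_imp_le norm_ge_zero order_le_less)
  qed (rule add)
  then have "blinfun_apply (Blinfun g) = g" by (rule bounded_linear_Blinfun_apply)
  then show ?thesis
    by (intro bexI[of _ "Blinfun g"]) (simp_all add: g bounded_ops_def scaleC)
qed

lemma op_eqI: "S = T" if "\<And>x y. cinner x (blinfun_apply S y) = cinner x (blinfun_apply T y)"
  by (rule blinfun_eqI, rule cinner_eqI, rule that)

lemma adj_eqI:
  assumes "S \<in> bounded_ops" "\<And>x y. cinner (blinfun_apply T x) y = cinner x (blinfun_apply S y)"
  shows "adj T = S"
  unfolding adj_def 
proof (rule the_equality)
  fix R assume R: "R \<in> bounded_ops \<and> (\<forall>x y. cinner (T x) y = cinner x (R y))"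
  show "R = S" by (rule op_eqI) (use R assms(2) in metis)
qed (use assms in blast)

lemma adj_props:
  assumes "T \<in> bounded_ops"
  shows adj_bounded_ops [simp]: "adj T \<in> bounded_ops"
    and adj_right: "cinner (blinfun_apply T x) y = cinner x (blinfun_apply (adj T) y)"
  using adj_exists[OF assms] adj_eqI[of _ T] by metis+

lemma adj_left: "cinner (adj T x) y = cinner x (T y)" if "T \<in> bounded_ops"
  by (metis adj_right[OF that] cinner_commute)

lemma bounded_ops_intros [simp]:
  "0 \<in> bounded_ops" "id_blinfun \<in> bounded_ops"
  "S \<in> bounded_ops \<Longrightarrow> T \<in> bounded_ops \<Longrightarrow> S + T \<in> bounded_ops"
  "S \<in> bounded_ops \<Longrightarrow> T \<in> bounded_ops \<Longrightarrow> S - T \<in> bounded_ops"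
  "S \<in> bounded_ops \<Longrightarrow> T \<in> bounded_ops \<Longrightarrow> S o\<^sub>L T \<in> bounded_ops"
  "T \<in> bounded_ops \<Longrightarrow> op_scale c T \<in> bounded_ops"
  by (simp_all add: bounded_ops_def blinfun.bilinear_simps scaleC_add_right scaleC_diff_right
      op_scale_apply scaleC_scaleC mult.commute)

lemma closed_bounded_ops: "closed (bounded_ops :: ('h::complex_hilbert_space) op set)"
proof -
  have "bounded_ops = (\<Inter>c. \<Inter>x. {T :: 'h op. T (c *\<^sub>C x) = c *\<^sub>C T x})"
    by (auto simp: bounded_ops_def)
  moreover have "continuous_on UNIV (\<lambda>T :: 'h op. c *\<^sub>C T x)" for c x
    by (intro linear_continuous_on bounded_linear_compose[OF bounded_linear_scaleC]
        blinfun.bounded_linear_left)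
  then have "closed {T :: 'h op. T (c *\<^sub>C x) = c *\<^sub>C T x}" for c x
    by (intro closed_Collect_eq continuous_intros)
  ultimately show ?thesis
    by (metis (no_types, lifting) closed_INT)
qed

lemma adj_adj [simp]: "T \<in> bounded_ops \<Longrightarrow> adj (adj T) = T"
  by (rule adj_eqI) (simp_all add: adj_left)

lemma adj_op_scale: "T \<in> bounded_ops \<Longrightarrow> adj (op_scale c T) = op_scale (cnj c) (adj T)"
  by (rule adj_eqI) (simp_all add: adj_right cinner_simps op_scale_apply)

lemma adj_algebra:
  assumes "S \<in> bounded_ops" "T \<in> bounded_ops"
  shows adj_add: "adj (S + T) = adj S + adj T"
    and adj_diff: "adj (S - T) = adj S - adj T"
    and adj_compose: "adj (S o\<^sub>L T) = adj T o\<^sub>L adj S"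
  by (rule adj_eqI; simp add: assms adj_right blinfun.bilinear_simps cinner_simps)+

lemma adj_id [simp]: "adj id_blinfun = id_blinfun" and adj_zero [simp]: "adj 0 = 0"
  by (rule adj_eqI; simp)+

lemma norm_adj_le: "norm (adj T) \<le> norm T" if T: "T \<in> bounded_ops"
proof (rule norm_blinfun_bound)
  fix y
  have "(norm (adj T y))\<^sup>2 = Re (cinner (T (adj T y)) y)"
    by (simp add: adj_right[OF T] Re_cinner_self)
  also have "\<dots> \<le> norm (T (adj T y)) * norm y" by (rule Re_cinner_le)
  also have "\<dots> \<le> norm T * norm (adj T y) * norm y" by (simp add: mult_right_mono norm_blinfun)
  finally have "norm (adj T y) * norm (adj T y) \<le> (norm T * norm y) * norm (adj T y)"
    by (simp add: power2_eq_square mult_ac)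
  then show "norm (adj T y) \<le> norm T * norm y"
    by (cases "norm (adj T y) = 0") (simp, metis mult_right_le_imp_le norm_ge_zero order_le_less)
qed simp

lemma adj_tendsto:
  assumes "\<And>n. X n \<in> bounded_ops" "T \<in> bounded_ops" "X \<longlonglongrightarrow> T"
  shows "(\<lambda>n. adj (X n)) \<longlonglongrightarrow> adj T"
proof (rule Lim_transform_bound[of "\<lambda>n. adj (X n) - adj T", THEN LIM_zero_cancel])
  show "\<forall>\<^sub>F n in sequentially. norm (adj (X n) - adj T) \<le> norm (X n - T)"
    using norm_adj_le[of "X _ - T"] assms by (simp add: adj_diff)
  show "(\<lambda>n. X n - T) \<longlonglongrightarrow> 0" using assms(3) by (rule LIM_zero)
qed

text \<open>The quadratic form at \<open>x + T x\<close>, minus its values at \<open>x\<close> and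
  at \<open>T x\<close>, leaves two cross terms, each equal to \<open>norm (T x) ^ 2\<close> by
  self-adjointness.\<close>

lemma self_adjoint_eq_zeroI:
  assumes T: "T \<in> bounded_ops" "adj T = T" and zero: "\<And>x. cinner (blinfun_apply T x) x = 0"
  shows "T = 0"
proof (rule blinfun_eqI)
  fix x
  have "cinner (T (x + T x)) (x + T x) - cinner (T x) x - cinner (T (T x)) (T x) = 0"
    by (simp add: zero)
  then have "cinner (T x) (T x) + cinner (T (T x)) x = 0"
    by (simp add: blinfun.bilinear_simps cinner_simps add.commute)
  then have "cinner (T x) (T x) = 0"
    using adj_left[OF T(1), of "T x" x] T(2) by (simp add: add.commute)
  then show "T x = blinfun_apply 0 x" by (simp add: cinner_self_eq_zero)
qed

subsection \<open>Composition and scalar multiples\<close>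

interpretation blinfun_compose: bounded_bilinear "(o\<^sub>L)"
  by (rule bounded_bilinear_blinfun_compose)

lemmas blinfun_compose_simps =
  blinfun_compose.add_left blinfun_compose.add_right
  blinfun_compose.diff_left blinfun_compose.diff_right
  blinfun_compose.minus_left blinfun_compose.minus_right
  blinfun_compose.scaleR_left blinfun_compose.scaleR_right

lemma blinfun_compose_assoc: "(a o\<^sub>L b) o\<^sub>L c = a o\<^sub>L (b o\<^sub>L c)"
  by (rule blinfun_eqI) simp

lemma blinfun_compose_id [simp]: "a o\<^sub>L id_blinfun = a" "id_blinfun o\<^sub>L a = a"
  by (rule blinfun_eqI; simp)+

lemma op_scale_simps:
  "op_scale c (S + T) = op_scale c S + op_scale c T"
  "op_scale (c + d) T = op_scale c T + op_scale d T"
  "op_scale c (op_scale d T) = op_scale (c * d) T"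
  "op_scale 1 T = T" "op_scale 0 T = 0" "op_scale c 0 = 0"
  by (rule blinfun_eqI;
      simp add: op_scale_apply blinfun.bilinear_simps scaleC_add_right scaleC_add_left scaleC_scaleC)+

lemma op_scale_minus_one: "op_scale (- 1) T = - T"
  using op_scale_simps(2)[of 1 "- 1" T] by (simp add: op_scale_simps eq_neg_iff_add_eq_0 add.commute)

lemma op_scale_compose_left: "op_scale c S o\<^sub>L T = op_scale c (S o\<^sub>L T)"
  by (rule blinfun_eqI) (simp add: op_scale_apply)

lemma op_scale_compose_right: "S \<in> bounded_ops \<Longrightarrow> S o\<^sub>L op_scale c T = op_scale c (S o\<^sub>L T)"
  by (rule blinfun_eqI) (simp add: op_scale_apply bounded_opsD)

lemma scaleR_op_scale: "r *\<^sub>R T = op_scale (of_real r) T"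
  by (rule blinfun_eqI) (simp add: op_scale_apply blinfun.bilinear_simps scaleR_scaleC)

lemma norm_op_scale: "norm (op_scale c T) = cmod c * norm T"
proof -
  have le: "norm (op_scale c T) \<le> cmod c * norm T" for c and T :: "'a op"
    by (rule norm_blinfun_bound)
      (simp_all add: op_scale_apply norm_scaleC mult.assoc mult_left_mono norm_blinfun)
  show ?thesis
  proof (cases "c = 0")
    case False
    have "norm T = norm (op_scale (1 / c) (op_scale c T))"
      using False by (simp add: op_scale_simps)
    also have "\<dots> \<le> norm (op_scale c T) / cmod c"
      using le[of "1 / c" "op_scale c T"] by (simp add: norm_divide)
    finally show ?thesis using le[of c T] False by (simp add: field_simps)
  qed (simp add: op_scale_simps)
qed

lemma bounded_linear_op_scale: "bounded_linear (op_scale c)"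
  by (rule bounded_linear_intro[where K = "cmod c"])
    (simp_all add: op_scale_simps scaleR_op_scale norm_op_scale mult.commute)

subsection \<open>The absolute value of a self-adjoint contraction\<close>

text \<open>Iterating \<open>q \<mapsto> (T + q\<^sup>2) / 2\<close> from \<open>0\<close> converges to the solution \<open>q = 1 - sqrt (1 - T)\<close> of
  \<open>(1 - q)\<^sup>2 = 1 - T\<close>; the increments are dominated by those of the scalar iteration with \<open>T = 1\<close>.\<close>

primrec sqrt_iter :: "('h::real_normed_vector \<Rightarrow>\<^sub>L 'h) \<Rightarrow> nat \<Rightarrow> 'h \<Rightarrow>\<^sub>L 'h" where
  "sqrt_iter T 0 = 0"
| "sqrt_iter T (Suc n) = (1/2) *\<^sub>R (T + (sqrt_iter T n o\<^sub>L sqrt_iter T n))"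

primrec sqrt_iter_bound :: "nat \<Rightarrow> real" where
  "sqrt_iter_bound 0 = 0"
| "sqrt_iter_bound (Suc n) = (1 + (sqrt_iter_bound n)\<^sup>2) / 2"

lemma sqrt_iter_bound_le_one: "0 \<le> sqrt_iter_bound n \<and> sqrt_iter_bound n \<le> 1"
  by (induction n) (auto simp: power_le_one)

lemma sqrt_iter_bound_convergent: "convergent sqrt_iter_bound"
proof (rule Bseq_monoseq_convergent)
  show "Bseq sqrt_iter_bound"
    using sqrt_iter_bound_le_one by (intro BseqI'[where K = 1]) (simp add: abs_le_iff)
  have "sqrt_iter_bound n \<le> sqrt_iter_bound (Suc n)" for n
    using zero_le_power2[of "1 - sqrt_iter_bound n"] by (simp add: power2_diff)
  then show "monoseq sqrt_iter_bound" by (simp add: incseq_SucI incseq_imp_monoseq)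
qed

context
  fixes T :: "'h::banach \<Rightarrow>\<^sub>L 'h"
  assumes T: "norm T \<le> 1"
begin

lemma norm_sqrt_iter_le: "norm (sqrt_iter T n) \<le> sqrt_iter_bound n"
proof (induction n)
  case (Suc n)
  let ?q = "sqrt_iter T n"
  have "norm (T + (?q o\<^sub>L ?q)) \<le> norm T + norm (?q o\<^sub>L ?q)"
    by (rule norm_triangle_ineq)
  also have "norm (?q o\<^sub>L ?q) \<le> norm ?q * norm ?q" by (rule norm_blinfun_compose)
  also have "\<dots> \<le> (sqrt_iter_bound n)\<^sup>2"
    unfolding power2_eq_square using Suc by (simp add: mult_mono sqrt_iter_bound_le_one)
  finally show ?case using T by simp
qed simp

text \<open>The factorisation \<open>r r - q q = r (r - q) + (r - q) q\<close> holds without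
  commutativity and reduces the estimate to the scalar identity
  \<open>t\<^sup>2 - s\<^sup>2 = t (t - s) + (t - s) s\<close>.\<close>

lemma norm_sqrt_iter_step:
  "norm (sqrt_iter T (Suc n) - sqrt_iter T n) \<le> sqrt_iter_bound (Suc n) - sqrt_iter_bound n"
proof (induction n)
  case 0
  then show ?case using T by simp
next
  case (Suc n)
  let ?q = "sqrt_iter T n" and ?r = "sqrt_iter T (Suc n)"
  let ?s = "sqrt_iter_bound n" and ?t = "sqrt_iter_bound (Suc n)"
  have "norm ((?r o\<^sub>L ?r) - (?q o\<^sub>L ?q)) = norm ((?r o\<^sub>L (?r - ?q)) + ((?r - ?q) o\<^sub>L ?q))"
    by (simp only: blinfun_compose_simps) simp
  also have "\<dots> \<le> norm ?r * norm (?r - ?q) + norm (?r - ?q) * norm ?q"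
    by (intro order_trans[OF norm_triangle_ineq] add_mono norm_blinfun_compose)
  also have "\<dots> \<le> ?t * (?t - ?s) + (?t - ?s) * ?s"
    using Suc norm_sqrt_iter_le sqrt_iter_bound_le_one order_trans[OF norm_ge_zero Suc]
    by (intro add_mono mult_mono) (simp_all del: sqrt_iter.simps sqrt_iter_bound.simps)
  also have "\<dots> = ?t\<^sup>2 - ?s\<^sup>2" by (simp add: power2_eq_square algebra_simps del: sqrt_iter_bound.simps)
  finally have "norm ((?r o\<^sub>L ?r) - (?q o\<^sub>L ?q)) \<le> ?t\<^sup>2 - ?s\<^sup>2" .
  moreover have "sqrt_iter T (Suc (Suc n)) - ?r = (1/2) *\<^sub>R ((?r o\<^sub>L ?r) - (?q o\<^sub>L ?q))"
    using arg_cong2[OF sqrt_iter.simps(2)[of T "Suc n"] sqrt_iter.simps(2)[of T n], of minus]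
    unfolding scaleR_diff_right[symmetric] add_diff_cancel_left .
  moreover have "sqrt_iter_bound (Suc (Suc n)) - ?t = (?t\<^sup>2 - ?s\<^sup>2) / 2"
    using sqrt_iter_bound.simps(2)[of "Suc n"] sqrt_iter_bound.simps(2)[of n] by argo
  ultimately show ?case by (simp del: sqrt_iter.simps sqrt_iter_bound.simps)
qed

lemma norm_sqrt_iter_diff:
  "norm (sqrt_iter T (n + j) - sqrt_iter T n) \<le> sqrt_iter_bound (n + j) - sqrt_iter_bound n"
proof (induction j)
  case (Suc j)
  then show ?case
    using norm_sqrt_iter_step[of "n + j"]
      norm_triangle_ineq[of "sqrt_iter T (Suc (n + j)) - sqrt_iter T (n + j)" "sqrt_iter T (n + j) - sqrt_iter T n"]
    by (simp del: sqrt_iter.simps sqrt_iter_bound.simps)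
qed simp

lemma sqrt_iter_tendsto: "sqrt_iter T \<longlonglongrightarrow> lim (sqrt_iter T)"
proof -
  have "Cauchy (sqrt_iter T)"
  proof (rule metric_CauchyI)
    fix e :: real assume "0 < e"
    then obtain M where M: "\<And>m n. m \<ge> M \<Longrightarrow> n \<ge> M \<Longrightarrow> dist (sqrt_iter_bound m) (sqrt_iter_bound n) < e"
      using convergent_Cauchy[OF sqrt_iter_bound_convergent] metric_CauchyD by metis
    have less: "dist (sqrt_iter T m) (sqrt_iter T n) < e" if "n \<ge> M" "m \<ge> n" for m n
      using norm_sqrt_iter_diff[of n "m - n"] M[of m n] that by (simp add: dist_norm)
    have "dist (sqrt_iter T m) (sqrt_iter T n) < e" if "n \<ge> M" "m \<ge> M" for m n
      using less[of n m] less[of m n] that by (cases "n \<le> m") (auto simp: dist_commute)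
    then show "\<exists>M. \<forall>m\<ge>M. \<forall>n\<ge>M. dist (sqrt_iter T m) (sqrt_iter T n) < e" by blast
  qed
  then show ?thesis by (simp add: Cauchy_convergent_iff convergent_LIMSEQ_iff)
qed

text \<open>The rate is the same for all contractions \<open>T\<close>; this uniformity makes
  \<open>op_abs\<close> continuous.\<close>

lemma dist_sqrt_iter_lim:
  "norm (lim (sqrt_iter T) - sqrt_iter T n) \<le> lim sqrt_iter_bound - sqrt_iter_bound n"
proof (rule LIMSEQ_le)
  show "(\<lambda>j. norm (sqrt_iter T (n + j) - sqrt_iter T n)) \<longlonglongrightarrow> norm (lim (sqrt_iter T) - sqrt_iter T n)"
    using LIMSEQ_ignore_initial_segment[OF sqrt_iter_tendsto, of n]
    by (intro tendsto_intros) (simp add: add.commute)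
  show "(\<lambda>j. sqrt_iter_bound (n + j) - sqrt_iter_bound n) \<longlonglongrightarrow> lim sqrt_iter_bound - sqrt_iter_bound n"
    using LIMSEQ_ignore_initial_segment[of sqrt_iter_bound "lim sqrt_iter_bound" n]
      sqrt_iter_bound_convergent
    by (intro tendsto_intros) (simp add: add.commute convergent_LIMSEQ_iff)
qed (use norm_sqrt_iter_diff in blast)

lemma norm_lim_sqrt_iter_le: "norm (lim (sqrt_iter T)) \<le> 1"
proof (rule LIMSEQ_le_const2)
  show "(\<lambda>n. norm (sqrt_iter T n)) \<longlonglongrightarrow> norm (lim (sqrt_iter T))"
    by (intro tendsto_intros sqrt_iter_tendsto)
  show "\<exists>N. \<forall>n\<ge>N. norm (sqrt_iter T n) \<le> 1"
    using norm_sqrt_iter_le sqrt_iter_bound_le_one order_trans by blast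
qed

lemma lim_sqrt_iter_eq:
  "lim (sqrt_iter T) = (1/2) *\<^sub>R (T + (lim (sqrt_iter T) o\<^sub>L lim (sqrt_iter T)))"
proof (rule LIMSEQ_unique)
  show "(\<lambda>n. sqrt_iter T (Suc n)) \<longlonglongrightarrow> lim (sqrt_iter T)"
    using LIMSEQ_Suc[OF sqrt_iter_tendsto] .
  show "(\<lambda>n. sqrt_iter T (Suc n)) \<longlonglongrightarrow> (1/2) *\<^sub>R (T + (lim (sqrt_iter T) o\<^sub>L lim (sqrt_iter T)))"
    unfolding sqrt_iter.simps
    by (intro tendsto_intros blinfun_compose.tendsto sqrt_iter_tendsto)
qed

end

text \<open>For a self-adjoint contraction this is the absolute value \<open>sqrt (k k)\<close>:
  with \<open>T = 1 - k k\<close> the limit \<open>q\<close> satisfies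
  \<open>(1 - q) (1 - q) = 1 - T = k k\<close>.\<close>

definition op_abs :: "('h::banach \<Rightarrow>\<^sub>L 'h) \<Rightarrow> 'h \<Rightarrow>\<^sub>L 'h" where
  "op_abs k = id_blinfun - lim (sqrt_iter (id_blinfun - (k o\<^sub>L k)))"

text \<open>Used along the path \<open>t \<mapsto> h - t\<close>, where connectedness finds the
  scalar to which \<open>h\<close> is congruent modulo a maximal ideal.\<close>

lemma continuous_on_op_abs:
  "continuous_on {k :: 'h::banach \<Rightarrow>\<^sub>L 'h. norm (id_blinfun - (k o\<^sub>L k)) \<le> 1} op_abs"
proof -
  let ?K = "{k :: 'h \<Rightarrow>\<^sub>L 'h. norm (id_blinfun - (k o\<^sub>L k)) \<le> 1}"
  let ?T = "\<lambda>k :: 'h \<Rightarrow>\<^sub>L 'h. id_blinfun - (k o\<^sub>L k)"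
  have "uniform_limit ?K (\<lambda>n k. sqrt_iter (?T k) n) (\<lambda>k. lim (sqrt_iter (?T k))) sequentially"
  proof (rule uniform_limitI)
    fix e :: real assume "0 < e"
    then have "\<forall>\<^sub>F n in sequentially. dist (sqrt_iter_bound n) (lim sqrt_iter_bound) < e"
      using sqrt_iter_bound_convergent by (simp add: convergent_LIMSEQ_iff tendstoD)
    then show "\<forall>\<^sub>F n in sequentially. \<forall>k\<in>?K. dist (sqrt_iter (?T k) n) (lim (sqrt_iter (?T k))) < e"
    proof (eventually_elim, intro ballI)
      fix n k assume n: "dist (sqrt_iter_bound n) (lim sqrt_iter_bound) < e" and "k \<in> ?K"
      then show "dist (sqrt_iter (?T k) n) (lim (sqrt_iter (?T k))) < e"
        using dist_sqrt_iter_lim[of "?T k" n] by (simp add: dist_norm norm_minus_commute)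
    qed
  qed
  moreover have "continuous_on ?K (\<lambda>k. sqrt_iter (?T k) n)" for n
    by (induction n) (auto intro!: continuous_intros blinfun_compose.continuous_on)
  ultimately have "continuous_on ?K (\<lambda>k. lim (sqrt_iter (?T k)))"
    by (intro uniform_limit_theorem[where F = sequentially]) auto
  then show ?thesis unfolding op_abs_def by (intro continuous_intros)
qed

text \<open>\<open>norm (v - k (k v)) ^ 2\<close> expands to
  \<open>norm v ^ 2 - 2 * norm (k v) ^ 2 + norm (k (k v)) ^ 2\<close>, whose last term is at most
  \<open>norm (k v) ^ 2\<close>. Hence the iteration may be run with
  \<open>T = 1 - k k\<close>.\<close>

lemma self_adjoint_contraction_compl:
  fixes k :: "('h::complex_hilbert_space) op"
  assumes k: "k \<in> bounded_ops" "adj k = k" "norm k \<le> 1"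
  shows "norm (id_blinfun - (k o\<^sub>L k)) \<le> 1"
proof (rule norm_blinfun_bound)
  fix v
  have contr: "norm (k w) \<le> norm w" for w
    using norm_blinfun[of k w] k(3) by (meson mult_left_le_one_le norm_ge_zero order_trans)
  have "(norm (v - k (k v)))\<^sup>2 = (norm v)\<^sup>2 - 2 * (norm (k v))\<^sup>2 + (norm (k (k v)))\<^sup>2"
    using adj_right[OF k(1), of v "k v"] k(2) Re_cinner_self[of "k v"] by (simp add: norm_diff_sq)
  also have "\<dots> \<le> (norm v)\<^sup>2"
    using power_mono[OF contr[of "k v"] norm_ge_zero, of 2] zero_le_power2[of "norm (k v)"]
    by linarith
  finally have "norm (v - k (k v)) \<le> norm v" by (rule power2_le_imp_le) simp
  then show "norm ((id_blinfun - (k o\<^sub>L k)) v) \<le> 1 * norm v"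
    by (simp add: blinfun.bilinear_simps)
qed simp

context
  fixes k :: "('h::complex_hilbert_space) op"
  assumes k: "k \<in> bounded_ops" "adj k = k" "norm k \<le> 1"
begin

lemma op_abs_sq: "op_abs k o\<^sub>L op_abs k = k o\<^sub>L k"
proof -
  define q where "q = lim (sqrt_iter (id_blinfun - (k o\<^sub>L k)))"
  have "2 *\<^sub>R q = 2 *\<^sub>R ((1/2) *\<^sub>R (id_blinfun - (k o\<^sub>L k) + (q o\<^sub>L q)))"
    using lim_sqrt_iter_eq[OF self_adjoint_contraction_compl[OF k]] by (simp add: q_def)
  then have q: "2 *\<^sub>R q = id_blinfun - (k o\<^sub>L k) + (q o\<^sub>L q)" by simp
  show ?thesis unfolding op_abs_def q_def[symmetric]
  proof (rule blinfun_eqI)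
    fix x
    have "2 *\<^sub>R q x = x - k (k x) + q (q x)"
      using arg_cong[OF q, of "\<lambda>T. blinfun_apply T x"] by (simp add: blinfun.bilinear_simps)
    then show "blinfun_apply ((id_blinfun - q) o\<^sub>L (id_blinfun - q)) x = (k o\<^sub>L k) x"
      by (simp add: blinfun.bilinear_simps algebra_simps scaleR_2)
  qed
qed

text \<open>Positivity of the absolute value is used in this form: it makes characters nonnegative
  at \<open>op_abs k\<close>, and it gives
  \<open>norm (m w) ^ 2 \<le> 2 * Re (cinner (m w) w)\<close> for
  \<open>m = op_abs k\<close>.\<close>

lemma norm_one_minus_op_abs: "norm (id_blinfun - op_abs k) \<le> 1"
  unfolding op_abs_def
  using norm_lim_sqrt_iter_le[OF self_adjoint_contraction_compl[OF k]] by simp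

text \<open>An induction principle along the iteration, applied to the algebra, to commutants and to
  the self-adjoint operators. The last set is closed under squares but not under products, hence the
  premise on \<open>a o\<^sub>L a\<close>.\<close>

lemma op_abs_mem:
  assumes "closed S" "id_blinfun \<in> S" "0 \<in> S" "k o\<^sub>L k \<in> S"
    and "\<And>a b. a \<in> S \<Longrightarrow> b \<in> S \<Longrightarrow> a + b \<in> S" "\<And>a b. a \<in> S \<Longrightarrow> b \<in> S \<Longrightarrow> a - b \<in> S"
    and "\<And>a. a \<in> S \<Longrightarrow> a o\<^sub>L a \<in> S" "\<And>a. a \<in> S \<Longrightarrow> (1/2) *\<^sub>R a \<in> S"
  shows "op_abs k \<in> S"
proof -
  have "sqrt_iter (id_blinfun - (k o\<^sub>L k)) n \<in> S" for n
    by (induction n) (use assms in auto)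
  then have "lim (sqrt_iter (id_blinfun - (k o\<^sub>L k))) \<in> S"
    using closed_sequentially[OF assms(1)] sqrt_iter_tendsto[OF self_adjoint_contraction_compl[OF k]]
    by blast
  then show ?thesis unfolding op_abs_def using assms by blast
qed

lemma op_abs_commutes: "E o\<^sub>L op_abs k = op_abs k o\<^sub>L E" if E: "E o\<^sub>L k = k o\<^sub>L E"
proof -
  have "op_abs k \<in> {T. E o\<^sub>L T = T o\<^sub>L E}"
  proof (rule op_abs_mem)
    show "closed {T. E o\<^sub>L T = T o\<^sub>L E}"
      by (intro closed_Collect_eq continuous_intros blinfun_compose.continuous_on)
    have comm: "E o\<^sub>L (a o\<^sub>L b) = (a o\<^sub>L b) o\<^sub>L E" if "E o\<^sub>L a = a o\<^sub>L E" "E o\<^sub>L b = b o\<^sub>L E" for a b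
      by (metis blinfun_compose_assoc that)
    show "k o\<^sub>L k \<in> {T. E o\<^sub>L T = T o\<^sub>L E}" using comm[OF E E] by simp
    show "a o\<^sub>L a \<in> {T. E o\<^sub>L T = T o\<^sub>L E}" if "a \<in> {T. E o\<^sub>L T = T o\<^sub>L E}" for a
      using comm[of a a] that by simp
  qed (auto simp: blinfun_compose_simps intro!: blinfun_eqI)
  then show ?thesis by simp
qed

lemma op_abs_self_adjoint: "op_abs k \<in> bounded_ops \<and> adj (op_abs k) = op_abs k"
proof -
  let ?S = "{T \<in> bounded_ops. adj T = T} :: 'h op set"
  have "closed ?S"
    unfolding closed_sequential_limits
  proof safe
    fix X :: "nat \<Rightarrow> 'h op" and T assume X: "\<forall>n. X n \<in> ?S" and lim: "X \<longlonglongrightarrow> T"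
    show T: "T \<in> bounded_ops"
      using closed_sequentially[OF closed_bounded_ops _ lim] X by blast
    have "(\<lambda>n. adj (X n)) \<longlonglongrightarrow> adj T"
      by (rule adj_tendsto) (use X T lim in auto)
    then show "adj T = T" using X lim LIMSEQ_unique by auto
  qed
  then have "op_abs k \<in> ?S"
    by (rule op_abs_mem)
      (use k in \<open>auto simp: adj_add adj_diff adj_compose scaleR_op_scale adj_op_scale\<close>)
  then show ?thesis by simp
qed

text \<open>If \<open>k \<le> 0\<close> on the range of a projection \<open>E\<close> commuting with \<open>k\<close>, then the positive part of \<open>k\<close>
  vanishes there: for \<open>w\<close> in the range of \<open>E (\<bar>k\<bar> + k)\<close> one has \<open>(\<bar>k\<bar> - k) w = 0\<close>, hence
  \<open>\<langle>\<bar>k\<bar> w, w\<rangle> = \<langle>k w, w\<rangle> = 0\<close>.\<close>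

lemma positive_part_eq_zero:
  assumes E: "E \<in> bounded_ops" "adj E = E" "E o\<^sub>L E = E" "E o\<^sub>L k = k o\<^sub>L E"
    and neg: "\<And>v. Re (cinner (k (blinfun_apply E v)) (E v)) \<le> 0"
  shows "E o\<^sub>L (op_abs k + k) = 0"
proof (rule blinfun_eqI)
  fix v
  define m where "m = op_abs k"
  have m: "m \<in> bounded_ops" "adj m = m" using op_abs_self_adjoint by (auto simp: m_def)
  have mm: "m (m x) = k (k x)" for x
    using arg_cong[OF op_abs_sq, of "\<lambda>T. blinfun_apply T x"] by (simp add: m_def)
  have km: "k (m x) = m (k x)" for x
    using arg_cong[OF op_abs_commutes[of k], of "\<lambda>T. blinfun_apply T x"] by (simp add: m_def)
  have Ek: "E (k x) = k (E x)" for x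
    using arg_cong[OF E(4), of "\<lambda>T. blinfun_apply T x"] by simp
  have Em: "E (m x) = m (E x)" for x
    using arg_cong[OF op_abs_commutes[OF E(4)], of "\<lambda>T. blinfun_apply T x"] by (simp add: m_def)
  have EE: "E (E x) = E x" for x
    using arg_cong[OF E(3), of "\<lambda>T. blinfun_apply T x"] by simp
  define w where "w = E (m v + k v)"
  have Ew: "E w = w" by (simp add: w_def EE)
  have mkw: "m w = k w"
    unfolding w_def Ek[symmetric] Em[symmetric] by (simp add: blinfun.bilinear_simps mm km add.commute)
  define q where "q = id_blinfun - m"
  have "norm (q w) \<le> norm w"
    using norm_blinfun[of q w] norm_one_minus_op_abs
    by (metis m_def mult_left_le_one_le norm_ge_zero order_trans q_def)
  then have "(norm (q w))\<^sup>2 \<le> (norm w)\<^sup>2" by simp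
  moreover have "Re (cinner (m w) w) \<le> 0" using neg[of w] by (simp add: Ew mkw)
  moreover have qw: "q w = w - m w" by (simp add: q_def blinfun.bilinear_simps)
  ultimately have "(norm (m w))\<^sup>2 \<le> 0"
    using Re_cinner_commute[of w "m w"] unfolding qw norm_diff_sq by linarith
  then have "m w = 0" by simp
  then have "m w + k w = 0" using mkw by simp
  moreover have "cinner w w = cinner v (m w + k w)"
  proof -
    have "cinner w w = cinner (m v + k v) w"
      using adj_left[OF E(1), of "m v + k v" w] by (simp add: E(2) Ew flip: w_def)
    also have "\<dots> = cinner v (m w + k w)"
      using adj_left[OF m(1), of v w] adj_left[OF k(1), of v w]
      by (simp only: m(2) k(2) cinner_add_left cinner_add_right)
    finally show ?thesis .
  qed
  ultimately have "cinner w w = 0" by simp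
  then show "blinfun_apply (E o\<^sub>L (op_abs k + k)) v = blinfun_apply 0 v"
    by (simp add: cinner_self_eq_zero w_def m_def blinfun.bilinear_simps)
qed

text \<open>Up to a factor 1/2 these are the positive and negative parts of \<open>k\<close>. Their
  orthogonality separates characters, and it lets a prime ideal choose one of the two parts.\<close>

lemma op_abs_diff_mult: "(op_abs k + k) o\<^sub>L (op_abs k - k) = 0"
proof -
  have "op_abs k o\<^sub>L k = k o\<^sub>L op_abs k" using op_abs_commutes[of k] by simp
  then show ?thesis by (simp add: blinfun_compose_simps op_abs_sq)
qed

end

lemma op_abs_minus: "op_abs (- k) = op_abs k"
  by (simp add: op_abs_def blinfun_compose_simps)

section \<open>Characters of a commutative algebra\<close>

lemma self_adjoint_Re_cinner_le:
  "\<bar>Re (cinner (h v) v)\<bar> \<le> norm h * (norm v)\<^sup>2" for h :: "('h::complex_hilbert_space) op"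
proof -
  have "\<bar>Re (cinner (h v) v)\<bar> \<le> norm (h v) * norm v"
    using Re_cinner_le[of "h v" v] Re_cinner_le[of "- h v" v] by (simp add: cinner_minus_left)
  also have "\<dots> \<le> norm h * norm v * norm v" by (simp add: mult_right_mono norm_blinfun)
  finally show ?thesis by (simp add: power2_eq_square)
qed

locale comm_cstar =
  fixes A :: "('h::complex_hilbert_space) op set"
  assumes comm_cstar: "unital_comm_cstar_algebra A"
begin

lemma mem:
  shows id_mem [simp, intro]: "id_blinfun \<in> A"
    and zero_mem [simp, intro]: "0 \<in> A"
    and add_mem [simp, intro]: "a \<in> A \<Longrightarrow> b \<in> A \<Longrightarrow> a + b \<in> A"
    and compose_mem [simp, intro]: "a \<in> A \<Longrightarrow> b \<in> A \<Longrightarrow> a o\<^sub>L b \<in> A"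
    and adj_mem [simp, intro]: "a \<in> A \<Longrightarrow> adj a \<in> A"
    and op_scale_mem [simp, intro]: "a \<in> A \<Longrightarrow> op_scale c a \<in> A"
    and closed_alg: "closed A"
    and mem_bounded_ops [simp]: "a \<in> A \<Longrightarrow> a \<in> bounded_ops"
    and compose_comm: "a \<in> A \<Longrightarrow> b \<in> A \<Longrightarrow> a o\<^sub>L b = b o\<^sub>L a"
  using comm_cstar
  unfolding unital_comm_cstar_algebra_def cstar_algebra_def op_subspace_def by blast+

lemma minus_mem [simp, intro]: "a \<in> A \<Longrightarrow> - a \<in> A"
  using op_scale_mem[of a "- 1"] by (simp add: op_scale_minus_one)

lemma diff_mem [simp, intro]: "a \<in> A \<Longrightarrow> b \<in> A \<Longrightarrow> a - b \<in> A"
  using add_mem[of a "- b"] by simp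

lemma scaleR_mem [simp, intro]: "a \<in> A \<Longrightarrow> r *\<^sub>R a \<in> A"
  by (simp add: scaleR_op_scale)

lemma self_adjoint_decomposition:
  assumes a: "a \<in> A"
  obtains h k where "h \<in> A" "adj h = h" "k \<in> A" "adj k = k" "a = h + op_scale \<i> k"
    "adj a = h - op_scale \<i> k"
proof
  let ?h = "op_scale (1/2) (a + adj a)" and ?k = "op_scale (- \<i>/2) (a - adj a)"
  show "?h \<in> A" "?k \<in> A" using a by auto
  show "adj ?h = ?h" using a by (simp add: adj_op_scale adj_add add.commute)
  have "adj ?k = op_scale (\<i>/2) (adj a - a)" using a by (simp add: adj_op_scale adj_diff)
  also have "\<dots> = op_scale (\<i>/2) (op_scale (- 1) (a - adj a))" by (simp add: op_scale_minus_one)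
  also have "\<dots> = ?k" by (simp add: op_scale_simps)
  finally show "adj ?k = ?k" .
  have half: "op_scale (1/2) b + op_scale (1/2) b = b" for b :: "'h op"
    by (simp flip: op_scale_simps(2)) (simp add: op_scale_simps)
  have "op_scale (1/2) (a - adj a) = op_scale \<i> ?k" by (simp add: op_scale_simps(3))
  moreover have "a = op_scale (1/2) (a + adj a) + op_scale (1/2) (a - adj a)"
    using half[of a] by (simp flip: op_scale_simps(1))
  moreover have "adj a = op_scale (1/2) (a + adj a) - op_scale (1/2) (a - adj a)"
  proof -
    have "op_scale (1/2) (a + adj a) = op_scale (1/2) (a - adj a) + op_scale (1/2) (adj a + adj a)"
      by (simp flip: op_scale_simps(1))
    then show ?thesis using half[of "adj a"] by (simp add: op_scale_simps(1))
  qed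
  ultimately show "a = ?h + op_scale \<i> ?k" "adj a = ?h - op_scale \<i> ?k" by simp_all
qed

lemma op_abs_mem_alg [simp, intro]:
  "k \<in> A \<Longrightarrow> adj k = k \<Longrightarrow> norm k \<le> 1 \<Longrightarrow> op_abs k \<in> A"
  by (rule op_abs_mem) (auto intro: closed_alg)

text \<open>The Neumann series, obtained as a fixed point: \<open>1 + c\<close> is the inverse of \<open>1 - b\<close>.\<close>

lemma neumann:
  assumes b: "b \<in> A" "norm b < 1"
  obtains c where "c \<in> A" "c = b + (b o\<^sub>L c)"
proof -
  have "\<exists>!c\<in>A. b + (b o\<^sub>L c) = c"
  proof (rule Banach_fix)
    show "complete A" by (simp add: closed_alg complete_eq_closed)
    show "(\<lambda>c. b + (b o\<^sub>L c)) ` A \<subseteq> A" using b by auto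
    fix c d :: "'h op"
    show "dist (b + (b o\<^sub>L c)) (b + (b o\<^sub>L d)) \<le> norm b * dist c d"
      using norm_blinfun_compose[of b "c - d"] by (simp add: dist_norm blinfun_compose_simps)
  qed (use b in auto)
  then show thesis using that by metis
qed

subsection \<open>Basic properties of characters\<close>

context
  fixes x
  assumes x: "x \<in> characters A"
begin

lemma char_add: "a \<in> A \<Longrightarrow> b \<in> A \<Longrightarrow> x (a + b) = x a + x b"
  and char_scale: "a \<in> A \<Longrightarrow> x (op_scale c a) = c * x a"
  and char_mult: "a \<in> A \<Longrightarrow> b \<in> A \<Longrightarrow> x (a o\<^sub>L b) = x a * x b"
  and char_nonzero: "\<exists>a\<in>A. x a \<noteq> 0"
  and char_extensional: "x \<in> extensional A"
  using x unfolding characters_def by blast+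

lemma char_zero: "x 0 = 0"
  using char_scale[of 0 0] by (simp add: op_scale_simps)

lemma char_one: "x id_blinfun = 1"
proof -
  obtain a where "a \<in> A" "x a \<noteq> 0" using char_nonzero by blast
  then show ?thesis using char_mult[of a id_blinfun] by simp
qed

lemma char_minus: "a \<in> A \<Longrightarrow> x (- a) = - x a"
  using char_scale[of a "- 1"] by (simp add: op_scale_minus_one)

lemma char_diff: "a \<in> A \<Longrightarrow> b \<in> A \<Longrightarrow> x (a - b) = x a - x b"
  using char_add[of a "- b"] by (simp add: char_minus)

lemma char_scaleR: "a \<in> A \<Longrightarrow> x (r *\<^sub>R a) = r * x a"
  by (simp add: scaleR_op_scale char_scale)

text \<open>Continuity is automatic: otherwise \<open>b = a / x a\<close> has norm below 1 and
  \<open>x b = 1\<close>, and applying \<open>x\<close> to the Neumann equation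
  \<open>c = b + b c\<close> gives \<open>x c = 1 + x c\<close>.\<close>

lemma char_bound: "a \<in> A \<Longrightarrow> cmod (x a) \<le> norm a"
proof (rule ccontr)
  assume a: "a \<in> A" and "\<not> cmod (x a) \<le> norm a"
  then have less: "norm a < cmod (x a)" by simp
  then have nz: "x a \<noteq> 0" by auto
  define b where "b = op_scale (1 / x a) a"
  have b: "b \<in> A" "norm b < 1" "x b = 1"
    using a less nz by (simp_all add: b_def norm_op_scale norm_divide char_scale divide_less_eq)
  obtain c where "c \<in> A" "c = b + (b o\<^sub>L c)" using neumann[OF b(1,2)] .
  then have "x c = 1 + x c" using b char_add char_mult by (metis compose_mem mult_1)
  then show False by simp
qed

text \<open>Arens' argument: adding \<open>\<i> * t\<close> to \<open>h\<close> raises the squared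
  norm by at most \<open>t\<^sup>2\<close>, whereas the squared modulus of the value also gains
  \<open>2 * Im (x h) * t\<close>, which is unbounded in \<open>t\<close>.\<close>

lemma char_self_adjoint:
  assumes h: "h \<in> A" "adj h = h"
  shows "Im (x h) = 0"
proof (rule ccontr)
  assume nz: "Im (x h) \<noteq> 0"
  have *: "(Re (x h))\<^sup>2 + (Im (x h) + t)\<^sup>2 \<le> (norm h)\<^sup>2 + t\<^sup>2" for t :: real
  proof -
    let ?g = "h + op_scale (\<i> * t) id_blinfun"
    have "norm ?g \<le> sqrt ((norm h)\<^sup>2 + t\<^sup>2)"
    proof (rule norm_blinfun_bound)
      fix v
      have "Im (cinner (h v) v) = 0"
        using adj_left[of h v v] h cinner_commute[of "h v" v]
        by (metis cnj.simps(2) equal_neg_zero mem_bounded_ops)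
      then have "(norm (?g v))\<^sup>2 = (norm (h v))\<^sup>2 + t\<^sup>2 * (norm v)\<^sup>2"
        by (simp add: blinfun.bilinear_simps op_scale_apply norm_add_sq cinner_scaleC_right norm_scaleC
            norm_mult power_mult_distrib)
      also have "\<dots> \<le> (norm h * norm v)\<^sup>2 + t\<^sup>2 * (norm v)\<^sup>2"
        by (intro add_mono power_mono norm_blinfun) auto
      also have "\<dots> = (sqrt ((norm h)\<^sup>2 + t\<^sup>2) * norm v)\<^sup>2"
        by (simp add: power_mult_distrib algebra_simps)
      finally show "norm (?g v) \<le> sqrt ((norm h)\<^sup>2 + t\<^sup>2) * norm v"
        by (rule power2_le_imp_le) simp
    qed simp
    then have "cmod (x ?g) \<le> sqrt ((norm h)\<^sup>2 + t\<^sup>2)"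
      using char_bound[of ?g] h by (meson add_mem id_mem op_scale_mem order_trans)
    then have "(cmod (x ?g))\<^sup>2 \<le> (norm h)\<^sup>2 + t\<^sup>2"
      by (simp add: real_le_rsqrt sqrt_ge_absD)
    moreover have "x ?g = x h + \<i> * t"
      using h by (simp add: char_add char_scale char_one)
    ultimately show ?thesis by (simp add: cmod_power2)
  qed
  \<comment> \<open>Chosen so that the linear gain \<open>2 * Im (x h) * t\<close> exceeds
    \<open>(norm h)\<^sup>2\<close>.\<close>
  define t where "t = ((norm h)\<^sup>2 + 1) / Im (x h)"
  have "(Re (x h))\<^sup>2 + (Im (x h))\<^sup>2 + 2 * (Im (x h) * t) \<le> (norm h)\<^sup>2"
    using *[of t] by (simp add: power2_sum)
  moreover have "Im (x h) * t = (norm h)\<^sup>2 + 1" using nz by (simp add: t_def)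
  ultimately show False
    using zero_le_power2[of "Re (x h)"] zero_le_power2[of "Im (x h)"] zero_le_power2[of "norm h"]
    by linarith
qed

lemma char_adj:
  assumes a: "a \<in> A"
  shows "x (adj a) = cnj (x a)"
proof -
  obtain h k where hk: "h \<in> A" "adj h = h" "k \<in> A" "adj k = k" "a = h + op_scale \<i> k"
    "adj a = h - op_scale \<i> k"
    using self_adjoint_decomposition[OF a] .
  have "x a = x h + \<i> * x k" unfolding hk(5) using hk(1,3) by (simp add: char_add char_scale)
  moreover have "x (adj a) = x h - \<i> * x k"
    unfolding hk(6) using hk(1,3) by (simp add: char_diff char_scale)
  ultimately show ?thesis
    using char_self_adjoint hk(1-4) by (simp add: complex_eq_iff)
qed

text \<open>The square of the value is known from \<open>op_abs_sq\<close>; the sign is fixed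
  because \<open>1 - op_abs k\<close> is a contraction.\<close>

lemma char_op_abs:
  assumes k: "k \<in> A" "adj k = k" "norm k \<le> 1"
  shows "x (op_abs k) = of_real \<bar>Re (x k)\<bar>"
proof -
  have m: "op_abs k \<in> A" using k by simp
  have k': "k \<in> bounded_ops" using k by simp
  have "Im (x (op_abs k)) = 0"
    using op_abs_self_adjoint[OF k' k(2,3)] m by (intro char_self_adjoint) auto
  then have re: "x (op_abs k) = of_real (Re (x (op_abs k)))" by (simp add: complex_eq_iff)
  have rek: "x k = of_real (Re (x k))" using char_self_adjoint k by (simp add: complex_eq_iff)
  have "cmod (x (id_blinfun - op_abs k)) \<le> 1"
    using char_bound[of "id_blinfun - op_abs k"] norm_one_minus_op_abs[OF k' k(2,3)] m
    by (meson diff_mem id_mem order_trans)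
  then have "cmod (1 - x (op_abs k)) \<le> 1" using m by (simp add: char_diff char_one)
  then have "0 \<le> Re (x (op_abs k))"
    using complex_Re_le_cmod[of "1 - x (op_abs k)"] by simp
  moreover have "x (op_abs k) * x (op_abs k) = x k * x k"
    using op_abs_sq[OF k' k(2,3)] m k by (simp flip: char_mult)
  then have "(Re (x (op_abs k)))\<^sup>2 = (Re (x k))\<^sup>2"
    by (subst (asm) (1 2) re, subst (asm) (1 2) rek) (simp flip: of_real_mult add: power2_eq_square)
  ultimately have "Re (x (op_abs k)) = \<bar>Re (x k)\<bar>"
    by (metis abs_of_nonneg power2_eq_iff abs_minus_cancel)
  then show ?thesis using re by simp
qed

text \<open>Otherwise \<open>x h = 1\<close> and \<open>h E \<le> r E\<close> for some positive \<open>h\<close> and \<open>r < 1\<close>; the positive part of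
  \<open>h - r\<close> then lies in the ideal \<open>{a. E a = 0}\<close> without being annihilated by \<open>x\<close>.\<close>

lemma char_bound_projection:
  assumes E: "E \<in> bounded_ops" "adj E = E" "E o\<^sub>L E = E" "\<And>a. a \<in> A \<Longrightarrow> E o\<^sub>L a = a o\<^sub>L E"
    and van: "\<And>a. a \<in> A \<Longrightarrow> E o\<^sub>L a = 0 \<Longrightarrow> x a = 0"
    and a: "a \<in> A"
  shows "cmod (x a) \<le> norm (E o\<^sub>L a)"
proof (rule ccontr)
  assume "\<not> ?thesis"
  then have less: "norm (E o\<^sub>L a) < cmod (x a)" by simp
  define s where "s = (norm (E o\<^sub>L a))\<^sup>2"
  define d where "d = (cmod (x a))\<^sup>2"
  have sd: "s < d" unfolding s_def d_def by (rule power_strict_mono) (use less in auto)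
  define g where "g = (adj a o\<^sub>L a) - s *\<^sub>R id_blinfun"
  have g: "g \<in> A" "adj g = g"
    using a by (auto simp: g_def adj_diff adj_compose scaleR_op_scale adj_op_scale)
  \<comment> \<open>Scaling makes \<open>k\<close> a contraction, as \<open>op_abs\<close> requires;
    the summand 1 keeps \<open>r\<close> meaningful for \<open>g = 0\<close>.\<close>
  define r where "r = 1 / (norm g + 1)"
  have r: "0 < r" unfolding r_def by (smt (verit) norm_ge_zero zero_less_divide_1_iff)
  define k where "k = r *\<^sub>R g"
  have k: "k \<in> A" "adj k = k" using g by (auto simp: k_def scaleR_op_scale adj_op_scale)
  have "norm k = norm g / (norm g + 1)" using r by (simp add: k_def r_def)
  then have nk: "norm k \<le> 1"
    by (simp add: divide_le_eq_1_pos add_nonneg_pos)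
  have "x g = of_real (d - s)"
    using a complex_norm_square[of "x a"]
    by (simp add: g_def char_diff char_mult char_scaleR char_one char_adj d_def mult.commute)
  then have xk: "x k = of_real (r * (d - s))" using g by (simp add: k_def char_scaleR)
  have pos: "0 < r * (d - s)" using r sd by simp
  have "E o\<^sub>L (op_abs k + k) = 0"
  proof (rule positive_part_eq_zero)
    fix v
    have Ea: "E (a u) = a (E u)" for u
      using arg_cong[OF E(4)[OF a], of "\<lambda>T. blinfun_apply T u"] by simp
    have EE: "E (E u) = E u" for u
      using arg_cong[OF E(3), of "\<lambda>T. blinfun_apply T u"] by simp
    \<comment> \<open>On the range of \<open>E\<close> the form of \<open>g\<close> is
      \<open>norm (a w) ^ 2 - s * norm w ^ 2\<close>, and \<open>s\<close> is the squared norm of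
      \<open>E o\<^sub>L a\<close>, so the form is nonpositive there.\<close>
    have "Re (cinner (g (E v)) (E v)) = (norm (a (E v)))\<^sup>2 - s * (norm (E v))\<^sup>2"
      using adj_left[of a "a (E v)" "E v"] a
      by (simp add: g_def blinfun.bilinear_simps cinner_simps Re_cinner_self)
    also have "a (E v) = (E o\<^sub>L a) (E v)" by (simp add: Ea EE)
    also have "(norm ((E o\<^sub>L a) (E v)))\<^sup>2 \<le> (norm (E o\<^sub>L a) * norm (E v))\<^sup>2"
      by (intro power_mono norm_blinfun) simp
    finally have "Re (cinner (g (E v)) (E v)) \<le> 0" by (simp add: s_def power_mult_distrib)
    then show "Re (cinner (k (E v)) (E v)) \<le> 0"
      using r by (simp add: k_def blinfun.bilinear_simps cinner_simps mult_le_0_iff)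
  qed (use k nk E in auto)
  then have "x (op_abs k + k) = 0" using van k nk by auto
  moreover have "x (op_abs k + k) = of_real (2 * (r * (d - s)))"
    using k nk pos by (simp add: char_add char_op_abs xk)
  ultimately show False using pos by (simp only: of_real_eq_0_iff)
qed

end

text \<open>Some self-adjoint \<open>h\<close> has different values at \<open>x\<close> and
  \<open>y\<close>. Subtracting their midpoint \<open>s\<close> and rescaling turns the values into
  \<open>t\<close> and \<open>- t\<close>, so the orthogonal positive and negative parts are each
  seen by one of the two characters.\<close>

lemma characters_separated:
  assumes x: "x \<in> characters A" and y: "y \<in> characters A" and neq: "x \<noteq> y"
  obtains a b where "a \<in> A" "b \<in> A" "a o\<^sub>L b = 0" "x a \<noteq> 0" "y b \<noteq> 0"
proof -
  have "\<exists>h\<in>A. adj h = h \<and> x h \<noteq> y h"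
  proof (rule ccontr)
    assume no: "\<not> ?thesis"
    have "x a = y a" if "a \<in> A" for a
      using self_adjoint_decomposition[OF that] no
      by (metis char_add[OF x] char_add[OF y] char_scale[OF x] char_scale[OF y] op_scale_mem)
    then have "x = y"
      using char_extensional[OF x] char_extensional[OF y] by (intro extensionalityI) auto
    with neq show False by simp
  qed
  then obtain h where h: "h \<in> A" "adj h = h" "x h \<noteq> y h" by blast
  define s where "s = (Re (x h) + Re (y h)) / 2"
  define g where "g = h - s *\<^sub>R id_blinfun"
  have g: "g \<in> A" "adj g = g"
    using h by (auto simp: g_def adj_diff scaleR_op_scale adj_op_scale)
  define r where "r = 1 / (norm g + 1)"
  have r: "0 < r" unfolding r_def by (smt (verit) norm_ge_zero zero_less_divide_1_iff)
  define k where "k = r *\<^sub>R g"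
  have k: "k \<in> A" "adj k = k" using g by (auto simp: k_def scaleR_op_scale adj_op_scale)
  have "norm k = norm g / (norm g + 1)" using r by (simp add: k_def r_def)
  then have nk: "norm k \<le> 1" by (simp add: divide_le_eq_1_pos add_nonneg_pos)
  define t where "t = r * ((Re (x h) - Re (y h)) / 2)"
  have xh: "x h = of_real (Re (x h))" "y h = of_real (Re (y h))"
    using char_self_adjoint[OF x h(1,2)] char_self_adjoint[OF y h(1,2)] by (simp_all add: complex_eq_iff)
  have "x k = of_real (r * (Re (x h) - s))" "y k = of_real (r * (Re (y h) - s))"
    using g h xh by (simp_all add: k_def g_def char_scaleR char_diff char_one x y)
  then have xk: "x k = of_real t" "y k = of_real (- t)"
    by (simp_all only: t_def s_def) (simp_all add: field_simps)
  have t: "t \<noteq> 0" using h(3) xh r by (simp add: t_def) metis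
  let ?p = "op_abs k + k" and ?m = "op_abs k - k"
  have mem: "?p \<in> A" "?m \<in> A" using k nk by auto
  have k': "k \<in> bounded_ops" using k by simp
  have pm: "?p o\<^sub>L ?m = 0" by (rule op_abs_diff_mult[OF k' k(2) nk])
  have val: "x ?p = of_real (\<bar>t\<bar> + t)" "x ?m = of_real (\<bar>t\<bar> - t)"
    "y ?p = of_real (\<bar>t\<bar> - t)" "y ?m = of_real (\<bar>t\<bar> + t)"
    using k nk by (simp_all add: char_add char_diff char_op_abs x y xk)
  show thesis
  proof (cases "0 < t")
    case True
    then show ?thesis using that[OF mem pm] val by simp
  next
    case False
    moreover have "?m o\<^sub>L ?p = 0" using pm compose_comm mem by metis
    ultimately show ?thesis using that[OF mem(2,1)] val t by simp
  qed
qed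

subsection \<open>Ideals and the existence of characters\<close>

text \<open>A purely algebraic notion, unlike \<open>cstar_ideal\<close>: closedness does not pass
  to unions of chains. For maximal ideals it is recovered below.\<close>

definition proper_ideal :: "'h op set \<Rightarrow> bool" where
  "proper_ideal J \<longleftrightarrow> J \<subseteq> A \<and> 0 \<in> J \<and> id_blinfun \<notin> J \<and>
     (\<forall>a\<in>J. \<forall>b\<in>J. a + b \<in> J) \<and> (\<forall>a\<in>A. \<forall>b\<in>J. a o\<^sub>L b \<in> J)"

lemma maximal_ideal_exists:
  assumes "proper_ideal I"
  obtains J where "proper_ideal J" "I \<subseteq> J"
    "\<And>K. proper_ideal K \<Longrightarrow> J \<subseteq> K \<Longrightarrow> K = J"
proof -
  let ?S = "{J. proper_ideal J \<and> I \<subseteq> J}"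
  have "\<exists>M\<in>?S. \<forall>X\<in>?S. M \<subseteq> X \<longrightarrow> X = M"
  proof (rule subset_Zorn_nonempty)
    fix C assume C: "C \<noteq> {}" "subset.chain ?S C"
    then have CS: "C \<subseteq> ?S" and total: "\<And>X Y. X \<in> C \<Longrightarrow> Y \<in> C \<Longrightarrow> X \<subseteq> Y \<or> Y \<subseteq> X"
      by (auto simp: subset_chain_def)
    have "a + b \<in> \<Union>C" if ab: "a \<in> \<Union>C" "b \<in> \<Union>C" for a b
    proof -
      obtain X Y where "X \<in> C" "a \<in> X" "Y \<in> C" "b \<in> Y" using ab by blast
      then obtain Z where "Z \<in> C" "a \<in> Z" "b \<in> Z" using total[of X Y] by blast
      then show ?thesis using CS unfolding proper_ideal_def by blast
    qed
    moreover have "\<Union>C \<subseteq> A" "0 \<in> \<Union>C" "id_blinfun \<notin> \<Union>C" "I \<subseteq> \<Union>C"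
      using CS C(1) unfolding proper_ideal_def by blast+
    moreover have "a o\<^sub>L b \<in> \<Union>C" if "a \<in> A" "b \<in> \<Union>C" for a b
      using CS that unfolding proper_ideal_def by blast
    ultimately show "\<Union>C \<in> ?S" unfolding proper_ideal_def by blast
  qed (use assms in auto)
  then obtain J where "J \<in> ?S" and max: "\<forall>X\<in>?S. J \<subseteq> X \<longrightarrow> X = J"
    by (rule bexE)
  then have J: "proper_ideal J" "I \<subseteq> J" by simp_all
  show thesis
  proof (rule that[OF J])
    fix K assume "proper_ideal K" "J \<subseteq> K"
    then show "K = J" using max J(2) by simp
  qed
qed

context
  fixes J
  assumes J: "proper_ideal J" and maximal: "\<And>K. proper_ideal K \<Longrightarrow> J \<subseteq> K \<Longrightarrow> K = J"
begin

lemma ideal_add: "a \<in> J \<Longrightarrow> b \<in> J \<Longrightarrow> a + b \<in> J"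
  and ideal_mult: "a \<in> A \<Longrightarrow> b \<in> J \<Longrightarrow> a o\<^sub>L b \<in> J"
  and ideal_zero: "0 \<in> J" and ideal_subset: "b \<in> J \<Longrightarrow> b \<in> A"
  and ideal_proper: "id_blinfun \<notin> J"
  using J unfolding proper_ideal_def by blast+

lemma ideal_scale: "b \<in> J \<Longrightarrow> op_scale c b \<in> J"
  using ideal_mult[of "op_scale c id_blinfun" b] by (simp add: op_scale_compose_left)

lemma ideal_diff: "a \<in> J \<Longrightarrow> b \<in> J \<Longrightarrow> a - b \<in> J"
  using ideal_add[of a "op_scale (- 1) b"] ideal_scale[of b "- 1"] by (simp add: op_scale_minus_one)

lemma ideal_scalar: "op_scale c id_blinfun \<in> J \<Longrightarrow> c = 0"
  using ideal_scale[of "op_scale c id_blinfun" "1 / c"] ideal_proper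
  by (cases "c = 0") (auto simp: op_scale_simps)

text \<open>An element \<open>j\<close> within distance 1 of the identity is invertible by the
  Neumann series, so no proper ideal comes that close. The closure is thus still proper, and
  maximality applies.\<close>

lemma maximal_ideal_closed: "closed J"
proof -
  have "proper_ideal (closure J)"
    unfolding proper_ideal_def
  proof (intro conjI ballI)
    show "closure J \<subseteq> A" by (rule closure_minimal) (auto intro: ideal_subset closed_alg)
    show "0 \<in> closure J" using ideal_zero closure_subset by blast
    show "id_blinfun \<notin> closure J"
    proof
      assume "id_blinfun \<in> closure J"
      then obtain j where j: "j \<in> J" "dist j id_blinfun < 1"
        using closure_approachable zero_less_one by blast
      define b where "b = id_blinfun - j"
      have b: "b \<in> A" "norm b < 1"
        using j ideal_subset by (auto simp: b_def dist_norm norm_minus_commute)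
      obtain c where c: "c \<in> A" "c = b + (b o\<^sub>L c)" using neumann[OF b] .
      have "(id_blinfun + c) o\<^sub>L j = j o\<^sub>L (id_blinfun + c)"
        by (rule compose_comm) (use c(1) j(1) ideal_subset in auto)
      also have "\<dots> = id_blinfun + c - (b + (b o\<^sub>L c))"
        by (simp add: b_def blinfun_compose_simps)
      also have "\<dots> = id_blinfun" by (simp flip: c(2))
      finally show False using ideal_mult[of "id_blinfun + c" j] j(1) c(1) ideal_proper by auto
    qed
    fix a b assume b: "b \<in> closure J"
    then obtain g where g: "\<And>n. g n \<in> J" "g \<longlonglongrightarrow> b" unfolding closure_sequential by blast
    { assume "a \<in> closure J"
      then obtain f where f: "\<And>n. f n \<in> J" "f \<longlonglongrightarrow> a" unfolding closure_sequential by blast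
      have "(\<lambda>n. f n + g n) \<longlonglongrightarrow> a + b" by (intro tendsto_intros f g)
      then show "a + b \<in> closure J"
        unfolding closure_sequential using f(1) g(1)
        by (intro exI[of _ "\<lambda>n. f n + g n"]) (simp add: ideal_add) }
    { assume a: "a \<in> A"
      have "(\<lambda>n. a o\<^sub>L g n) \<longlonglongrightarrow> (a o\<^sub>L b)" by (intro blinfun_compose.tendsto tendsto_intros g)
      then show "a o\<^sub>L b \<in> closure J"
        unfolding closure_sequential using g(1) a
        by (intro exI[of _ "\<lambda>n. a o\<^sub>L g n"]) (simp add: ideal_mult) }
  qed
  then show ?thesis using maximal[of "closure J"] closure_subset[of J] by (metis closed_closure)
qed

text \<open>If \<open>a\<close> is outside \<open>J\<close>, the ideal \<open>J + a A\<close>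
  contains the identity; multiplying \<open>1 = j + a c\<close> by \<open>b\<close> writes
  \<open>b\<close> as a sum of two elements of \<open>J\<close>.\<close>

lemma maximal_ideal_prime:
  assumes a: "a \<in> A" and b: "b \<in> A" and ab: "a o\<^sub>L b \<in> J" and "a \<notin> J"
  shows "b \<in> J"
proof -
  define K where "K = {j + (a o\<^sub>L c) |j c. j \<in> J \<and> c \<in> A}"
  have JK: "J \<subseteq> K"
  proof
    fix j assume "j \<in> J"
    then have "j = j + (a o\<^sub>L 0) \<and> j \<in> J \<and> 0 \<in> A" by (simp add: blinfun_compose.zero_right)
    then show "j \<in> K" unfolding K_def by blast
  qed
  have "a = 0 + (a o\<^sub>L id_blinfun)" by simp
  then have aK: "a \<in> K" unfolding K_def using ideal_zero id_mem by blast
  then have "K \<noteq> J" using \<open>a \<notin> J\<close> by blast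
  then have "\<not> proper_ideal K" using maximal JK by blast
  moreover have "K \<subseteq> A" using ideal_subset a by (auto simp: K_def)
  moreover have "0 \<in> K" using JK ideal_zero by blast
  moreover have "u + v \<in> K" if uv: "u \<in> K" "v \<in> K" for u v
  proof -
    obtain i c j d where "u = i + (a o\<^sub>L c)" "i \<in> J" "c \<in> A" "v = j + (a o\<^sub>L d)" "j \<in> J" "d \<in> A"
      using uv unfolding K_def by blast
    then have "u + v = (i + j) + (a o\<^sub>L (c + d)) \<and> i + j \<in> J \<and> c + d \<in> A"
      by (auto simp: blinfun_compose_simps ideal_add)
    then show ?thesis unfolding K_def by blast
  qed
  moreover have "u o\<^sub>L v \<in> K" if u: "u \<in> A" and v: "v \<in> K" for u v
  proof -
    obtain j d where jd: "v = j + (a o\<^sub>L d)" "j \<in> J" "d \<in> A"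
      using v unfolding K_def by blast
    have "u o\<^sub>L (a o\<^sub>L d) = a o\<^sub>L (u o\<^sub>L d)"
      using compose_comm[OF u a] by (metis blinfun_compose_assoc)
    then have "u o\<^sub>L v = (u o\<^sub>L j) + (a o\<^sub>L (u o\<^sub>L d)) \<and> u o\<^sub>L j \<in> J \<and> u o\<^sub>L d \<in> A"
      using jd u by (auto simp: blinfun_compose_simps ideal_mult)
    then show ?thesis unfolding K_def by blast
  qed
  ultimately have "id_blinfun \<in> K" unfolding proper_ideal_def by blast
  then obtain j c where jc: "id_blinfun = j + (a o\<^sub>L c)" "j \<in> J" "c \<in> A" unfolding K_def by blast
  have "b = b o\<^sub>L (j + (a o\<^sub>L c))" using jc(1) by (metis blinfun_compose_id(1))
  also have "\<dots> = (b o\<^sub>L j) + ((b o\<^sub>L a) o\<^sub>L c)"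
    by (simp add: blinfun_compose_simps blinfun_compose_assoc)
  also have "(b o\<^sub>L a) o\<^sub>L c = c o\<^sub>L (a o\<^sub>L b)" using compose_comm a b jc(3) by (metis compose_mem)
  finally have "b = (b o\<^sub>L j) + (c o\<^sub>L (a o\<^sub>L b))" .
  moreover have "\<dots> \<in> J" by (rule ideal_add[OF ideal_mult[OF b jc(2)] ideal_mult[OF jc(3) ab]])
  ultimately show ?thesis by simp
qed

text \<open>For every real \<open>t\<close> one of \<open>\<bar>h - t\<bar> \<mp> (h - t)\<close> lies in the prime ideal \<open>J\<close>. Both alternatives
  are closed conditions on \<open>t\<close> which occur at the end points, so by connectedness they occur
  simultaneously for some \<open>t\<close>, and then \<open>h - t \<in> J\<close>.\<close>

lemma maximal_ideal_self_adjoint_small: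
  assumes h: "h \<in> A" "adj h = h" "norm h \<le> 1/2"
  obtains t :: real where "h - t *\<^sub>R id_blinfun \<in> J"
proof -
  \<comment> \<open>This interval contains the numerical range of \<open>h\<close>, and for
    \<open>t\<close> in it \<open>h - t\<close> is still a contraction.\<close>
  let ?I = "{-1/2..1/2::real}"
  define k where "k t = h - t *\<^sub>R id_blinfun" for t :: real
  have k: "k t \<in> A" "adj (k t) = k t" for t
    using h by (auto simp: k_def adj_diff scaleR_op_scale adj_op_scale)
  have nk: "norm (k t) \<le> 1" if "t \<in> ?I" for t
  proof -
    have "norm (k t) \<le> norm h + \<bar>t\<bar> * norm (id_blinfun :: 'h op)"
      unfolding k_def by (rule order_trans[OF norm_triangle_ineq4]) simp
    also have "\<bar>t\<bar> * norm (id_blinfun :: 'h op) \<le> \<bar>t\<bar> * 1"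
      by (intro mult_left_mono norm_blinfun_id_le) simp
    finally show ?thesis using h(3) that by auto
  qed
  have contk: "continuous_on ?I k" unfolding k_def by (intro continuous_intros)
  have contm: "continuous_on ?I (\<lambda>t. op_abs (k t))"
    by (rule continuous_on_compose2[OF continuous_on_op_abs contk])
      (use self_adjoint_contraction_compl k nk mem_bounded_ops in blast)
  define L where "L = {t\<in>?I. op_abs (k t) - k t \<in> J}"
  define R where "R = {t\<in>?I. op_abs (k t) + k t \<in> J}"
  have "L = ?I \<inter> (\<lambda>t. op_abs (k t) - k t) -` J" "R = ?I \<inter> (\<lambda>t. op_abs (k t) + k t) -` J"
    by (auto simp: L_def R_def)
  then have "closed L" "closed R"
    using continuous_closed_preimage[OF continuous_on_diff[OF contm contk] closed_atLeastAtMost maximal_ideal_closed]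
      continuous_closed_preimage[OF continuous_on_add[OF contm contk] closed_atLeastAtMost maximal_ideal_closed]
    by metis+
  moreover have "?I \<subseteq> L \<union> R"
  proof
    fix t assume t: "t \<in> ?I"
    have "(op_abs (k t) + k t) o\<^sub>L (op_abs (k t) - k t) = 0"
      using op_abs_diff_mult k nk[OF t] mem_bounded_ops by blast
    then have "op_abs (k t) + k t \<in> J \<or> op_abs (k t) - k t \<in> J"
      using maximal_ideal_prime[of "op_abs (k t) + k t" "op_abs (k t) - k t"] ideal_zero k nk[OF t] by auto
    then show "t \<in> L \<union> R" using t by (auto simp: L_def R_def)
  qed
  \<comment> \<open>Here \<open>k = h + 1/2\<close> is positive because
    \<open>norm h \<le> 1/2\<close>. Applied to \<open>- k\<close> with the projection 1,
    \<open>positive_part_eq_zero\<close> kills the negative part of \<open>k\<close>.\<close>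
  moreover have "- 1/2 \<in> L"
  proof -
    let ?k = "k (- 1/2)"
    have "id_blinfun o\<^sub>L (op_abs (- ?k) + - ?k) = 0"
    proof (rule positive_part_eq_zero)
      show "Re (cinner (blinfun_apply (- ?k) (blinfun_apply id_blinfun v)) (id_blinfun v)) \<le> 0" for v
        using self_adjoint_Re_cinner_le[of h v] mult_right_mono[OF h(3), of "(norm v)\<^sup>2"]
        by (simp add: k_def blinfun.bilinear_simps cinner_simps Re_cinner_self)
      show "adj (- ?k) = - ?k" using k by (simp add: op_scale_minus_one[symmetric] adj_op_scale)
    qed (use k nk[of "-1/2"] in auto)
    then have "op_abs ?k - ?k = 0" by (simp add: op_abs_minus)
    then show ?thesis unfolding L_def using ideal_zero by auto
  qed
  moreover have "1/2 \<in> R"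
  proof -
    let ?k = "k (1/2)"
    have "id_blinfun o\<^sub>L (op_abs ?k + ?k) = 0"
    proof (rule positive_part_eq_zero)
      show "Re (cinner (blinfun_apply ?k (blinfun_apply id_blinfun v)) (id_blinfun v)) \<le> 0" for v
        using self_adjoint_Re_cinner_le[of h v] mult_right_mono[OF h(3), of "(norm v)\<^sup>2"]
        by (simp add: k_def blinfun.bilinear_simps cinner_simps Re_cinner_self)
    qed (use k nk[of "1/2"] in auto)
    then show ?thesis unfolding R_def using ideal_zero by auto
  qed
  moreover have "connected ?I" by simp
  ultimately have "L \<inter> R \<inter> ?I \<noteq> {}"
    unfolding connected_closed by (metis (no_types, lifting) IntI atLeastAtMost_iff empty_iff L_def R_def mem_Collect_eq)
  then obtain t where t: "op_abs (k t) - k t \<in> J" "op_abs (k t) + k t \<in> J"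
    unfolding L_def R_def by blast
  have "k t = op_scale (1/2) ((op_abs (k t) + k t) - (op_abs (k t) - k t))"
    by (simp add: op_scale_simps(1) flip: op_scale_simps(2)) (simp add: op_scale_simps)
  also have "\<dots> \<in> J" by (rule ideal_scale[OF ideal_diff[OF t(2,1)]])
  finally show thesis using that by (simp add: k_def)
qed

lemma maximal_ideal_self_adjoint:
  assumes h: "h \<in> A" "adj h = h"
  obtains t where "h - t *\<^sub>R id_blinfun \<in> J"
proof -
  define r where "r = 1 / (2 * (norm h + 1))"
  have n: "norm h + 1 > 0" by (smt (verit) norm_ge_zero)
  have r: "0 < r" using n by (simp add: r_def)
  have "norm (r *\<^sub>R h) = norm h / (2 * (norm h + 1))" using r by (simp add: r_def)
  also have "\<dots> \<le> 1/2" using n by (simp add: divide_le_eq)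
  finally have nrh: "norm (r *\<^sub>R h) \<le> 1/2" .
  have rh: "r *\<^sub>R h \<in> A" "adj (r *\<^sub>R h) = r *\<^sub>R h"
    using h by (simp_all add: scaleR_op_scale adj_op_scale)
  obtain t where t: "r *\<^sub>R h - t *\<^sub>R id_blinfun \<in> J"
    by (rule maximal_ideal_self_adjoint_small[OF rh nrh])
  have "h - (t / r) *\<^sub>R id_blinfun = (1 / r) *\<^sub>R (r *\<^sub>R h - t *\<^sub>R id_blinfun)"
    using r by (simp add: scaleR_diff_right)
  then show thesis using ideal_scale[OF t, of "of_real (1 / r)"] that[of "t / r"]
    unfolding scaleR_op_scale[symmetric] by simp
qed

text \<open>The role of Gelfand-Mazur: every element is congruent modulo \<open>J\<close> to a
  scalar, by treating real and imaginary parts separately. The scalar is unique since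
  \<open>J\<close> contains no nonzero scalar, and congruence respects the operations.\<close>

lemma maximal_ideal_character:
  obtains y where "y \<in> characters A" "\<And>a. a \<in> J \<Longrightarrow> y a = 0"
proof -
  have "\<exists>c. a - op_scale c id_blinfun \<in> J" if a: "a \<in> A" for a
  proof -
    obtain h k where hk: "h \<in> A" "adj h = h" "k \<in> A" "adj k = k" "a = h + op_scale \<i> k"
      using self_adjoint_decomposition[OF a] by metis
    obtain s t :: real where st: "h - op_scale s id_blinfun \<in> J" "k - op_scale t id_blinfun \<in> J"
      using maximal_ideal_self_adjoint hk(1-4) unfolding scaleR_op_scale by metis
    have "op_scale \<i> (k - op_scale t id_blinfun) = op_scale \<i> k - op_scale (\<i> * t) id_blinfun"
      using op_scale_simps(1)[of \<i> "k - op_scale t id_blinfun" "op_scale t id_blinfun"]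
      by (simp add: op_scale_simps(3))
    then have "a - op_scale (s + \<i> * t) id_blinfun
        = (h - op_scale s id_blinfun) + op_scale \<i> (k - op_scale t id_blinfun)"
      by (simp add: hk(5) op_scale_simps(2))
    also have "\<dots> \<in> J" using st by (intro ideal_add ideal_scale)
    finally show ?thesis by blast
  qed
  then obtain f where f: "\<And>a. a \<in> A \<Longrightarrow> a - op_scale (f a) id_blinfun \<in> J" by metis
  have f_eq: "f a = c" if a: "a \<in> A" "a - op_scale c id_blinfun \<in> J" for a c
  proof -
    have "op_scale (f a - c) id_blinfun = op_scale (f a) (id_blinfun :: 'h op) - op_scale c id_blinfun"
      using op_scale_simps(2)[of "f a - c" c "id_blinfun :: 'h op"] by simp
    also have "\<dots> = (a - op_scale c id_blinfun) - (a - op_scale (f a) id_blinfun)" by simp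
    also have "\<dots> \<in> J" by (rule ideal_diff[OF a(2) f[OF a(1)]])
    finally show ?thesis using ideal_scalar by fastforce
  qed
  define y where "y = restrict f A"
  have "y \<in> characters A"
    unfolding characters_def
  proof (intro CollectI conjI ballI allI)
    show "y \<in> extensional A" by (simp add: y_def)
    fix a assume a: "a \<in> A"
    { fix c
      have "op_scale c a - op_scale (c * f a) id_blinfun = op_scale c (a - op_scale (f a) id_blinfun)"
        using op_scale_simps(1)[of c "a - op_scale (f a) id_blinfun" "op_scale (f a) id_blinfun"]
        by (simp add: op_scale_simps(3))
      then show "y (op_scale c a) = c * y a"
        using f_eq[of "op_scale c a" "c * f a"] ideal_scale[OF f[OF a]] a by (simp add: y_def) }
    fix b assume b: "b \<in> A"
    have "a + b - op_scale (f a + f b) id_blinfun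
        = (a - op_scale (f a) id_blinfun) + (b - op_scale (f b) id_blinfun)"
      by (simp add: op_scale_simps(2))
    also have "\<dots> \<in> J" using f a b by (intro ideal_add)
    finally show "y (a + b) = y a + y b" using f_eq a b by (simp add: y_def)
    have "(a o\<^sub>L b) - op_scale (f a * f b) id_blinfun
        = (a o\<^sub>L (b - op_scale (f b) id_blinfun)) + op_scale (f b) (a - op_scale (f a) id_blinfun)"
      using a op_scale_simps(1)[of "f b" "a - op_scale (f a) id_blinfun" "op_scale (f a) id_blinfun"]
      by (simp add: blinfun_compose_simps op_scale_compose_right op_scale_simps(3) mult.commute)
    also have "\<dots> \<in> J" using f a b by (intro ideal_add ideal_scale ideal_mult)
    finally show "y (a o\<^sub>L b) = y a * y b" using f_eq a b by (simp add: y_def)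
  next
    have "y id_blinfun = 1"
      using f_eq[of id_blinfun 1] ideal_zero by (simp add: y_def op_scale_simps)
    then show "\<exists>a\<in>A. y a \<noteq> 0" using id_mem zero_neq_one by metis
  qed
  moreover have "y a = 0" if "a \<in> J" for a
    using f_eq[of a 0] that ideal_subset by (simp add: y_def op_scale_simps)
  ultimately show thesis using that by blast
qed

end

lemma character_exists:
  assumes "proper_ideal I"
  obtains y where "y \<in> characters A" "\<And>a. a \<in> I \<Longrightarrow> y a = 0"
proof -
  obtain J where J: "proper_ideal J" "I \<subseteq> J" "\<And>K. proper_ideal K \<Longrightarrow> J \<subseteq> K \<Longrightarrow> K = J"
    by (rule maximal_ideal_exists[OF assms]) blast
  obtain y where "y \<in> characters A" "\<And>a. a \<in> J \<Longrightarrow> y a = 0"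
    by (rule maximal_ideal_character[OF J(1,3)]) blast+
  then show thesis using that J(2) by blast
qed

end

section \<open>The extended algebra\<close>

subsection \<open>Partial isometries\<close>

text \<open>With \<open>S = T\<^sup>* T\<close>, isometry on the range of \<open>S\<close>, which is orthogonal to the kernel of \<open>T\<close>, says
  \<open>S\<^sup>3 = S\<^sup>2\<close>, and then \<open>S\<^sup>2 = S\<close> and \<open>T S = T\<close> since \<open>norm (T x) ^ 2 = \<langle>S x, x\<rangle>\<close>.\<close>

lemma partial_isometry_apply:
  fixes T :: "('h::complex_hilbert_space) op"
  assumes "partial_isometry T"
  shows "T (adj T (T x)) = T x"
proof -
  have T: "T \<in> bounded_ops"
    and iso: "\<And>x. (\<And>y. T y = 0 \<Longrightarrow> cinner x y = 0) \<Longrightarrow> norm (T x) = norm x"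
    using assms unfolding partial_isometry_def by blast+
  define S where "S = adj T o\<^sub>L T"
  have S: "S \<in> bounded_ops" "adj S = S" using T by (simp_all add: S_def adj_compose)
  have S_left: "cinner (S u) v = cinner u (S v)" for u v using adj_left[OF S(1)] S(2) by simp
  have TS: "cinner (T u) (T v) = cinner (S u) v" for u v
    by (simp add: S_def adj_left[OF T])
  have "norm (T (S u)) = norm (S u)" for u
    by (rule iso) (simp add: S_def adj_left[OF T])
  then have "cinner (T (S u)) (T (S u)) = cinner (S u) (S u)" for u
    by (simp add: cinner_self)
  then have SSS: "cinner (S (S (S u))) u = cinner (S (S u)) u" for u
    by (simp add: TS S_left)
  define D where "D = (S o\<^sub>L (S o\<^sub>L S)) - (S o\<^sub>L S)"
  have "D = 0"
  proof (rule self_adjoint_eq_zeroI)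
    show "D \<in> bounded_ops" "adj D = D"
      using S by (simp_all add: D_def adj_diff adj_compose blinfun_compose_assoc)
    show "cinner (D u) u = 0" for u
      using SSS[of u] by (simp add: D_def blinfun.bilinear_simps cinner_diff_left)
  qed
  then have S3: "S (S (S u)) = S (S u)" for u
    by (metis D_def blinfun.diff_left blinfun.zero_left blinfun_apply_blinfun_compose
        eq_iff_diff_eq_0)
  have S2: "S (S u) = S u" for u
  proof -
    let ?w = "S (S u) - S u"
    have "cinner ?w ?w = cinner (S ?w) (S u - u)"
      using S_left[of ?w "S u - u"] by (simp add: blinfun.bilinear_simps)
    also have "S ?w = 0" by (simp add: blinfun.bilinear_simps S3)
    finally show ?thesis by (simp add: cinner_self_eq_zero)
  qed
  have "cinner (T (S x - x)) (T (S x - x)) = 0"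
    by (simp only: TS) (simp add: blinfun.bilinear_simps S2)
  then show ?thesis by (simp add: cinner_self_eq_zero blinfun.bilinear_simps S_def)
qed

lemma partial_isometry_adj_apply:
  fixes T :: "('h::complex_hilbert_space) op"
  assumes T: "partial_isometry T"
  shows "adj T (T (adj T x)) = adj T x"
proof (rule cinner_eqI)
  fix z
  have b: "T \<in> bounded_ops" using T by (simp add: partial_isometry_def)
  have "cinner z (adj T (T (adj T x))) = cinner (T (adj T (T z))) x"
    by (simp add: adj_left adj_right b)
  then show "cinner z (adj T (T (adj T x))) = cinner z (adj T x)"
    by (simp add: partial_isometry_apply[OF T] adj_right b)
qed

lemma delta_star_eq_delta: "U \<in> bounded_ops \<Longrightarrow> delta_star U = delta (adj U)"
  by (rule ext) (simp add: delta_def delta_star_def)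

lemma delta_apply: "delta U a x = U (a (adj U x))"
  by (simp add: delta_def)

lemma delta_star_apply: "delta_star U a x = adj U (a (U x))"
  by (simp add: delta_star_def)

lemma bounded_linear_delta: "bounded_linear (delta U)"
proof -
  have "bounded_linear (\<lambda>a. (U o\<^sub>L a) o\<^sub>L adj U)"
    by (rule bounded_linear_compose[OF blinfun_compose.bounded_linear_left
          blinfun_compose.bounded_linear_right])
  then show ?thesis by (simp add: delta_def[abs_def])
qed

lemma bounded_linear_delta_star: "bounded_linear (delta_star U)"
proof -
  have "bounded_linear (\<lambda>a. (adj U o\<^sub>L a) o\<^sub>L U)"
    by (rule bounded_linear_compose[OF blinfun_compose.bounded_linear_left
          blinfun_compose.bounded_linear_right])
  then show ?thesis by (simp add: delta_star_def[abs_def])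
qed

text \<open>Stated for a general \<open>W\<close> so that it covers both \<open>U\<close> and its
  adjoint. The kernel has unit \<open>1 - P\<close>, and the image is cut out by \<open>Q\<close>,
  with \<open>delta (adj W)\<close> as inverse there.\<close>

lemma (in comm_cstar) partial_automorphism_delta:
  assumes W: "W \<in> bounded_ops" "\<And>x. W (adj W (blinfun_apply W x)) = W x"
    "\<And>x. adj W (W (blinfun_apply (adj W) x)) = adj W x"
    and inv: "\<And>a. a \<in> A \<Longrightarrow> delta W a \<in> A" "\<And>a. a \<in> A \<Longrightarrow> delta (adj W) a \<in> A"
  shows "partial_automorphism A (delta W)"
proof -
  define P where "P = adj W o\<^sub>L W"
  define Q where "Q = W o\<^sub>L adj W"
  have "P = delta (adj W) id_blinfun" "Q = delta W id_blinfun"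
    using W(1) by (simp_all add: P_def Q_def delta_def)
  then have PQ: "P \<in> A" "Q \<in> A" using inv by auto
  have comm: "adj W (W (a x)) = a (adj W (W x))" "W (adj W (a x)) = a (W (adj W x))" if "a \<in> A" for a x
    using compose_comm[OF PQ(1) that] compose_comm[OF PQ(2) that]
    by (metis P_def blinfun_apply_blinfun_compose, metis Q_def blinfun_apply_blinfun_compose)
  have endo: "endomorphism A (delta W)"
    unfolding endomorphism_def
  proof (intro conjI ballI allI)
    fix a assume a: "a \<in> A"
    show "delta W a \<in> A" by (rule inv(1)[OF a])
    show "delta W (op_scale c a) = op_scale c (delta W a)" for c
      by (rule blinfun_eqI) (simp add: delta_apply op_scale_apply bounded_opsD[OF W(1)])
    show "delta W (adj a) = adj (delta W a)"
      using a W(1) by (simp add: delta_def adj_compose blinfun_compose_assoc)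
    fix b assume b: "b \<in> A"
    show "delta W (a + b) = delta W a + delta W b"
      by (rule linear_add[OF bounded_linear.linear[OF bounded_linear_delta]])
    show "delta W (a o\<^sub>L b) = delta W a o\<^sub>L delta W b"
      by (rule blinfun_eqI) (simp add: delta_apply comm(1)[OF a, symmetric] W(2))
  qed
  have ker: "P o\<^sub>L a = 0" if a: "a \<in> A" "delta W a = 0" for a
  proof (rule blinfun_eqI)
    fix x
    have "(P o\<^sub>L a) x = adj W (delta W a (W x))"
      using a(1) by (simp add: P_def delta_apply comm(1)[symmetric] W(3))
    then show "blinfun_apply (P o\<^sub>L a) x = blinfun_apply 0 x" by (simp add: a(2))
  qed
  have "delta W (id_blinfun - P) = 0"
    by (rule blinfun_eqI) (simp add: delta_apply P_def blinfun.bilinear_simps W(3))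
  then have "\<exists>e\<in>{a\<in>A. delta W a = 0}. \<forall>a\<in>{a\<in>A. delta W a = 0}. e o\<^sub>L a = a \<and> a o\<^sub>L e = a"
    using PQ ker compose_comm
    by (intro bexI[of _ "id_blinfun - P"] ballI) (auto simp: blinfun_compose_simps)
  moreover have img: "delta W ` A = {b \<in> A. Q o\<^sub>L b = b}"
  proof (intro set_eqI iffI)
    fix b assume "b \<in> delta W ` A"
    then obtain a where a: "a \<in> A" "b = delta W a" by blast
    have "Q o\<^sub>L b = b" by (rule blinfun_eqI) (simp add: a(2) delta_apply Q_def W(2))
    then show "b \<in> {b \<in> A. Q o\<^sub>L b = b}" using a inv by simp
  next
    fix b assume b: "b \<in> {b \<in> A. Q o\<^sub>L b = b}"
    have Qb: "W (adj W (b x)) = b x" for x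
      using b by (metis (mono_tags, lifting) Q_def blinfun_apply_blinfun_compose mem_Collect_eq)
    have "delta W (delta (adj W) b) = b"
    proof (rule blinfun_eqI)
      fix x
      have "delta W (delta (adj W) b) x = W (adj W (b (W (adj W x))))"
        using W(1) by (simp add: delta_apply)
      also have "\<dots> = b x" using b by (simp add: Qb comm(2)[symmetric])
      finally show "delta W (delta (adj W) b) x = b x" .
    qed
    then show "b \<in> delta W ` A" using b inv by (metis (mono_tags, lifting) imageI mem_Collect_eq)
  qed
  have "cstar_ideal A (delta W ` A)"
    unfolding cstar_ideal_def img op_subspace_def
  proof (intro conjI ballI allI)
    have "closed {b. Q o\<^sub>L b = b}"
      by (intro closed_Collect_eq continuous_intros blinfun_compose.continuous_on)
    then show "closed {b \<in> A. Q o\<^sub>L b = b}"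
      using closed_alg closed_Int by (metis Collect_conj_eq Collect_mem_eq)
    have Q: "Q \<in> bounded_ops" using PQ by simp
    show "0 \<in> {b \<in> A. Q o\<^sub>L b = b}" by (simp add: blinfun_compose.zero_right)
    fix a b assume b: "b \<in> {b \<in> A. Q o\<^sub>L b = b}"
    show "op_scale c b \<in> {b \<in> A. Q o\<^sub>L b = b}" for c
      using b Q by (simp add: op_scale_compose_right)
    { assume "a \<in> {b \<in> A. Q o\<^sub>L b = b}"
      then show "a + b \<in> {b \<in> A. Q o\<^sub>L b = b}" using b by (simp add: blinfun_compose_simps) }
    { assume a: "a \<in> A"
      have "Q o\<^sub>L (b o\<^sub>L a) = b o\<^sub>L a" using b by (simp flip: blinfun_compose_assoc)
      then show "b o\<^sub>L a \<in> {b \<in> A. Q o\<^sub>L b = b}" using a b by simp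
      then show "a o\<^sub>L b \<in> {b \<in> A. Q o\<^sub>L b = b}" using compose_comm[OF a, of b] b by simp }
  qed auto
  ultimately show ?thesis unfolding partial_automorphism_def using endo by blast
qed

subsection \<open>Generators\<close>

lemma closure_induct:
  assumes "x \<in> closure S" "closed {x. P x}" "\<And>x. x \<in> S \<Longrightarrow> P x"
  shows "P x"
  using closure_minimal[of S "{x. P x}"] assms by blast

lemma op_pow_conj: "op_pow (adj U) n o\<^sub>L a o\<^sub>L op_pow U n = (delta_star U ^^ n) a"
proof (induction n)
  case 0
  then show ?case by (simp add: op_pow_def)
next
  case (Suc n)
  have "op_pow U m o\<^sub>L U = U o\<^sub>L op_pow U m" for m
    by (induction m) (auto simp: op_pow_def blinfun_compose_assoc)
  then have "op_pow U (Suc n) = op_pow U n o\<^sub>L U" by (simp add: op_pow_def)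
  moreover have "op_pow (adj U) (Suc n) = adj U o\<^sub>L op_pow (adj U) n" by (simp add: op_pow_def)
  ultimately have "op_pow (adj U) (Suc n) o\<^sub>L a o\<^sub>L op_pow U (Suc n)
      = adj U o\<^sub>L (op_pow (adj U) n o\<^sub>L a o\<^sub>L op_pow U n) o\<^sub>L U"
    by (simp add: blinfun_compose_assoc)
  then show ?case by (simp add: Suc delta_star_def)
qed

locale cstar_dynamics =
  fixes A :: "('h::complex_hilbert_space) op set" and U :: "'h op"
  assumes dynamics: "cstar_dynamical_system A U"
begin

sublocale comm_cstar A
  using dynamics by unfold_locales (simp add: cstar_dynamical_system_def)

abbreviation V :: "'h op" where "V \<equiv> adj U"

abbreviation gen :: "nat \<Rightarrow> 'h op \<Rightarrow> 'h op" where "gen n \<equiv> delta_star U ^^ n"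

lemma U_bounded [simp]: "U \<in> bounded_ops" and partial_isometry: "partial_isometry U"
  using dynamics by (simp_all add: cstar_dynamical_system_def partial_isometry_def)

lemma UVU [simp]: "U (V (U x)) = U x" and VUV [simp]: "V (U (V x)) = V x"
  using partial_isometry_apply partial_isometry_adj_apply partial_isometry by blast+

lemma delta_mem [simp, intro]: "a \<in> A \<Longrightarrow> delta U a \<in> A"
  using dynamics by (simp add: cstar_dynamical_system_def delta_def)

lemma delta_pow_mem [simp, intro]: "a \<in> A \<Longrightarrow> (delta U ^^ n) a \<in> A"
  by (induction n) auto

lemma VU_commute: "V (U (a x)) = a (V (U x))" if "a \<in> A" for a
proof -
  have "(V o\<^sub>L U) o\<^sub>L a = a o\<^sub>L (V o\<^sub>L U)"
    using dynamics that by (simp add: cstar_dynamical_system_def commutant_def)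
  then show ?thesis by (metis blinfun_apply_blinfun_compose)
qed

text \<open>\<open>U a = U V U a = U a V U\<close>, since \<open>V o\<^sub>L U\<close> commutes with
  A. This rule and its mirror image below reduce all products of generators.\<close>

lemma U_shift: "a \<in> A \<Longrightarrow> U (a x) = delta U a (U x)"
  by (simp add: delta_apply flip: VU_commute)

lemma V_shift: "a \<in> A \<Longrightarrow> a (V x) = V (delta U a x)"
  by (simp add: delta_apply VU_commute)

lemma delta_one: "delta U id_blinfun x = U (V x)"
  by (simp add: delta_apply)

lemma gen_Suc_apply: "gen (Suc n) a x = V (gen n a (U x))"
  by (simp add: delta_star_apply)

lemma gen_add: "gen n (a + b) = gen n a + gen n b"
  by (induction n) (simp_all add: linear_add[OF bounded_linear.linear[OF bounded_linear_delta_star]])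

lemma gen_bounded_ops [simp]: "a \<in> bounded_ops \<Longrightarrow> gen n a \<in> bounded_ops"
  by (induction n) (simp_all add: delta_star_def)

lemma gen_scale: "op_scale c (gen n a) = gen n (op_scale c a)"
proof (induction n)
  case (Suc n)
  have "op_scale c (delta_star U b) = delta_star U (op_scale c b)" for b
    by (rule blinfun_eqI) (simp add: delta_star_apply op_scale_apply bounded_opsD)
  then show ?case using Suc by simp
qed simp

lemma gen_adj: "a \<in> bounded_ops \<Longrightarrow> adj (gen n a) = gen n (adj a)"
proof (induction n)
  case (Suc n)
  have "adj (delta_star U c) = delta_star U (adj c)" if "c \<in> bounded_ops" for c
    using that by (simp add: delta_star_def adj_compose blinfun_compose_assoc)
  then show ?case using Suc by simp
qed simp

lemma mult_gen: "a \<in> A \<Longrightarrow> a o\<^sub>L gen n b = gen n ((delta U ^^ n) a o\<^sub>L b)"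
proof (induction n arbitrary: a)
  case (Suc n)
  have "(a o\<^sub>L gen (Suc n) b) x = gen (Suc n) ((delta U ^^ Suc n) a o\<^sub>L b) x" for x
  proof -
    have "(a o\<^sub>L gen (Suc n) b) x = V ((delta U a o\<^sub>L gen n b) (U x))"
      using Suc.prems by (simp only: gen_Suc_apply blinfun_apply_blinfun_compose V_shift)
    also have "delta U a o\<^sub>L gen n b = gen n ((delta U ^^ n) (delta U a) o\<^sub>L b)"
      using Suc by blast
    also have "V (gen n ((delta U ^^ n) (delta U a) o\<^sub>L b) (U x))
        = gen (Suc n) ((delta U ^^ n) (delta U a) o\<^sub>L b) x"
      by (rule gen_Suc_apply[symmetric])
    finally show ?thesis by (simp add: funpow_swap1)
  qed
  then show ?case by (rule blinfun_eqI)
qed simp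

lemma gen_commute_alg: "a \<in> A \<Longrightarrow> b \<in> A \<Longrightarrow> gen n b o\<^sub>L a = a o\<^sub>L gen n b"
proof (induction n arbitrary: a)
  case 0
  then show ?case by (simp add: compose_comm)
next
  case (Suc n)
  have "gen n b o\<^sub>L delta U a = delta U a o\<^sub>L gen n b" using Suc by blast
  then have comm: "gen n b (delta U a x) = delta U a (gen n b x)" for x
    by (metis blinfun_apply_blinfun_compose)
  show ?case
    by (rule blinfun_eqI)
      (use Suc.prems in \<open>simp only: blinfun_apply_blinfun_compose gen_Suc_apply U_shift V_shift comm\<close>)
qed

text \<open>Peeling one \<open>V\<close> and one \<open>U\<close> off each factor leaves
  \<open>U V = delta U 1\<close> in the middle. It lies in A and is absorbed into \<open>b\<close>
  on either side, so the induction hypothesis for \<open>?d\<close> yields both claims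
  together.\<close>

lemma gen_mult_commute:
  "a \<in> A \<Longrightarrow> b \<in> A \<Longrightarrow>
    (\<exists>c\<in>A. gen n a o\<^sub>L gen (n + k) b = gen (n + k) c) \<and>
    gen n a o\<^sub>L gen (n + k) b = gen (n + k) b o\<^sub>L gen n a"
proof (induction n arbitrary: b)
  case 0
  then show ?case using gen_commute_alg mult_gen[of a k b] by (auto intro!: bexI)
next
  case (Suc n)
  let ?p = "delta U id_blinfun"
  let ?d = "(delta U ^^ (n + k)) ?p o\<^sub>L b"
  have d: "?d \<in> A" using Suc.prems by auto
  have p: "?p \<in> A" by auto
  have pd: "?p o\<^sub>L gen (n + k) b = gen (n + k) ?d" by (rule mult_gen[OF p])
  have dp: "gen (n + k) b o\<^sub>L ?p = gen (n + k) ?d"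
    using gen_commute_alg[OF p Suc.prems(2)] pd by simp
  obtain c where c: "c \<in> A" "gen n a o\<^sub>L gen (n + k) ?d = gen (n + k) c"
    using Suc.IH[OF Suc.prems(1) d] by blast
  have comm: "gen n a o\<^sub>L gen (n + k) ?d = gen (n + k) ?d o\<^sub>L gen n a"
    using Suc.IH[OF Suc.prems(1) d] by blast
  have 1: "(gen (Suc n) a o\<^sub>L gen (Suc n + k) b) x = V ((gen n a o\<^sub>L gen (n + k) ?d) (U x))" for x
    by (simp only: add_Suc gen_Suc_apply blinfun_apply_blinfun_compose pd[symmetric] delta_one)
  have "gen (n + k) ?d o\<^sub>L gen n a = gen (n + k) b o\<^sub>L (?p o\<^sub>L gen n a)"
    using dp by (metis blinfun_compose_assoc)
  then have 2: "(gen (Suc n + k) b o\<^sub>L gen (Suc n) a) x = V ((gen n a o\<^sub>L gen (n + k) ?d) (U x))" for x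
    unfolding comm by (simp only: add_Suc gen_Suc_apply blinfun_apply_blinfun_compose delta_one)
  have "(gen (Suc n) a o\<^sub>L gen (Suc n + k) b) x = gen (Suc n + k) c x" for x
    unfolding 1 c(2) by (simp only: add_Suc gen_Suc_apply)
  then have "gen (Suc n) a o\<^sub>L gen (Suc n + k) b = gen (Suc n + k) c" by (rule blinfun_eqI)
  moreover have "gen (Suc n) a o\<^sub>L gen (Suc n + k) b = gen (Suc n + k) b o\<^sub>L gen (Suc n) a"
    by (rule blinfun_eqI) (simp only: 1 2)
  ultimately show ?case using c(1) by blast
qed

text \<open>Additive closure already gives the linear span, because a scalar multiple of a generator
  is again a generator of the same index.\<close>

inductive_set gen_span :: "'h op set" where
  gen: "a \<in> A \<Longrightarrow> gen n a \<in> gen_span"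
| add: "b \<in> gen_span \<Longrightarrow> c \<in> gen_span \<Longrightarrow> b + c \<in> gen_span"

lemma gen_gen_mult:
  assumes a: "a \<in> A" and b: "b \<in> A"
  shows "gen n a o\<^sub>L gen m b \<in> gen_span \<and> gen n a o\<^sub>L gen m b = gen m b o\<^sub>L gen n a"
proof (cases "n \<le> m")
  case True
  then show ?thesis using gen_mult_commute[OF a b, of n "m - n"] by (metis gen_span.gen le_add_diff_inverse)
next
  case False
  then show ?thesis using gen_mult_commute[OF b a, of m "n - m"]
    by (metis gen_span.gen le_add_diff_inverse nat_le_linear)
qed

lemma gen_span_mult:
  assumes "b \<in> gen_span" "c \<in> gen_span"
  shows "b o\<^sub>L c \<in> gen_span \<and> b o\<^sub>L c = c o\<^sub>L b"
  using assms(1)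
proof (induction rule: gen_span.induct)
  case (gen a n)
  show ?case using assms(2)
    by (induction rule: gen_span.induct)
      (use gen gen_gen_mult gen_span.add in \<open>auto simp: blinfun_compose_simps\<close>)
next
  case (add d e)
  then show ?case using gen_span.add by (auto simp: blinfun_compose_simps)
qed

lemma gen_span_scale: "b \<in> gen_span \<Longrightarrow> op_scale c b \<in> gen_span"
  by (induction rule: gen_span.induct)
    (auto simp: gen_scale op_scale_simps(1) intro: gen_span.intros)

lemma gen_span_bounded: "b \<in> gen_span \<Longrightarrow> b \<in> bounded_ops"
  by (induction rule: gen_span.induct) auto

lemma gen_span_adj: "b \<in> gen_span \<Longrightarrow> adj b \<in> gen_span"
proof (induction rule: gen_span.induct)
  case (gen a n)
  then show ?case by (auto simp: gen_adj intro: gen_span.gen)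
next
  case (add b c)
  then show ?case by (simp add: adj_add gen_span_bounded gen_span.add)
qed

lemma alg_subset_gen_span: "A \<subseteq> gen_span"
  using gen_span.gen[of _ 0] by auto

lemma delta_star_gen_span: "b \<in> gen_span \<Longrightarrow> delta_star U b \<in> gen_span"
proof (induction rule: gen_span.induct)
  case (gen a n)
  then show ?case using gen_span.gen[of a "Suc n"] by simp
next
  case (add b c)
  then show ?case
    by (simp add: linear_add[OF bounded_linear.linear[OF bounded_linear_delta_star]] gen_span.add)
qed

text \<open>\<open>delta\<close> undoes one step of \<open>delta_star\<close> up to compression by
  \<open>U V\<close>; this is how it lowers the index of a generator.\<close>

lemma delta_gen_Suc: "delta U (gen (Suc n) a) = delta U id_blinfun o\<^sub>L gen n a o\<^sub>L delta U id_blinfun"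
  by (rule blinfun_eqI) (simp add: delta_apply delta_star_apply)

lemma delta_gen_span: "b \<in> gen_span \<Longrightarrow> delta U b \<in> gen_span"
proof (induction rule: gen_span.induct)
  case (gen a n)
  have "delta U id_blinfun \<in> gen_span" using alg_subset_gen_span by auto
  then have "delta U id_blinfun o\<^sub>L gen m a o\<^sub>L delta U id_blinfun \<in> gen_span" for m
    using gen_span_mult gen_span.gen[OF gen] by blast
  then show ?case
    using gen alg_subset_gen_span delta_gen_Suc by (cases n) (auto simp del: funpow.simps(2))
next
  case (add b c)
  then show ?case
    by (simp add: linear_add[OF bounded_linear.linear[OF bounded_linear_delta]] gen_span.add)
qed

subsection \<open>The closure of the span of the generators\<close>

abbreviation B :: "'h op set" where "B \<equiv> ext_algebra A U"

lemma closure_gen_span_alg: "unital_comm_cstar_algebra (closure gen_span)"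
proof -
  let ?B = "closure gen_span"
  have sub: "gen_span \<subseteq> ?B" by (rule closure_subset)
  have bounded: "b \<in> bounded_ops" if "b \<in> ?B" for b
    using that by (rule closure_induct) (auto simp: closed_bounded_ops gen_span_bounded)
  \<comment> \<open>Separate continuity suffices: one argument at a time is moved from the span to
    its closure.\<close>
  have map2: "f a b \<in> ?B"
    if "\<And>a. continuous_on UNIV (f a)" "\<And>b. continuous_on UNIV (\<lambda>a. f a b)"
      and mem: "\<And>a b. a \<in> gen_span \<Longrightarrow> b \<in> gen_span \<Longrightarrow> f a b \<in> gen_span"
      and ab: "a \<in> ?B" "b \<in> ?B" for f a b
  proof -
    have *: "closed {b. f a b \<in> ?B}" "closed {a. f a b \<in> ?B}" for a b
      using closed_vimage[OF closed_closure that(1)] closed_vimage[OF closed_closure that(2)]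
      by (simp_all add: vimage_def)
    have "f a b \<in> ?B" if "a \<in> gen_span" for a
      using ab(2) by (rule closure_induct) (use * mem that sub in auto)
    then show ?thesis by (intro closure_induct[OF ab(1) *(2)])
  qed
  have comm: "a o\<^sub>L b = b o\<^sub>L a" if ab: "a \<in> ?B" "b \<in> ?B" for a b
  proof -
    have *: "closed {b. a o\<^sub>L b = b o\<^sub>L a}" "closed {b. b o\<^sub>L a = a o\<^sub>L b}" for a :: "'h op"
      by (intro closed_Collect_eq continuous_intros blinfun_compose.continuous_on)+
    have "a o\<^sub>L b = b o\<^sub>L a" if "a \<in> gen_span" for a
      using ab(2) *(1) by (rule closure_induct) (use gen_span_mult that in blast)
    then show ?thesis by (rule closure_induct[OF ab(1) *(2)])
  qed
  have adj: "adj b \<in> ?B" if b: "b \<in> ?B" for b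
  proof -
    obtain X where X: "\<And>n. X n \<in> gen_span" "X \<longlonglongrightarrow> b" using b unfolding closure_sequential by blast
    have "(\<lambda>n. adj (X n)) \<longlonglongrightarrow> adj b"
      by (rule adj_tendsto) (use X gen_span_bounded bounded b in auto)
    then show ?thesis
      unfolding closure_sequential using X(1)
      by (intro exI[of _ "\<lambda>n. adj (X n)"]) (simp add: gen_span_adj)
  qed
  have scale: "op_scale c b \<in> ?B" if "b \<in> ?B" for b c
    using that
  proof (rule closure_induct)
    show "closed {b. op_scale c b \<in> ?B}"
      using closed_vimage[OF closed_closure linear_continuous_on[OF bounded_linear_op_scale]]
      by (simp add: vimage_def)
  qed (use gen_span_scale sub in blast)
  have "a + b \<in> ?B" if "a \<in> ?B" "b \<in> ?B" for a b
    using that by (intro map2[of "(+)"] continuous_intros gen_span.add)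
  moreover have "a o\<^sub>L b \<in> ?B" if "a \<in> ?B" "b \<in> ?B" for a b
    using that gen_span_mult
    by (intro map2[of "(o\<^sub>L)"] continuous_intros blinfun_compose.continuous_on) blast+
  ultimately show ?thesis
    unfolding unital_comm_cstar_algebra_def cstar_algebra_def op_subspace_def
    using bounded comm adj scale subsetD[OF alg_subset_gen_span] subsetD[OF sub] by simp blast
qed

lemma ext_algebra_eq: "B = closure gen_span"
  unfolding ext_algebra_def op_pow_conj
proof (rule hull_unique)
  show "(\<Union>n. {gen n a |a. a \<in> A}) \<subseteq> closure gen_span"
    using gen_span.gen closure_subset by blast
  show "cstar_algebra (closure gen_span)"
    using closure_gen_span_alg by (simp add: unital_comm_cstar_algebra_def)
  fix T assume T: "(\<Union>n. {gen n a |a. a \<in> A}) \<subseteq> T" "cstar_algebra T"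
  have "b \<in> T" if "b \<in> gen_span" for b
    using that by (induction rule: gen_span.induct)
      (use T in \<open>auto simp: cstar_algebra_def op_subspace_def\<close>)
  then show "closure gen_span \<subseteq> T"
    using T(2) by (intro closure_minimal) (auto simp: cstar_algebra_def)
qed

sublocale B: comm_cstar B
  using closure_gen_span_alg by unfold_locales (simp add: ext_algebra_eq)

lemma gen_span_subset: "gen_span \<subseteq> B"
  by (simp add: ext_algebra_eq closure_subset)

lemma gen_mem [simp, intro]: "a \<in> A \<Longrightarrow> gen n a \<in> B"
  using gen_span.gen gen_span_subset by blast

lemma alg_subset: "a \<in> A \<Longrightarrow> a \<in> B"
  using alg_subset_gen_span gen_span_subset by blast

lemma delta_mem_ext [simp, intro]: "b \<in> B \<Longrightarrow> delta U b \<in> B"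
  using image_closure_subset[OF linear_continuous_on[OF bounded_linear_delta] closed_closure]
    delta_gen_span closure_subset unfolding ext_algebra_eq by blast

lemma delta_star_mem_ext [simp, intro]: "b \<in> B \<Longrightarrow> delta_star U b \<in> B"
  using image_closure_subset[OF linear_continuous_on[OF bounded_linear_delta_star] closed_closure]
    delta_star_gen_span closure_subset unfolding ext_algebra_eq by blast

lemma partial_automorphism_ext_delta: "partial_automorphism B (delta U)"
  by (rule B.partial_automorphism_delta) (auto simp flip: delta_star_eq_delta)

lemma partial_automorphism_ext_delta_star: "partial_automorphism B (delta_star U)"
  unfolding delta_star_eq_delta[OF U_bounded]
  by (rule B.partial_automorphism_delta) (auto simp flip: delta_star_eq_delta)

lemma delta_mult: "a \<in> B \<Longrightarrow> b \<in> B \<Longrightarrow> delta U (a o\<^sub>L b) = delta U a o\<^sub>L delta U b"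
  and delta_star_mult: "a \<in> B \<Longrightarrow> b \<in> B \<Longrightarrow> delta_star U (a o\<^sub>L b) = delta_star U a o\<^sub>L delta_star U b"
  using partial_automorphism_ext_delta partial_automorphism_ext_delta_star
  unfolding partial_automorphism_def endomorphism_def by blast+

end

section \<open>Characters of the extended algebra\<close>

subsection \<open>A character from its graph on a dense subalgebra\<close>

text \<open>The closure of \<open>R\<close> is the graph of the extension. Two values at one element
  give a pair \<open>(0, z - w)\<close>, so the norm bound makes the graph single-valued; the same
  bound makes the values along an approximating sequence Cauchy.\<close>

lemma (in comm_cstar) character_of_relation:
  fixes R :: "('h op \<times> complex) set"
  assumes dom: "fst ` R \<subseteq> A" "A \<subseteq> closure (fst ` R)"
    and bound: "\<And>b z. (b, z) \<in> R \<Longrightarrow> cmod z \<le> norm b"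
    and add: "\<And>b z c w. (b, z) \<in> R \<Longrightarrow> (c, w) \<in> R \<Longrightarrow> (b + c, z + w) \<in> R"
    and scale: "\<And>b z c. (b, z) \<in> R \<Longrightarrow> (op_scale c b, c * z) \<in> R"
    and mult: "\<And>b z c w. (b, z) \<in> R \<Longrightarrow> (c, w) \<in> R \<Longrightarrow> (b o\<^sub>L c, z * w) \<in> R"
    and one: "(id_blinfun, 1) \<in> R"
  obtains x where "x \<in> characters A" "\<And>b z. (b, z) \<in> R \<Longrightarrow> x b = z"
proof -
  let ?S = "closure R"
  have bound_S: "cmod z \<le> norm b" if "(b, z) \<in> ?S" for b z
  proof -
    have "closed {p :: 'h op \<times> complex. cmod (snd p) \<le> norm (fst p)}"
      by (intro closed_Collect_le continuous_intros)
    from closure_induct[OF that this] bound show ?thesis by auto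
  qed
  have map2: "f (p, q) \<in> ?S" if cont: "continuous_on UNIV f"
      and mem: "\<And>p q. p \<in> R \<Longrightarrow> q \<in> R \<Longrightarrow> f (p, q) \<in> R" and pq: "p \<in> ?S" "q \<in> ?S" for f p q
  proof -
    have "f ` closure (R \<times> R) \<subseteq> ?S"
      using mem closure_subset[of R]
      by (intro image_closure_subset) (auto intro: continuous_on_subset[OF cont])
    then show ?thesis using pq by (auto simp: closure_Times)
  qed
  have add_S: "(b + c, z + w) \<in> ?S" if "(b, z) \<in> ?S" "(c, w) \<in> ?S" for b z c w
    using map2[of "\<lambda>r. (fst (fst r) + fst (snd r), snd (fst r) + snd (snd r))", OF _ _ that]
    by (force intro: continuous_intros add)
  have mult_S: "(b o\<^sub>L c, z * w) \<in> ?S" if "(b, z) \<in> ?S" "(c, w) \<in> ?S" for b z c w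
    using map2[of "\<lambda>r. (fst (fst r) o\<^sub>L fst (snd r), snd (fst r) * snd (snd r))", OF _ _ that]
    by (force intro: continuous_intros blinfun_compose.continuous_on mult)
  have scale_S: "(op_scale c b, c * z) \<in> ?S" if "(b, z) \<in> ?S" for b z c
    using map2[of "\<lambda>r. (op_scale c (fst (fst r)), c * snd (fst r))", OF _ _ that that]
    by (force intro: continuous_intros scale
        bounded_linear.continuous_on[OF bounded_linear_op_scale])
  have diff_S: "(b - c, z - w) \<in> ?S" if "(b, z) \<in> ?S" "(c, w) \<in> ?S" for b z c w
    using add_S[OF that(1) scale_S[OF that(2), of "- 1"]] by (simp add: op_scale_minus_one)
  have R_S: "p \<in> ?S" if "p \<in> R" for p using that closure_subset by blast
  have unique: "z = w" if "(b, z) \<in> ?S" "(b, w) \<in> ?S" for b z w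
    using bound_S[OF diff_S[OF that]] by simp
  have total: "\<exists>z. (b, z) \<in> ?S" if "b \<in> A" for b
  proof -
    have "b \<in> closure (fst ` R)" using dom(2) that by blast
    then obtain X where X: "\<And>n. X n \<in> fst ` R" "X \<longlonglongrightarrow> b"
      unfolding closure_sequential by blast
    then have "\<forall>n. \<exists>z. (X n, z) \<in> R" by fastforce
    then obtain Z where Z: "\<And>n. (X n, Z n) \<in> R" by metis
    have dist: "dist (Z m) (Z n) \<le> dist (X m) (X n)" for m n
      using bound_S[OF diff_S[OF R_S[OF Z] R_S[OF Z], of m n]] by (simp add: dist_norm)
    have "Cauchy X" using X(2) LIMSEQ_imp_Cauchy by blast
    then have "Cauchy Z"
      unfolding Cauchy_def using dist by (meson le_less_trans)
    then obtain z where "Z \<longlonglongrightarrow> z" using Cauchy_convergent_iff convergent_def by blast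
    then have "(\<lambda>n. (X n, Z n)) \<longlonglongrightarrow> (b, z)" using X(2) by (intro tendsto_intros)
    then show ?thesis
      unfolding closure_sequential using Z
      by (intro exI[of _ z] exI[of _ "\<lambda>n. (X n, Z n)"]) simp
  qed
  define x where "x = (\<lambda>b\<in>A. THE z. (b, z) \<in> ?S)"
  have x_mem: "(b, x b) \<in> ?S" if "b \<in> A" for b
    using total[OF that] unique that theI[of "\<lambda>z. (b, z) \<in> ?S"] unfolding x_def by auto
  have x_eq: "x b = z" if "(b, z) \<in> ?S" "b \<in> A" for b z
    using x_mem unique that by blast
  show thesis
  proof
    show "x \<in> characters A"
      unfolding characters_def
    proof (intro CollectI conjI ballI allI)
      have "x id_blinfun = 1" using x_eq R_S one by blast
      then show "\<exists>a\<in>A. x a \<noteq> 0" by (intro bexI[of _ id_blinfun]) auto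
    qed (auto simp: x_def[THEN arg_cong, of "\<lambda>f. f \<in> extensional A"] intro!: x_eq add_S scale_S mult_S x_mem)
    show "x b = z" if "(b, z) \<in> R" for b z
      using x_eq[OF R_S[OF that]] that dom(1) by force
  qed
qed

lemma norm_projection_le:
  fixes P :: "('h::complex_hilbert_space) op"
  assumes P: "P \<in> bounded_ops" "adj P = P" "P o\<^sub>L P = P"
  shows "norm P \<le> 1"
proof (rule norm_blinfun_bound)
  fix v
  have PP: "P (P v) = P v" using P(3) by (metis blinfun_apply_blinfun_compose)
  have "(norm (P v))\<^sup>2 = Re (cinner (P v) v)"
    using adj_left[OF P(1), of "P v" v] by (simp add: P(2) PP Re_cinner_self)
  also have "\<dots> \<le> norm (P v) * norm v" by (rule Re_cinner_le)
  finally have "norm (P v) * norm (P v) \<le> norm v * norm (P v)"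
    by (simp add: power2_eq_square mult.commute)
  then show "norm (P v) \<le> 1 * norm v"
    by (cases "norm (P v) = 0") (simp, metis mult_1 mult_right_le_imp_le norm_ge_zero order_le_less)
qed simp

context comm_cstar
begin

lemma zero_functional_apply: "a \<in> A \<Longrightarrow> zero_functional A a = 0"
  by (simp add: zero_functional_def)

text \<open>Evaluation at the identity takes only the values 0 and 1 here, which turns membership
  questions into scalar equations and later into clopen sets.\<close>

lemma char_or_zero_one:
  assumes "x \<in> insert (zero_functional A) (characters A)"
  shows "x \<in> characters A \<longleftrightarrow> x id_blinfun = 1"
    and "x = zero_functional A \<longleftrightarrow> x id_blinfun = 0"
    and "x \<in> characters A \<longleftrightarrow> x \<noteq> zero_functional A"
  using assms char_one zero_functional_apply[of id_blinfun] by fastforce+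

end

context cstar_dynamics
begin

subsection \<open>Characters of the original algebra\<close>

lemma delta_mult_alg: "a \<in> A \<Longrightarrow> b \<in> A \<Longrightarrow> delta U (a o\<^sub>L b) = delta U a o\<^sub>L delta U b"
  using delta_mult alg_subset by blast

lemma delta_one_idem: "delta U id_blinfun o\<^sub>L delta U id_blinfun = delta U id_blinfun"
  using delta_mult_alg[of id_blinfun id_blinfun] by simp

lemma dual_dom_one:
  assumes "y \<in> dual_dom A (delta U)"
  shows "y \<in> characters A" "y (delta U id_blinfun) = 1"
proof -
  show y: "y \<in> characters A" using assms by (simp add: dual_dom_def)
  have "y (delta U id_blinfun) * y (delta U id_blinfun) = y (delta U id_blinfun)"
    using char_mult[OF y, of "delta U id_blinfun" "delta U id_blinfun"] by (simp add: delta_one_idem)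
  then show "y (delta U id_blinfun) = 1" using assms by (simp add: dual_dom_def)
qed

lemma dual_map_character:
  assumes "y \<in> dual_dom A (delta U)"
  shows "dual_map A (delta U) y \<in> characters A"
proof -
  note y = dual_dom_one[OF assms]
  show ?thesis
    unfolding characters_def dual_map_def
  proof (intro CollectI conjI ballI allI)
    show "\<exists>a\<in>A. restrict (y \<circ> delta U) A a \<noteq> 0"
      using y(2) by (intro bexI[of _ id_blinfun]) auto
    fix a assume a: "a \<in> A"
    have "delta U (op_scale c a) = op_scale c (delta U a)" for c
      by (rule blinfun_eqI) (simp add: delta_apply op_scale_apply bounded_opsD)
    then show "restrict (y \<circ> delta U) A (op_scale c a) = c * restrict (y \<circ> delta U) A a" for c
      using a y(1) by (simp add: char_scale)
  qed (auto simp: char_add char_mult y(1) delta_mult_alg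
      linear_add[OF bounded_linear.linear[OF bounded_linear_delta]])
qed

text \<open>The projection onto the kernel of \<open>U\<close>. It always belongs to B and commutes
  with A, but it may lie outside A.\<close>

abbreviation P :: "'h op" where "P \<equiv> id_blinfun - delta_star U id_blinfun"

lemma P_apply: "P x = x - V (U x)"
  by (simp add: blinfun.bilinear_simps delta_star_apply)

lemma P_projection: "P \<in> bounded_ops" "adj P = P" "P o\<^sub>L P = P"
proof -
  show "P \<in> bounded_ops" by (simp add: delta_star_def)
  show "adj P = P" by (simp add: adj_diff delta_star_def adj_compose)
  show "P o\<^sub>L P = P"
    by (rule blinfun_eqI) (simp only: blinfun_apply_blinfun_compose P_apply, simp add: blinfun.bilinear_simps)
qed

text \<open>As \<open>V o\<^sub>L U\<close> is idempotent, the ideal defining Y consists of the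
  \<open>a\<close> in A that it fixes, which is the kernel of
  \<open>a \<mapsto> P o\<^sub>L a\<close>.\<close>

lemma ext_Y_vanish: "x \<in> ext_Y A U \<longleftrightarrow>
    x \<in> characters A \<and> (\<forall>a\<in>A. delta_star U id_blinfun o\<^sub>L a = a \<longrightarrow> x a = 0)"
proof -
  have p: "V o\<^sub>L U o\<^sub>L a = delta_star U id_blinfun o\<^sub>L a" for a by (simp add: delta_star_def)
  have "delta_star U id_blinfun o\<^sub>L (delta_star U id_blinfun o\<^sub>L a) = delta_star U id_blinfun o\<^sub>L a" for a
    by (rule blinfun_eqI) (simp add: delta_star_apply)
  then have "(\<lambda>a. V o\<^sub>L U o\<^sub>L a) ` A \<inter> A = {a \<in> A. delta_star U id_blinfun o\<^sub>L a = a}"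
    unfolding p by (auto simp: image_iff) metis
  then show ?thesis by (auto simp: ext_Y_def zero_hull_def)
qed

lemma ext_Y_bound:
  assumes x: "x \<in> ext_Y A U" and a: "a \<in> A"
  shows "cmod (x a) \<le> norm (P o\<^sub>L a)"
proof (rule char_bound_projection)
  show "x \<in> characters A" using x by (simp add: ext_Y_vanish)
  show "P o\<^sub>L a = a o\<^sub>L P" if "a \<in> A" for a
    by (rule blinfun_eqI)
      (simp only: blinfun_apply_blinfun_compose P_apply, simp add: blinfun.bilinear_simps VU_commute that)
  show "x a = 0" if "a \<in> A" "P o\<^sub>L a = 0" for a
    using x that by (simp add: ext_Y_vanish blinfun_compose_simps)
qed (use P_projection a in auto)

text \<open>If \<open>x c \<noteq> 0\<close> for some \<open>c = U\<^sup>* U c\<close>, then \<open>\<delta> b = 0\<close> forces \<open>b c = 0\<close>, hence \<open>x b = 0\<close>. So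
  the ideal of all \<open>d\<close> with \<open>d \<delta>(b) = 0\<close> for some \<open>b\<close> with \<open>x b \<noteq> 0\<close> is proper, and a character
  that annihilates it is mapped to \<open>x\<close>, since characters are separated by elements with product
  zero.\<close>

lemma not_ext_Y_in_image:
  assumes x: "x \<in> characters A" and notY: "x \<notin> ext_Y A U"
  shows "x \<in> dual_map A (delta U) ` dual_dom A (delta U)"
proof -
  obtain c where c: "c \<in> A" "delta_star U id_blinfun o\<^sub>L c = c" "x c \<noteq> 0"
    using x notY by (auto simp: ext_Y_vanish)
  define J where "J = {d\<in>A. \<exists>b\<in>A. x b \<noteq> 0 \<and> d o\<^sub>L delta U b = 0}"
  have "proper_ideal J"
    unfolding proper_ideal_def
  proof (intro conjI ballI)
    show "J \<subseteq> A" by (auto simp: J_def)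
    show "0 \<in> J" using c by (auto simp: J_def blinfun_compose.zero_left)
    show "id_blinfun \<notin> J"
    proof
      assume "id_blinfun \<in> J"
      then obtain b where b: "b \<in> A" "x b \<noteq> 0" "delta U b = 0" by (auto simp: J_def)
      have cv: "V (U (c v)) = c v" for v
        using arg_cong[OF c(2), of "\<lambda>T. blinfun_apply T v"] by (simp add: delta_star_apply)
      have "b o\<^sub>L c = 0"
      proof (rule blinfun_eqI)
        fix v
        have "b (c v) = V (U (b (V (U (c v)))))" by (simp add: cv VU_commute b(1))
        also have "\<dots> = V (delta U b (U (c v)))" by (simp add: delta_apply)
        finally show "(b o\<^sub>L c) v = blinfun_apply 0 v" by (simp add: b(3))
      qed
      then have "x b * x c = 0" using char_mult[OF x b(1) c(1)] char_zero[OF x] by simp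
      then show False using b c by simp
    qed
    fix d e assume e: "e \<in> J"
    then obtain b where b: "b \<in> A" "x b \<noteq> 0" "e o\<^sub>L delta U b = 0" "e \<in> A" by (auto simp: J_def)
    { assume "d \<in> J"
      then obtain a where a: "a \<in> A" "x a \<noteq> 0" "d o\<^sub>L delta U a = 0" "d \<in> A" by (auto simp: J_def)
      have "d o\<^sub>L delta U (a o\<^sub>L b) = 0"
        using a b by (simp add: delta_mult_alg blinfun_compose.zero_left flip: blinfun_compose_assoc)
      moreover have "e o\<^sub>L delta U (b o\<^sub>L a) = 0"
        using a b by (simp add: delta_mult_alg blinfun_compose.zero_left flip: blinfun_compose_assoc)
      ultimately have "(d + e) o\<^sub>L delta U (a o\<^sub>L b) = 0"
        using compose_comm[OF a(1) b(1)] by (simp add: blinfun_compose_simps)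
      moreover have "x (a o\<^sub>L b) \<noteq> 0" using a b by (simp add: char_mult[OF x])
      ultimately show "d + e \<in> J" using a b unfolding J_def by blast }
    { assume "d \<in> A"
      then show "d o\<^sub>L e \<in> J" using b unfolding J_def
        by (auto simp: blinfun_compose_assoc blinfun_compose.zero_right) }
  qed
  then obtain y where y: "y \<in> characters A" "\<And>d. d \<in> J \<Longrightarrow> y d = 0"
    by (rule character_exists) blast
  \<comment> \<open>The witness \<open>b = 1\<close> puts this element in \<open>J\<close>, which
    forces \<open>y (delta U 1) = 1\<close> and places \<open>y\<close> in \<Delta>.\<close>
  have "(id_blinfun - delta U id_blinfun) o\<^sub>L delta U id_blinfun = 0"
    by (simp add: blinfun_compose_simps delta_one_idem)
  moreover have "x id_blinfun \<noteq> 0" by (simp add: char_one[OF x])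
  ultimately have "id_blinfun - delta U id_blinfun \<in> J" unfolding J_def by blast
  then have "y (delta U id_blinfun) = 1"
    using y by (force simp: char_diff char_one)
  then have dom: "y \<in> dual_dom A (delta U)" using y(1) by (simp add: dual_dom_def)
  have "dual_map A (delta U) y = x"
  proof (rule ccontr)
    assume "dual_map A (delta U) y \<noteq> x"
    then obtain a b where ab: "a \<in> A" "b \<in> A" "a o\<^sub>L b = 0"
        "dual_map A (delta U) y a \<noteq> 0" "x b \<noteq> 0"
      using characters_separated[OF dual_map_character[OF dom] x] by blast
    have "delta U a o\<^sub>L delta U b = delta U 0" using delta_mult_alg ab by metis
    then have "delta U a o\<^sub>L delta U b = 0"
      by (simp add: linear_0[OF bounded_linear.linear[OF bounded_linear_delta]])
    then have "delta U a \<in> J" using ab unfolding J_def by blast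
    then show False using ab y(2) by (simp add: dual_map_def)
  qed
  then show ?thesis using dom by blast
qed

subsection \<open>The sequence of a character\<close>

lemma gen_mem_ext [simp, intro]: "b \<in> B \<Longrightarrow> gen n b \<in> B"
  by (induction n) auto

lemma gen_mult: "a \<in> B \<Longrightarrow> b \<in> B \<Longrightarrow> gen n (a o\<^sub>L b) = gen n a o\<^sub>L gen n b"
  by (induction n) (auto simp: delta_star_mult)

lemma ext_seq_apply: "a \<in> A \<Longrightarrow> ext_seq A U x n a = x (gen n a)"
  by (simp add: ext_seq_def)

lemma delta_star_delta:
  "delta_star U (delta U a) = delta_star U id_blinfun o\<^sub>L a o\<^sub>L delta_star U id_blinfun"
  by (rule blinfun_eqI) (simp add: delta_apply delta_star_apply)

context
  fixes x
  assumes x: "x \<in> characters B"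
begin

text \<open>\<open>gen n id_blinfun\<close> is idempotent, being the image of 1 under a
  multiplicative map. Its value decides whether coordinate \<open>n\<close> is a point of M or
  0.\<close>

lemma char_gen_one_cases: "x (gen n id_blinfun) = 0 \<or> x (gen n id_blinfun) = 1"
proof -
  have "x (gen n id_blinfun) * x (gen n id_blinfun) = x (gen n id_blinfun)"
    using gen_mult[of id_blinfun id_blinfun n] by (simp flip: B.char_mult[OF x])
  then show ?thesis by simp
qed

lemma ext_seq_cases: "ext_seq A U x n \<in> insert (zero_functional A) (characters A)"
  using char_gen_one_cases[of n]
proof
  assume 0: "x (gen n id_blinfun) = 0"
  have "x (gen n a) = 0" if "a \<in> A" for a
  proof -
    have "x (gen n (a o\<^sub>L id_blinfun)) = x (gen n a) * x (gen n id_blinfun)"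
      using that alg_subset by (subst gen_mult) (auto simp: B.char_mult[OF x])
    then show ?thesis using 0 by simp
  qed
  then have "ext_seq A U x n = zero_functional A"
    by (auto simp: ext_seq_def zero_functional_def)
  then show ?thesis by simp
next
  assume 1: "x (gen n id_blinfun) = 1"
  have "ext_seq A U x n \<in> characters A"
    unfolding characters_def ext_seq_def
  proof (intro CollectI conjI ballI allI)
    show "\<exists>a\<in>A. (\<lambda>a\<in>A. x (gen n a)) a \<noteq> 0"
      using 1 by (intro bexI[of _ id_blinfun]) auto
    fix a b assume "a \<in> A" "b \<in> A"
    then show "(\<lambda>a\<in>A. x (gen n a)) (a o\<^sub>L b) = (\<lambda>a\<in>A. x (gen n a)) a * (\<lambda>a\<in>A. x (gen n a)) b"
      using gen_mult[OF alg_subset alg_subset] by (simp add: B.char_mult[OF x])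
  qed (auto simp: gen_add B.char_add[OF x] B.char_scale[OF x] simp flip: gen_scale)
  then show ?thesis by simp
qed

lemma ext_seq_zero_iff: "ext_seq A U x n = zero_functional A \<longleftrightarrow> x (gen n id_blinfun) = 0"
  using char_or_zero_one(2)[OF ext_seq_cases] by (simp add: ext_seq_apply)

lemma ext_seq_char_iff: "ext_seq A U x n \<in> characters A \<longleftrightarrow> x (gen n id_blinfun) = 1"
  using char_or_zero_one(1)[OF ext_seq_cases] by (simp add: ext_seq_apply)

text \<open>\<open>gen n\<close> sends the projection \<open>V o\<^sub>L U\<close> to
  \<open>gen (Suc n) id_blinfun\<close>. So coordinate \<open>n + 1\<close> vanishes exactly when
  this projection, raised to level \<open>n\<close>, is invisible to \<open>x\<close>.\<close>

lemma char_gen_absorb: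
  "b \<in> B \<Longrightarrow> x (gen n (delta_star U id_blinfun o\<^sub>L b)) = x (gen (Suc n) id_blinfun) * x (gen n b)"
  by (subst gen_mult) (auto simp: B.char_mult[OF x] funpow_swap1)

lemma char_gen_one_Suc: "x (gen (Suc n) id_blinfun) = 1 \<Longrightarrow> x (gen n id_blinfun) = 1"
  using char_gen_absorb[of id_blinfun n] char_gen_one_cases[of n] by (auto simp: funpow_swap1)

lemma char_gen_one_mono: "x (gen n id_blinfun) = 1 \<Longrightarrow> m \<le> n \<Longrightarrow> x (gen m id_blinfun) = 1"
  by (induction n) (auto simp: le_Suc_eq simp del: funpow.simps(2) dest: char_gen_one_Suc)

text \<open>\<open>delta_star U (delta U a)\<close> is \<open>a\<close> compressed by
  \<open>V o\<^sub>L U\<close>, and by assumption \<open>x\<close> takes the value 1 at the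
  level-\<open>n\<close> copy of that projection.\<close>

lemma ext_seq_Suc:
  assumes "x (gen (Suc n) id_blinfun) = 1"
  shows "ext_seq A U x (Suc n) \<in> dual_dom A (delta U)"
    and "dual_map A (delta U) (ext_seq A U x (Suc n)) = ext_seq A U x n"
proof -
  have *: "x (gen (Suc n) (delta U a)) = x (gen n a)" if a: "a \<in> A" for a
  proof -
    have "gen (Suc n) (delta U a) = gen n (delta_star U id_blinfun o\<^sub>L (a o\<^sub>L delta_star U id_blinfun))"
      by (simp add: funpow_swap1 delta_star_delta blinfun_compose_assoc)
    also have "a o\<^sub>L delta_star U id_blinfun = delta_star U id_blinfun o\<^sub>L a"
      using a alg_subset by (intro B.compose_comm) auto
    finally have "gen (Suc n) (delta U a)
      = gen n (delta_star U id_blinfun o\<^sub>L (delta_star U id_blinfun o\<^sub>L a))" .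
    then show ?thesis
      using a alg_subset assms by (simp add: char_gen_absorb del: funpow.simps(2))
  qed
  show "ext_seq A U x (Suc n) \<in> dual_dom A (delta U)"
    using assms ext_seq_char_iff *[of id_blinfun] char_gen_one_Suc[OF assms]
    by (simp add: dual_dom_def ext_seq_apply del: funpow.simps(2))
  show "dual_map A (delta U) (ext_seq A U x (Suc n)) = ext_seq A U x n"
    using * by (auto simp: dual_map_def ext_seq_def simp del: funpow.simps(2))
qed

lemma ext_seq_chain:
  assumes "1 \<le> n" "x (gen n id_blinfun) = 1"
  shows "ext_seq A U x n \<in> dual_dom A (delta U) \<and>
    dual_map A (delta U) (ext_seq A U x n) = ext_seq A U x (n - 1)"
proof -
  obtain m where "n = Suc m" using assms(1) by (cases n) auto
  then show ?thesis using ext_seq_Suc[of m] assms(2) by simp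
qed

text \<open>This is the origin of Y: when the next coordinate is 0, absorption kills the value at
  every \<open>a\<close> fixed by \<open>V o\<^sub>L U\<close>.\<close>

lemma ext_seq_in_ext_Y:
  assumes "x (gen n id_blinfun) = 1" "x (gen (Suc n) id_blinfun) = 0"
  shows "ext_seq A U x n \<in> ext_Y A U"
  unfolding ext_Y_vanish
proof (intro conjI ballI impI)
  show "ext_seq A U x n \<in> characters A" using assms(1) by (simp add: ext_seq_char_iff)
  fix a assume a: "a \<in> A" "delta_star U id_blinfun o\<^sub>L a = a"
  then have "x (gen n a) = 0"
    using char_gen_absorb[of a n] assms(2) alg_subset by simp
  then show "ext_seq A U x n a = 0" using a(1) by (simp add: ext_seq_apply)
qed

lemma ext_seq_mem: "ext_seq A U x \<in> ext_M A U"
proof (cases "\<forall>n. x (gen n id_blinfun) = 1")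
  case True
  then have "ext_seq A U x \<in> ext_M_inf A U"
    unfolding ext_M_inf_def using ext_seq_chain by blast
  then show ?thesis by (simp add: ext_M_def)
next
  case False
  \<comment> \<open>The first vanishing coordinate. It is not 0 because
    \<open>x id_blinfun = 1\<close>, so \<open>N = K - 1\<close> is the last coordinate in
    M.\<close>
  define K where "K = (LEAST n. x (gen n id_blinfun) \<noteq> 1)"
  have K: "x (gen K id_blinfun) \<noteq> 1" unfolding K_def using False by (metis (mono_tags, lifting) LeastI)
  have below: "x (gen n id_blinfun) = 1" if "n < K" for n
    using not_less_Least[of n "\<lambda>n. x (gen n id_blinfun) \<noteq> 1"] that by (simp add: K_def)
  have "K \<noteq> 0" using K B.char_one[OF x] by (cases K) auto
  then obtain N where N: "K = Suc N" using not0_implies_Suc by blast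
  have zero: "x (gen n id_blinfun) = 0" if "n > N" for n
    using char_gen_one_mono[of n K] K char_gen_one_cases[of n] that N by auto
  have "ext_seq A U x \<in> ext_M_fin A U N"
    unfolding ext_M_fin_def
  proof (intro CollectI conjI ballI allI impI)
    fix n assume "n \<in> {1..N}"
    then show "ext_seq A U x n \<in> dual_dom A (delta U)"
      and "dual_map A (delta U) (ext_seq A U x n) = ext_seq A U x (n - 1)"
      using ext_seq_chain[of n] below[of n] N by auto
  next
    show "ext_seq A U x N \<in> ext_Y A U"
      using ext_seq_in_ext_Y[of N] below[of N] zero[of "Suc N"] N by blast
  qed (use zero ext_seq_zero_iff in blast)
  then show ?thesis by (auto simp: ext_M_def)
qed

end

lemma ext_seq_inj:
  assumes x: "x \<in> characters B" and y: "y \<in> characters B" and eq: "ext_seq A U x = ext_seq A U y"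
  shows "x = y"
proof (rule extensionalityI[OF B.char_extensional[OF x] B.char_extensional[OF y]])
  have span: "x b = y b" if "b \<in> gen_span" for b
    using that
  proof (induction rule: gen_span.induct)
    case (gen a n)
    then show ?case using ext_seq_apply[of a] eq by metis
  next
    case (add b c)
    then show ?case using gen_span_subset by (simp add: B.char_add[OF x] B.char_add[OF y] subset_iff)
  qed
  fix b assume b: "b \<in> B"
  show "x b = y b"
  proof (rule ccontr)
    assume "x b \<noteq> y b"
    then have "0 < cmod (x b - y b) / 2" by simp
    then obtain c where c: "c \<in> gen_span" "dist c b < cmod (x b - y b) / 2"
      using b unfolding ext_algebra_eq closure_approachable by blast
    have cB: "c \<in> B" using c gen_span_subset by blast
    have "x b - y b = x (b - c) - y (b - c)"
      using b cB span[OF c(1)] by (simp add: B.char_diff[OF x] B.char_diff[OF y])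
    also have "cmod \<dots> \<le> norm (b - c) + norm (b - c)"
      using B.char_bound[OF x, of "b - c"] B.char_bound[OF y, of "b - c"] b cB
        norm_triangle_ineq4[of "x (b - c)" "y (b - c)"] by (smt (verit) B.diff_mem)
    finally show False using c(2) by (simp add: dist_norm norm_minus_commute)
  qed
qed

subsection \<open>The character of a sequence\<close>

lemma delta_pow_mem_ext [simp, intro]: "b \<in> B \<Longrightarrow> (delta U ^^ n) b \<in> B"
  by (induction n) auto

lemma delta_pow_mult: "a \<in> B \<Longrightarrow> b \<in> B \<Longrightarrow>
    (delta U ^^ n) (a o\<^sub>L b) = (delta U ^^ n) a o\<^sub>L (delta U ^^ n) b"
  by (induction n) (auto simp: delta_mult)

lemma delta_pow_linear:
  "(delta U ^^ n) (a + b) = (delta U ^^ n) a + (delta U ^^ n) b"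
  "(delta U ^^ n) (op_scale c a) = op_scale c ((delta U ^^ n) a)"
proof -
  show "(delta U ^^ n) (a + b) = (delta U ^^ n) a + (delta U ^^ n) b"
    by (induction n) (simp_all add: linear_add[OF bounded_linear.linear[OF bounded_linear_delta]])
  have "delta U (op_scale c b) = op_scale c (delta U b)" for b
    by (rule blinfun_eqI) (simp add: delta_apply op_scale_apply bounded_opsD)
  then show "(delta U ^^ n) (op_scale c a) = op_scale c ((delta U ^^ n) a)"
    by (induction n) simp_all
qed

lemma norm_delta_le: "norm (delta U b) \<le> norm b"
proof -
  have "norm (V o\<^sub>L U) \<le> 1"
    by (rule norm_projection_le) (auto simp: adj_compose intro!: blinfun_eqI)
  have "norm U \<le> 1"
  proof (rule norm_blinfun_bound)
    fix v
    have "(norm (U v))\<^sup>2 = Re (cinner ((V o\<^sub>L U) v) v)"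
      by (simp add: adj_left Re_cinner_self)
    also have "\<dots> \<le> norm (V o\<^sub>L U) * (norm v)\<^sup>2"
      using self_adjoint_Re_cinner_le[of "V o\<^sub>L U" v] by linarith
    also have "\<dots> \<le> (1 * norm v)\<^sup>2"
      using mult_right_mono[OF \<open>norm (V o\<^sub>L U) \<le> 1\<close>, of "(norm v)\<^sup>2"] by simp
    finally show "norm (U v) \<le> 1 * norm v" by (rule power2_le_imp_le) simp
  qed simp
  have "norm V \<le> 1" using norm_adj_le[OF U_bounded] \<open>norm U \<le> 1\<close> by linarith
  have "norm (delta U b) \<le> norm U * norm b * norm V"
    unfolding delta_def
    by (rule order_trans[OF norm_blinfun_compose]) (simp add: mult_right_mono norm_blinfun_compose)
  also have "\<dots> \<le> 1 * norm b * 1"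
    using \<open>norm U \<le> 1\<close> \<open>norm V \<le> 1\<close> by (intro mult_mono) auto
  finally show ?thesis by simp
qed

lemma norm_delta_pow_le: "norm ((delta U ^^ n) b) \<le> norm b"
  by (induction n) (auto intro: order_trans[OF norm_delta_le])

text \<open>The projections \<open>(delta U ^^ n) id_blinfun\<close> decrease with \<open>n\<close>,
  in the form \<open>r q = q r = r\<close>, so the compression from the previous step disappears
  inside the new one.\<close>

lemma delta_pow_gen:
  assumes "b \<in> B"
  shows "(delta U ^^ n) (gen n b) = (delta U ^^ n) id_blinfun o\<^sub>L b o\<^sub>L (delta U ^^ n) id_blinfun"
proof (induction n)
  case (Suc n)
  let ?p = "delta U id_blinfun" and ?q = "(delta U ^^ n) id_blinfun"
  let ?r = "(delta U ^^ Suc n) id_blinfun"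
  have r: "(delta U ^^ n) ?p = ?r" by (simp add: funpow_swap1)
  have "?r = (delta U ^^ n) (?p o\<^sub>L id_blinfun)" "?r = (delta U ^^ n) (id_blinfun o\<^sub>L ?p)"
    by (simp_all add: funpow_swap1)
  then have rq: "?r o\<^sub>L ?q = ?r" "?q o\<^sub>L ?r = ?r"
    using delta_pow_mult[of ?p id_blinfun n] delta_pow_mult[of id_blinfun ?p n] r by auto
  have "delta U (gen (Suc n) b) = ?p o\<^sub>L (gen n b o\<^sub>L ?p)"
    using delta_gen_Suc by (simp add: blinfun_compose_assoc)
  then have "(delta U ^^ Suc n) (gen (Suc n) b) = (delta U ^^ n) (?p o\<^sub>L (gen n b o\<^sub>L ?p))"
    by (simp add: funpow_swap1)
  also have "\<dots> = ?r o\<^sub>L ((?q o\<^sub>L b o\<^sub>L ?q) o\<^sub>L ?r)"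
    using assms Suc by (subst delta_pow_mult; auto simp: delta_pow_mult r)+
  also have "\<dots> = (?r o\<^sub>L ?q) o\<^sub>L b o\<^sub>L (?q o\<^sub>L ?r)" by (simp only: blinfun_compose_assoc)
  finally show ?case by (simp only: rq)
qed simp

text \<open>The graph of the character of \<open>B\<close> with sequence \<open>x\<close>, read off at the index \<open>N\<close>. The
  projection \<open>Q\<close> is \<open>1\<close> for infinite sequences and \<open>1 - U\<^sup>* U\<close> for sequences ending at \<open>x\<^sub>N \<in> Y\<close>, where
  it removes the contribution of the generators of index larger than \<open>N\<close>.\<close>

definition char_graph :: "(nat \<Rightarrow> 'h op \<Rightarrow> complex) \<Rightarrow> 'h op \<Rightarrow> nat \<Rightarrow> ('h op \<times> complex) set" where
  "char_graph x Q N =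
     {(b, z). b \<in> B \<and> (\<exists>a\<in>A. Q o\<^sub>L (delta U ^^ N) b = Q o\<^sub>L a \<and> z = x N a)}"

lemma char_graphI:
  "b \<in> B \<Longrightarrow> a \<in> A \<Longrightarrow> Q o\<^sub>L (delta U ^^ N) b = Q o\<^sub>L a \<Longrightarrow> z = x N a \<Longrightarrow> (b, z) \<in> char_graph x Q N"
  by (auto simp: char_graph_def)

context
  fixes x :: "nat \<Rightarrow> 'h op \<Rightarrow> complex" and N :: nat
  assumes start: "x 0 \<in> characters A"
    and chain: "\<forall>n\<in>{1..N}. x n \<in> dual_dom A (delta U) \<and> dual_map A (delta U) (x n) = x (n - 1)"
begin

lemma chain_char: "n \<le> N \<Longrightarrow> x n \<in> characters A"
  using start chain by (cases n) (auto simp: dual_dom_def)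

lemma chain_delta_pow: "n + k \<le> N \<Longrightarrow> a \<in> A \<Longrightarrow> x (n + k) ((delta U ^^ k) a) = x n a"
proof (induction k)
  case (Suc k)
  then have "dual_map A (delta U) (x (Suc (n + k))) = x (n + k)" using chain by simp
  then have "x (Suc (n + k)) (delta U ((delta U ^^ k) a)) = x (n + k) ((delta U ^^ k) a)"
    using delta_pow_mem[OF Suc.prems(2), of k] by (metis comp_apply dual_map_def restrict_apply')
  then show ?case using Suc by simp
qed simp

lemma chain_delta_pow_one: "n \<le> N \<Longrightarrow> x n ((delta U ^^ n) id_blinfun) = 1"
  using chain_delta_pow[of 0 n id_blinfun] start by (simp add: char_one)

text \<open>Up to index \<open>N\<close>, \<open>(delta U ^^ N) (gen n a)\<close> is itself an
  element of A and serves as witness for every \<open>Q\<close>. Its value under \<open>x N\<close>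
  is \<open>x n (e a e)\<close>, and \<open>x n e = 1\<close>.\<close>

lemma char_graph_gen:
  assumes "n \<le> N" "a \<in> A"
  shows "(gen n a, x n a) \<in> char_graph x Q N"
proof -
  let ?e = "(delta U ^^ n) id_blinfun"
  let ?c = "?e o\<^sub>L a o\<^sub>L ?e"
  have c: "?c \<in> A" using assms by auto
  have "(delta U ^^ N) (gen n a) = (delta U ^^ (N - n)) ((delta U ^^ n) (gen n a))"
    using assms(1) by (metis comp_apply funpow_add le_add_diff_inverse2)
  also have "\<dots> = (delta U ^^ (N - n)) ?c" using delta_pow_gen assms(2) alg_subset by simp
  finally have 1: "(delta U ^^ N) (gen n a) = (delta U ^^ (N - n)) ?c" .
  have "x N ((delta U ^^ (N - n)) ?c) = x n ?c"
    using chain_delta_pow[of n "N - n" ?c] c assms(1) by simp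
  also have "\<dots> = x n a"
    using assms chain_delta_pow_one[of n] by (simp add: char_mult[OF chain_char])
  finally show ?thesis
    unfolding char_graph_def using 1 c assms(2) by auto
qed

context
  fixes Q
  assumes Q: "Q \<in> B" "norm Q \<le> 1" and bound: "\<And>a. a \<in> A \<Longrightarrow> cmod (x N a) \<le> norm (Q o\<^sub>L a)"
begin

lemma char_graph_bound: "(b, z) \<in> char_graph x Q N \<Longrightarrow> cmod z \<le> norm b"
proof -
  assume "(b, z) \<in> char_graph x Q N"
  then obtain a where a: "a \<in> A" "Q o\<^sub>L (delta U ^^ N) b = Q o\<^sub>L a" "z = x N a"
    by (auto simp: char_graph_def)
  have "cmod z \<le> norm (Q o\<^sub>L (delta U ^^ N) b)" using bound a by simp
  also have "\<dots> \<le> norm Q * norm ((delta U ^^ N) b)" by (rule norm_blinfun_compose)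
  also have "\<dots> \<le> 1 * norm b" using Q norm_delta_pow_le by (intro mult_mono) auto
  finally show ?thesis by simp
qed

lemma char_graph_add:
  "(b, z) \<in> char_graph x Q N \<Longrightarrow> (c, w) \<in> char_graph x Q N \<Longrightarrow> (b + c, z + w) \<in> char_graph x Q N"
proof -
  assume "(b, z) \<in> char_graph x Q N" "(c, w) \<in> char_graph x Q N"
  then obtain a d where a: "a \<in> A" "Q o\<^sub>L (delta U ^^ N) b = Q o\<^sub>L a" "z = x N a" "b \<in> B"
    and d: "d \<in> A" "Q o\<^sub>L (delta U ^^ N) c = Q o\<^sub>L d" "w = x N d" "c \<in> B"
    by (auto simp: char_graph_def)
  then show ?thesis
    by (intro char_graphI[of _ "a + d"])
      (auto simp: delta_pow_linear blinfun_compose_simps char_add[OF chain_char])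
qed

lemma char_graph_scale: "(b, z) \<in> char_graph x Q N \<Longrightarrow> (op_scale c b, c * z) \<in> char_graph x Q N"
proof -
  assume "(b, z) \<in> char_graph x Q N"
  then obtain a where "a \<in> A" "Q o\<^sub>L (delta U ^^ N) b = Q o\<^sub>L a" "z = x N a" "b \<in> B"
    by (auto simp: char_graph_def)
  then show ?thesis using Q(1)
    by (intro char_graphI[of _ "op_scale c a"])
      (auto simp: delta_pow_linear op_scale_compose_right char_scale[OF chain_char])
qed

text \<open>A single \<open>Q\<close> serves both factors: since it commutes with \<open>a\<close>,
  one gets \<open>Q b' c' = Q a c' = a Q c' = a Q d = Q a d\<close>, where \<open>b'\<close> and
  \<open>c'\<close> are the images under \<open>delta U ^^ N\<close>.\<close>

lemma char_graph_mult:
  "(b, z) \<in> char_graph x Q N \<Longrightarrow> (c, w) \<in> char_graph x Q N \<Longrightarrow> (b o\<^sub>L c, z * w) \<in> char_graph x Q N"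
proof -
  assume "(b, z) \<in> char_graph x Q N" "(c, w) \<in> char_graph x Q N"
  then obtain a d where a: "a \<in> A" "Q o\<^sub>L (delta U ^^ N) b = Q o\<^sub>L a" "z = x N a" "b \<in> B"
    and d: "d \<in> A" "Q o\<^sub>L (delta U ^^ N) c = Q o\<^sub>L d" "w = x N d" "c \<in> B"
    by (auto simp: char_graph_def)
  note comm = B.compose_comm[OF Q(1) alg_subset[OF a(1)]]
  have "Q o\<^sub>L (delta U ^^ N) (b o\<^sub>L c) = (Q o\<^sub>L (delta U ^^ N) b) o\<^sub>L (delta U ^^ N) c"
    using a d by (simp add: delta_pow_mult flip: blinfun_compose_assoc)
  also have "\<dots> = a o\<^sub>L (Q o\<^sub>L (delta U ^^ N) c)"
    unfolding a(2) comm by (rule blinfun_compose_assoc)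
  also have "\<dots> = Q o\<^sub>L (a o\<^sub>L d)"
    unfolding d(2) blinfun_compose_assoc[symmetric] comm ..
  finally show ?thesis
    using a d by (intro char_graphI[of _ "a o\<^sub>L d"]) (auto simp: char_mult[OF chain_char])
qed

end

lemma char_graph_one: "(id_blinfun, 1) \<in> char_graph x Q N"
  using char_graph_gen[of 0 id_blinfun] start by (simp add: char_one)

end

lemma character_from_graph:
  assumes bound: "\<And>b z. (b, z) \<in> R \<Longrightarrow> cmod z \<le> norm b"
    and add: "\<And>b z c w. (b, z) \<in> R \<Longrightarrow> (c, w) \<in> R \<Longrightarrow> (b + c, z + w) \<in> R"
    and scale: "\<And>b z c. (b, z) \<in> R \<Longrightarrow> (op_scale c b, c * z) \<in> R"
    and mult: "\<And>b z c w. (b, z) \<in> R \<Longrightarrow> (c, w) \<in> R \<Longrightarrow> (b o\<^sub>L c, z * w) \<in> R"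
    and one: "(id_blinfun, 1) \<in> R" and dom: "fst ` R \<subseteq> B"
    and gen: "\<And>n a. a \<in> A \<Longrightarrow> (gen n a, y n a) \<in> R"
    and extl: "\<And>n. y n \<in> extensional A"
  shows "y \<in> ext_seq A U ` characters B"
proof -
  have "b \<in> fst ` R" if "b \<in> gen_span" for b
    using that
  proof (induction rule: gen_span.induct)
    case (gen a n)
    then show ?case using assms(7) by force
  next
    case (add b c)
    then show ?case using assms(2) by force
  qed
  then have "B \<subseteq> closure (fst ` R)" unfolding ext_algebra_eq by (intro closure_mono) blast
  then obtain t where t: "t \<in> characters B" "\<And>b z. (b, z) \<in> R \<Longrightarrow> t b = z"
    using B.character_of_relation[of R, OF dom _ bound add scale mult one] by metis
  have "ext_seq A U t n = y n" for n
    by (rule extensionalityI[of _ A]) (use t(2) gen extl in \<open>auto simp: ext_seq_def\<close>)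
  then have "ext_seq A U t = y" by auto
  then show ?thesis using t(1) by blast
qed

lemma ext_M_fin_subset: "ext_M_fin A U N \<subseteq> ext_seq A U ` characters B"
proof
  fix x assume x: "x \<in> ext_M_fin A U N"
  have chain: "\<forall>n\<in>{1..N}. x n \<in> dual_dom A (delta U) \<and> dual_map A (delta U) (x n) = x (n - 1)"
    and Y: "x N \<in> ext_Y A U" and zero: "\<And>n. n > N \<Longrightarrow> x n = zero_functional A"
    using x by (auto simp: ext_M_fin_def)
  \<comment> \<open>For \<open>N = 0\<close> this is part of \<open>x N \<in> ext_Y A U\<close>;
    otherwise \<open>x 0\<close> is the image of \<open>x 1\<close> under the dual map.\<close>
  have start: "x 0 \<in> characters A"
    using Y bspec[OF chain, of 1] dual_map_character[of "x 1"] by (cases N) (auto simp: ext_Y_vanish)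
  note ctx = start chain
  have P: "P \<in> B" "norm P \<le> 1" using norm_projection_le[OF P_projection] by auto
  have bound: "cmod (x N a) \<le> norm (P o\<^sub>L a)" if "a \<in> A" for a by (rule ext_Y_bound[OF Y that])
  show "x \<in> ext_seq A U ` characters B"
  proof (rule character_from_graph)
    show "(gen n a, x n a) \<in> char_graph x P N" if a: "a \<in> A" for n a
    proof (cases "n \<le> N")
      case True
      then show ?thesis using char_graph_gen[OF ctx] a by blast
    next
      case False
      \<comment> \<open>A positive index \<open>Suc k\<close> survives the \<open>N\<close>
        applications of \<open>delta U\<close>. Such a generator begins with \<open>V\<close>, and
        \<open>P\<close> annihilates the range of \<open>V\<close>.\<close>
      then obtain k where k: "n = N + Suc k" by (metis add_Suc_right less_imp_Suc_add not_le)
      let ?g = "gen (Suc k) a" and ?e = "(delta U ^^ N) id_blinfun"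
      have g: "?g \<in> B" "?e \<in> B" using a by auto
      have "P o\<^sub>L ?g = 0"
        by (rule blinfun_eqI) (simp only: blinfun_apply_blinfun_compose P_apply, simp add: delta_star_apply)
      then have "(P o\<^sub>L ?e) o\<^sub>L ?g = 0"
        using B.compose_comm[OF P(1) g(2)] by (simp add: blinfun_compose_assoc blinfun_compose.zero_right)
      moreover have "(delta U ^^ N) (gen n a) = ?e o\<^sub>L ?g o\<^sub>L ?e"
        unfolding k funpow_add o_apply by (rule delta_pow_gen[OF g(1)])
      ultimately have "P o\<^sub>L (delta U ^^ N) (gen n a) = P o\<^sub>L 0"
        by (simp add: blinfun_compose.zero_left blinfun_compose.zero_right flip: blinfun_compose_assoc)
      moreover have "x N 0 = 0" using Y char_zero by (simp add: ext_Y_vanish)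
      moreover have "x n a = 0" using zero False a by (simp add: zero_functional_apply)
      ultimately show ?thesis
        using a by (intro char_graphI[of _ 0]) auto
    qed
    show "x n \<in> extensional A" for n
      using zero chain_char[OF ctx, of n] char_extensional
      by (cases "n \<le> N") (auto simp: zero_functional_def)
  qed (use char_graph_bound[OF ctx P bound] char_graph_add[OF ctx P bound] char_graph_scale[OF ctx P bound]
      char_graph_mult[OF ctx P bound] char_graph_one[OF ctx] in \<open>auto simp: char_graph_def\<close>)
qed

text \<open>No single \<open>N\<close> reaches all generators, so the graph is the union over
  \<open>N\<close>. The graphs increase because \<open>x N = x (Suc N) \<circ> delta U\<close> on A,
  and any two pairs therefore meet at a common stage.\<close>

lemma ext_M_inf_subset: "ext_M_inf A U \<subseteq> ext_seq A U ` characters B"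
proof
  fix x assume x: "x \<in> ext_M_inf A U"
  have chain: "\<forall>n\<in>{1..N}. x n \<in> dual_dom A (delta U) \<and> dual_map A (delta U) (x n) = x (n - 1)" for N
    using x by (auto simp: ext_M_inf_def)
  have start: "x 0 \<in> characters A" using bspec[OF chain[of 1], of 1] dual_map_character[of "x 1"] by auto
  note ctx = start chain
  have char: "x n \<in> characters A" for n by (rule chain_char[OF ctx order_refl])
  let ?G = "\<lambda>N. char_graph x id_blinfun N"
  have Q: "id_blinfun \<in> B" "norm (id_blinfun :: 'h op) \<le> 1" by (auto simp: norm_blinfun_id_le)
  have bound: "cmod (x N a) \<le> norm (id_blinfun o\<^sub>L a)" if "a \<in> A" for a N
    using char_bound[OF char] that by simp
  have step: "?G N \<subseteq> ?G (Suc N)" for N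
  proof
    fix p assume "p \<in> ?G N"
    then obtain b a where p: "p = (b, x N a)" "b \<in> B" "a \<in> A" "(delta U ^^ N) b = a"
      by (auto simp: char_graph_def)
    have "x N a = x (Suc N) (delta U a)"
      using bspec[OF chain[of "Suc N"], of "Suc N"] p(3) by (auto simp: dual_map_def dest!: fun_cong[of _ _ a])
    then show "p \<in> ?G (Suc N)" using p by (auto simp: char_graph_def)
  qed
  have mono: "?G m \<subseteq> ?G n" if "m \<le> n" for m n
    by (rule lift_Suc_mono_le[of ?G, OF step that])
  have two: "\<exists>N. p \<in> ?G N \<and> q \<in> ?G N" if pq: "p \<in> (\<Union>N. ?G N)" "q \<in> (\<Union>N. ?G N)" for p q
  proof -
    obtain m n where "p \<in> ?G m" "q \<in> ?G n" using pq by blast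
    then have "p \<in> ?G (max m n)" "q \<in> ?G (max m n)"
      using subsetD[OF mono[of m "max m n"]] subsetD[OF mono[of n "max m n"]] by simp_all
    then show ?thesis by blast
  qed
  show "x \<in> ext_seq A U ` characters B"
  proof (rule character_from_graph)
    show "(gen n a, x n a) \<in> (\<Union>N. ?G N)" if "a \<in> A" for n a
      by (rule UN_I[of n UNIV _ ?G, OF UNIV_I char_graph_gen[OF ctx order_refl that]])
    show "(id_blinfun, 1) \<in> (\<Union>N. ?G N)" by (rule UN_I[of 0 UNIV _ ?G, OF UNIV_I char_graph_one[OF ctx]])
    fix b z assume b: "(b, z) \<in> (\<Union>N. ?G N)"
    then obtain N where N: "(b, z) \<in> ?G N" by (rule UN_E)
    show "cmod z \<le> norm b" by (rule char_graph_bound[OF ctx Q bound N])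
    show "(op_scale c b, c * z) \<in> (\<Union>N. ?G N)" for c
      by (rule UN_I[of N UNIV _ ?G, OF UNIV_I char_graph_scale[OF ctx Q bound N]])
    fix c w assume "(c, w) \<in> (\<Union>N. ?G N)"
    from two[OF b this] obtain K where K: "(b, z) \<in> ?G K" "(c, w) \<in> ?G K" by blast
    show "(b + c, z + w) \<in> (\<Union>N. ?G N)"
      by (rule UN_I[of K UNIV _ ?G, OF UNIV_I char_graph_add[OF ctx Q bound K]])
    show "(b o\<^sub>L c, z * w) \<in> (\<Union>N. ?G N)"
      by (rule UN_I[of K UNIV _ ?G, OF UNIV_I char_graph_mult[OF ctx Q bound K]])
  qed (use char char_extensional in \<open>auto simp: char_graph_def\<close>)
qed

lemma ext_seq_image: "ext_seq A U ` characters B = ext_M A U"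
proof
  show "ext_seq A U ` characters B \<subseteq> ext_M A U" using ext_seq_mem by blast
  show "ext_M A U \<subseteq> ext_seq A U ` characters B"
    unfolding ext_M_def using ext_M_fin_subset ext_M_inf_subset by blast
qed

end

section \<open>Topology\<close>

context comm_cstar
begin

lemma functionals_extensional: "insert (zero_functional A) (characters A) \<subseteq> extensional A"
  by (auto simp: characters_def zero_functional_def)

lemma topspace_product_UNIV: "topspace (product_topology (\<lambda>_. euclidean) A) = extensional A"
  by (auto simp: PiE_def)

text \<open>Since the characters are the functionals \<open>x\<close> in \<open>M \<union> {0}\<close> with \<open>x 1 = 1\<close>, the point \<open>0\<close>
  is isolated already for pointwise convergence.\<close>

lemma max_ideal_space0_eq: "max_ideal_space0 A =
  subtopology (product_topology (\<lambda>_. euclidean) A) (insert (zero_functional A) (characters A))"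
  unfolding topology_eq
proof (intro allI iffI)
  let ?X = "product_topology (\<lambda>_. euclidean :: complex topology) A"
  let ?M0 = "insert (zero_functional A) (characters A)"
  have eval: "openin ?X {f \<in> topspace ?X. f id_blinfun \<in> W}" if "open W" for W
    using openin_continuous_map_preimage[OF continuous_map_product_projection[of id_blinfun A "\<lambda>_. euclidean"]] that
    by simp
  have M0: "?M0 \<subseteq> topspace ?X"
    unfolding topspace_product_UNIV by (rule functionals_extensional)
  fix S
  {
    assume S: "openin (max_ideal_space0 A) S"
    then have sub: "S \<subseteq> ?M0" and "openin (max_ideal_space A) (S \<inter> characters A)"
      by (auto simp: openin_max_ideal_space0)
    then obtain T where T: "openin ?X T" "S \<inter> characters A = T \<inter> characters A"
      unfolding max_ideal_space_def openin_subtopology by blast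
    \<comment> \<open>\<open>W1\<close> removes the zero functional from \<open>T\<close>, and
      \<open>W0\<close> contains it but no character; both are cut out by the value at the
      identity.\<close>
    define W1 where "W1 = T \<inter> {f \<in> topspace ?X. f id_blinfun \<in> - {0}}"
    define W0 where "W0 = {f \<in> topspace ?X. f id_blinfun \<in> - {1}}"
    have W: "openin ?X W1" "openin ?X W0"
      unfolding W1_def W0_def
      by (rule openin_Int[OF T(1) eval[of "- {0}"]], simp add: open_Compl)
        (rule eval[of "- {1}"], simp add: open_Compl)
    have char_nonzero_one: "x id_blinfun \<noteq> 0" if "x \<in> characters A" for x
      using char_one[OF that] by simp
    have W1M: "W1 \<inter> ?M0 = S \<inter> characters A"
      using T(2) M0 sub char_nonzero_one zero_functional_apply[OF id_mem]
      unfolding W1_def by (auto simp: set_eq_iff)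
    have W0M: "W0 \<inter> ?M0 = {zero_functional A}"
      using M0 char_one zero_functional_apply[OF id_mem] unfolding W0_def by auto
    have "S = (if zero_functional A \<in> S then W1 \<union> W0 else W1) \<inter> ?M0"
    proof -
      have "(W1 \<union> W0) \<inter> ?M0 = (S \<inter> characters A) \<union> {zero_functional A}"
        by (simp only: Int_Un_distrib2 W1M W0M)
      then show ?thesis using W1M sub by auto
    qed
    moreover have "openin ?X (if zero_functional A \<in> S then W1 \<union> W0 else W1)"
      using W by (simp add: openin_Un)
    ultimately show "openin (subtopology ?X ?M0) S"
      unfolding openin_subtopology by blast
  next
    assume "openin (subtopology ?X ?M0) S"
    then obtain T where "openin ?X T" "S = T \<inter> ?M0" unfolding openin_subtopology by blast
    then have "S \<inter> characters A = T \<inter> characters A" by blast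
    then show "openin (max_ideal_space0 A) S"
      unfolding openin_max_ideal_space0 max_ideal_space_def openin_subtopology
      using \<open>openin ?X T\<close> \<open>S = T \<inter> ?M0\<close> by blast
  }
qed

lemma topspace_max_ideal_space: "topspace (max_ideal_space A) = characters A"
  unfolding max_ideal_space_def topspace_subtopology topspace_product_UNIV
  using functionals_extensional by blast

lemma continuous_map_max_ideal_space:
  "continuous_map X (max_ideal_space A) f \<longleftrightarrow>
    f \<in> topspace X \<rightarrow> characters A \<and> (\<forall>a\<in>A. continuous_map X euclidean (\<lambda>s. f s a))"
  unfolding max_ideal_space_def continuous_map_in_subtopology continuous_map_componentwise
  using functionals_extensional by blast

lemma topspace_max_ideal_space0:
  "topspace (max_ideal_space0 A) = insert (zero_functional A) (characters A)"
  unfolding max_ideal_space0_eq topspace_subtopology topspace_product_UNIV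
  using functionals_extensional by blast

lemma continuous_map_max_ideal_space0:
  "continuous_map X (max_ideal_space0 A) f \<longleftrightarrow>
    f \<in> topspace X \<rightarrow> insert (zero_functional A) (characters A) \<and>
    (\<forall>a\<in>A. continuous_map X euclidean (\<lambda>s. f s a))"
  unfolding max_ideal_space0_eq continuous_map_in_subtopology continuous_map_componentwise
  using functionals_extensional by blast

end

context cstar_dynamics
begin

lemma ext_M_cases: "s \<in> ext_M A U \<Longrightarrow> s n \<in> insert (zero_functional A) (characters A)"
  using ext_seq_cases unfolding ext_seq_image[symmetric] by blast

lemma ext_M_zero: "s \<in> ext_M A U \<Longrightarrow> s 0 \<in> characters A"
  using ext_seq_char_iff[of _ 0] B.char_one unfolding ext_seq_image[symmetric] by auto

lemma topspace_ext_space: "topspace (ext_space A U) = ext_M A U"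
  using ext_M_cases by (auto simp: ext_space_def topspace_max_ideal_space0)

text \<open>Every topology involved is one of pointwise convergence, so continuity into the sequence
  space is tested on scalar functions.\<close>

lemma continuous_map_ext_space:
  "continuous_map X (ext_space A U) f \<longleftrightarrow> f \<in> topspace X \<rightarrow> ext_M A U \<and>
    (\<forall>n. \<forall>a\<in>A. continuous_map X euclidean (\<lambda>s. f s n a))"
proof -
  have "(\<lambda>s. f s n) \<in> topspace X \<rightarrow> insert (zero_functional A) (characters A)"
    if "f \<in> topspace X \<rightarrow> ext_M A U" for n
    using ext_M_cases funcset_mem[OF that] by (intro funcsetI) blast
  then show ?thesis
    unfolding ext_space_def continuous_map_in_subtopology continuous_map_componentwise_UNIV
      continuous_map_max_ideal_space0
    by metis
qed

lemma continuous_map_ext_space_apply: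
  "a \<in> A \<Longrightarrow> continuous_map (ext_space A U) euclidean (\<lambda>s. s n a)"
  using continuous_map_ext_space[of "ext_space A U" id] by auto

lemma closedin_ext_Y: "closedin (max_ideal_space A) (ext_Y A U)"
proof -
  let ?I = "{a \<in> A. delta_star U id_blinfun o\<^sub>L a = a}"
  have "closedin (max_ideal_space A) {x \<in> topspace (max_ideal_space A). x a \<in> {0}}" if "a \<in> A" for a
    using continuous_map_max_ideal_space[of "max_ideal_space A" id] that
    by (intro closedin_continuous_map_preimage[of _ euclidean]) auto
  then have "closedin (max_ideal_space A)
      (\<Inter>a\<in>?I. {x \<in> topspace (max_ideal_space A). x a \<in> {0}})"
    by (intro closedin_Inter) (auto simp: blinfun_compose.zero_right)
  \<comment> \<open>A nonempty index set keeps the intersection inside the space of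
    characters.\<close>
  moreover have "0 \<in> ?I" by (simp add: blinfun_compose.zero_right)
  then have "(\<Inter>a\<in>?I. {x \<in> topspace (max_ideal_space A). x a \<in> {0}})
      = {x \<in> characters A. \<forall>a\<in>?I. x a = 0}"
    unfolding topspace_max_ideal_space by blast
  moreover have "{x \<in> characters A. \<forall>a\<in>?I. x a = 0} = ext_Y A U" by (auto simp: ext_Y_vanish)
  ultimately show ?thesis by simp
qed

text \<open>Values at elements of the span of the generators are continuous functions of the sequence,
  and values at arbitrary elements are uniform limits of these.\<close>

lemma homeomorphic_ext_seq:
  "homeomorphic_map (max_ideal_space B) (ext_space A U) (ext_seq A U)"
proof -
  define g where "g = inv_into (characters B) (ext_seq A U)"
  have inj: "inj_on (ext_seq A U) (characters B)" using ext_seq_inj by (auto simp: inj_on_def)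
  have g: "g s \<in> characters B" "ext_seq A U (g s) = s" if "s \<in> ext_M A U" for s
    using that inv_into_into f_inv_into_f unfolding g_def ext_seq_image[symmetric] by metis+
  have "homeomorphic_maps (max_ideal_space B) (ext_space A U) (ext_seq A U) g"
    unfolding homeomorphic_maps_def
  proof (intro conjI ballI)
    show "continuous_map (max_ideal_space B) (ext_space A U) (ext_seq A U)"
      unfolding continuous_map_ext_space B.topspace_max_ideal_space
    proof (intro conjI allI ballI)
      show "ext_seq A U \<in> characters B \<rightarrow> ext_M A U" using ext_seq_mem by blast
      show "continuous_map (max_ideal_space B) euclidean (\<lambda>x. ext_seq A U x n a)" if "a \<in> A" for n a
        using B.continuous_map_max_ideal_space[of "max_ideal_space B" id] that
        by (simp add: ext_seq_apply)
    qed
    show "continuous_map (ext_space A U) (max_ideal_space B) g"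
      unfolding B.continuous_map_max_ideal_space topspace_ext_space
    proof (intro conjI ballI)
      show "g \<in> ext_M A U \<rightarrow> characters B" using g by blast
      have span: "continuous_map (ext_space A U) euclidean (\<lambda>s. g s b)" if "b \<in> gen_span" for b
        using that
      proof (induction rule: gen_span.induct)
        case (gen a n)
        have "g s ((delta_star U ^^ n) a) = s n a" if "s \<in> ext_M A U" for s
          using ext_seq_apply[OF gen, of "g s" n] g(2)[OF that] by simp
        then show ?case
          using continuous_map_eq[OF continuous_map_ext_space_apply[OF gen, of n]]
          by (simp add: topspace_ext_space)
      next
        case (add b c)
        have "g s (b + c) = g s b + g s c" if "s \<in> ext_M A U" for s
          using B.char_add[OF g(1)[OF that]] add gen_span_subset by blast
        then show ?case
          using continuous_map_eq[OF continuous_map_add[OF add.IH]] by (simp add: topspace_ext_space)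
      qed
      fix b assume b: "b \<in> B"
      then obtain X where X: "\<And>n. X n \<in> gen_span" "X \<longlonglongrightarrow> b"
        unfolding ext_algebra_eq closure_sequential by blast
      have "continuous_map (ext_space A U) Met_TC.mtopology (\<lambda>s. g s b)"
      proof (rule Met_TC.continuous_map_uniform_limit)
        show "\<forall>\<^sub>F n in sequentially. continuous_map (ext_space A U) Met_TC.mtopology (\<lambda>s. g s (X n))"
          using span X(1) by simp
        fix e :: real assume "0 < e"
        then have "\<forall>\<^sub>F n in sequentially. dist (X n) b < e" using X(2) by (simp add: tendstoD)
        then show "\<forall>\<^sub>F n in sequentially. \<forall>s\<in>topspace (ext_space A U).
            g s b \<in> UNIV \<and> dist (g s (X n)) (g s b) < e"
        proof (eventually_elim, intro ballI conjI UNIV_I)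
          fix n s assume n: "dist (X n) b < e" and "s \<in> topspace (ext_space A U)"
          then have gs: "g s \<in> characters B" using g(1) by (simp add: topspace_ext_space)
          have Xn: "X n \<in> B" using X(1) gen_span_subset by blast
          have "cmod (g s (X n - b)) \<le> norm (X n - b)" using B.char_bound[OF gs] Xn b by simp
          then show "dist (g s (X n)) (g s b) < e"
            using n Xn b by (simp add: dist_norm B.char_diff[OF gs])
        qed
      qed simp
      then show "continuous_map (ext_space A U) euclidean (\<lambda>s. g s b)" by simp
    qed
    fix x assume "x \<in> topspace (max_ideal_space B)"
    then show "g (ext_seq A U x) = x"
      using inv_into_f_f[OF inj] by (simp add: g_def B.topspace_max_ideal_space)
  next
    fix s assume "s \<in> topspace (ext_space A U)"
    then show "ext_seq A U (g s) = s" using g(2) by (simp add: topspace_ext_space)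
  qed
  then show ?thesis by (rule homeomorphic_maps_imp_map)
qed

subsection \<open>The dual partial homeomorphisms\<close>

lemma ext_Delta_iff: "s \<in> ext_Delta A U \<longleftrightarrow> s \<in> ext_M A U \<and> s 0 (delta U id_blinfun) \<noteq> 0"
  using ext_M_zero by (auto simp: ext_Delta_def dual_dom_def)

lemma ext_Delta_one: "s \<in> ext_Delta A U \<Longrightarrow> s 0 (delta U id_blinfun) = 1"
  using dual_dom_one(2) by (auto simp: ext_Delta_def)

lemma ext_Delta_star_iff: "s \<in> ext_Delta_star A U \<longleftrightarrow> s \<in> ext_M A U \<and> s 1 id_blinfun \<noteq> 0"
  using char_or_zero_one(2)[OF ext_M_cases] by (auto simp: ext_Delta_star_def)

lemma ext_Delta_star_one: "s \<in> ext_Delta_star A U \<Longrightarrow> s 1 id_blinfun = 1"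
  using char_or_zero_one[OF ext_M_cases[of s 1]] by (auto simp: ext_Delta_star_def)

text \<open>A continuous function with values 0 and 1 yields the same set as preimage of the open
  complement of 0 and of the closed set containing only 1.\<close>

lemma clopen_ext_space:
  assumes a: "a \<in> A" and S: "\<And>s. s \<in> S \<longleftrightarrow> s \<in> ext_M A U \<and> s n a \<noteq> 0" "\<And>s. s \<in> S \<Longrightarrow> s n a = 1"
  shows "openin (ext_space A U) S" "closedin (ext_space A U) S"
proof -
  note cont = continuous_map_ext_space_apply[OF a, of n]
  have "S = {s \<in> topspace (ext_space A U). s n a \<in> - {0}}"
    "S = {s \<in> topspace (ext_space A U). s n a \<in> {1}}"
    using S by (auto simp: topspace_ext_space)
  then show "openin (ext_space A U) S" "closedin (ext_space A U) S"
    using openin_continuous_map_preimage[OF cont, of "- {0}"]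
      closedin_continuous_map_preimage[OF cont, of "{1}"] by auto
qed

lemma ext_alpha_mem:
  assumes "s \<in> ext_Delta A U"
  shows "ext_alpha A U s \<in> ext_Delta_star A U"
proof -
  have s: "s \<in> ext_M A U" "s 0 \<in> dual_dom A (delta U)" using assms by (auto simp: ext_Delta_def)
  \<comment> \<open>Prefixing shifts indices by one: the new link at \<open>m = 0\<close> comes from
    \<open>s 0\<close> lying in \<Delta>, all others are links of \<open>s\<close>. Hence the
    condition on \<open>m\<close> is guarded.\<close>
  have chain: "ext_alpha A U s n \<in> dual_dom A (delta U) \<and>
      dual_map A (delta U) (ext_alpha A U s n) = ext_alpha A U s (n - 1)"
    if n: "n = Suc m" and m: "1 \<le> m \<Longrightarrow> s m \<in> dual_dom A (delta U) \<and> dual_map A (delta U) (s m) = s (m - 1)" for n m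
    using s(2) m n by (cases m) (auto simp: ext_alpha_def)
  have "ext_alpha A U s \<in> ext_M A U"
    using s(1) unfolding ext_M_def
  proof (elim UnE UN_E)
    fix N assume "s \<in> ext_M_fin A U N"
    then have "ext_alpha A U s \<in> ext_M_fin A U (Suc N)"
      unfolding ext_M_fin_def
      using chain by (auto simp: ext_alpha_def split: nat.split)
    then show "ext_alpha A U s \<in> (\<Union>N. ext_M_fin A U N) \<union> ext_M_inf A U" by blast
  next
    assume s: "s \<in> ext_M_inf A U"
    have "ext_alpha A U s \<in> ext_M_inf A U"
      unfolding ext_M_inf_def
    proof (intro CollectI allI impI)
      fix n :: nat assume "1 \<le> n"
      then obtain m where m: "n = Suc m" by (cases n) auto
      show "ext_alpha A U s n \<in> dual_dom A (delta U) \<and>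
          dual_map A (delta U) (ext_alpha A U s n) = ext_alpha A U s (n - 1)"
        by (rule chain[OF m]) (use s in \<open>simp add: ext_M_inf_def\<close>)
    qed
    then show "ext_alpha A U s \<in> (\<Union>N. ext_M_fin A U N) \<union> ext_M_inf A U" by blast
  qed
  moreover have "ext_alpha A U s 1 id_blinfun = 1"
    using s(2) char_one by (simp add: ext_alpha_def dual_dom_def)
  ultimately show ?thesis by (simp add: ext_Delta_star_iff)
qed

lemma ext_alpha_inv_mem:
  assumes "s \<in> ext_Delta_star A U"
  shows "ext_alpha_inv s \<in> ext_Delta A U" "ext_alpha A U (ext_alpha_inv s) = s"
proof -
  have s: "s \<in> ext_M A U" "s 1 \<noteq> zero_functional A" using assms by (auto simp: ext_Delta_star_def)
  have "ext_alpha_inv s \<in> ext_M A U \<and> s 1 \<in> dual_dom A (delta U) \<and> dual_map A (delta U) (s 1) = s 0"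
    using s(1) unfolding ext_M_def
  proof (elim UnE UN_E)
    fix N assume N: "s \<in> ext_M_fin A U N"
    \<comment> \<open>A sequence with \<open>N = 0\<close> would have \<open>s 1\<close> equal to
      zero; dropping \<open>s 0\<close> then leaves a sequence ending at
      \<open>N - 1\<close>.\<close>
    then obtain K where K: "N = Suc K" using s(2) by (cases N) (auto simp: ext_M_fin_def)
    then have "ext_alpha_inv s \<in> ext_M_fin A U K"
      using N by (auto simp: ext_M_fin_def ext_alpha_inv_def)
    then show "ext_alpha_inv s \<in> (\<Union>N. ext_M_fin A U N) \<union> ext_M_inf A U \<and>
        s 1 \<in> dual_dom A (delta U) \<and> dual_map A (delta U) (s 1) = s 0"
      using N K by (auto simp: ext_M_fin_def)
  next
    assume "s \<in> ext_M_inf A U"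
    then have "ext_alpha_inv s \<in> ext_M_inf A U \<and> s 1 \<in> dual_dom A (delta U) \<and>
        dual_map A (delta U) (s 1) = s 0"
      unfolding ext_M_inf_def ext_alpha_inv_def by (auto dest: spec[of _ "Suc _"])
    then show "ext_alpha_inv s \<in> (\<Union>N. ext_M_fin A U N) \<union> ext_M_inf A U \<and>
        s 1 \<in> dual_dom A (delta U) \<and> dual_map A (delta U) (s 1) = s 0" by blast
  qed
  then show "ext_alpha_inv s \<in> ext_Delta A U" "ext_alpha A U (ext_alpha_inv s) = s"
    by (auto simp: ext_Delta_def ext_alpha_inv_def ext_alpha_def fun_eq_iff split: nat.split)
qed

lemma ext_alpha_inv_alpha: "ext_alpha_inv (ext_alpha A U s) = s"
  by (simp add: ext_alpha_inv_def ext_alpha_def)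

lemma ext_alpha_image: "ext_alpha A U ` ext_Delta A U = ext_Delta_star A U"
  using ext_alpha_mem ext_alpha_inv_mem by (auto simp: image_iff) metis

lemma homeomorphic_ext_alpha:
  "homeomorphic_maps (subtopology (ext_space A U) (ext_Delta A U))
     (subtopology (ext_space A U) (ext_Delta_star A U)) (ext_alpha A U) ext_alpha_inv"
  (is "homeomorphic_maps ?D ?E _ _")
proof -
  have top: "topspace ?D = ext_Delta A U" "topspace ?E = ext_Delta_star A U"
    by (auto simp: topspace_ext_space ext_Delta_def ext_Delta_star_def)
  have subM: "ext_Delta A U \<subseteq> ext_M A U" "ext_Delta_star A U \<subseteq> ext_M A U"
    by (auto simp: ext_Delta_def ext_Delta_star_def)
  have cont: "continuous_map (subtopology (ext_space A U) S) euclidean (\<lambda>s. s n a)" if "a \<in> A" for S n a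
    by (rule continuous_map_from_subtopology[OF continuous_map_ext_space_apply[OF that]])
  \<comment> \<open>Coordinate 0 of the image at \<open>a\<close> is \<open>s 0\<close> at
    \<open>delta U a\<close>, and later coordinates are shifted ones, so each is an evaluation
    already known to be continuous.\<close>
  have "continuous_map ?D euclidean (\<lambda>s. ext_alpha A U s n a)" if "a \<in> A" for n a
    using cont[OF delta_mem[OF that], where n = 0] cont[OF that] that
    by (cases n) (simp_all add: ext_alpha_def dual_map_def)
  then have "continuous_map ?D ?E (ext_alpha A U)"
    using ext_alpha_mem subM
    by (auto simp: continuous_map_in_subtopology continuous_map_ext_space top simp del: topspace_subtopology)
  moreover have "continuous_map ?E ?D ext_alpha_inv"
    using ext_alpha_inv_mem subM cont
    by (auto simp: continuous_map_in_subtopology continuous_map_ext_space top ext_alpha_inv_def[of "_ :: _ \<Rightarrow> _"]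
        simp del: topspace_subtopology)
  ultimately show ?thesis
    unfolding homeomorphic_maps_def top using ext_alpha_inv_mem ext_alpha_inv_alpha by blast
qed

lemma ext_seq_image_subset:
  assumes "\<And>x. x \<in> characters B \<Longrightarrow> x \<in> S \<longleftrightarrow> ext_seq A U x \<in> T" "S \<subseteq> characters B" "T \<subseteq> ext_M A U"
  shows "ext_seq A U ` S = T"
  using assms unfolding ext_seq_image[symmetric] by blast

lemma ext_seq_dual_dom_delta: "ext_seq A U ` dual_dom B (delta U) = ext_Delta A U"
proof (rule ext_seq_image_subset)
  fix x assume x: "x \<in> characters B"
  then show "x \<in> dual_dom B (delta U) \<longleftrightarrow> ext_seq A U x \<in> ext_Delta A U"
    using ext_seq_mem[OF x] by (simp add: dual_dom_def ext_Delta_iff ext_seq_apply)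
qed (auto simp: dual_dom_def ext_Delta_def)

lemma ext_seq_dual_dom_delta_star: "ext_seq A U ` dual_dom B (delta_star U) = ext_Delta_star A U"
proof (rule ext_seq_image_subset)
  fix x assume x: "x \<in> characters B"
  then show "x \<in> dual_dom B (delta_star U) \<longleftrightarrow> ext_seq A U x \<in> ext_Delta_star A U"
    using ext_seq_mem[OF x] by (simp add: dual_dom_def ext_Delta_star_iff ext_seq_apply)
qed (auto simp: dual_dom_def ext_Delta_star_def)

text \<open>On the domain \<open>x (delta U 1) = 1\<close>, so the compression in
  \<open>delta_gen_Suc\<close> is invisible to \<open>x\<close>, and composing with
  \<open>delta U\<close> moves every coordinate up by one index.\<close>

lemma ext_seq_dual_map_delta:
  assumes "x \<in> dual_dom B (delta U)"
  shows "ext_seq A U (dual_map B (delta U) x) = ext_alpha A U (ext_seq A U x)"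
proof (intro ext)
  fix n b
  have x: "x \<in> characters B" using assms by (simp add: dual_dom_def)
  have one: "x (delta U id_blinfun) = 1"
    using ext_Delta_one[of "ext_seq A U x"] ext_seq_dual_dom_delta assms by (auto simp: ext_seq_apply)
  show "ext_seq A U (dual_map B (delta U) x) n b = ext_alpha A U (ext_seq A U x) n b"
  proof (cases n)
    case 0
    then show ?thesis
      using alg_subset by (auto simp: ext_alpha_def ext_seq_def dual_map_def)
  next
    case (Suc m)
    have "x (delta U (gen (Suc m) a)) = x (gen m a)" if "a \<in> A" for a
    proof -
      have "x (delta U (gen (Suc m) a)) = x (delta U id_blinfun) * x (gen m a) * x (delta U id_blinfun)"
        unfolding delta_gen_Suc using that by (simp add: B.char_mult[OF x])
      then show ?thesis by (simp only: one) simp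
    qed
    then show ?thesis
      using gen_mem[of _ "Suc m"] by (auto simp: Suc ext_alpha_def ext_seq_def dual_map_def simp del: funpow.simps(2))
  qed
qed

lemma ext_seq_dual_map_delta_star:
  "ext_seq A U (dual_map B (delta_star U) x) = ext_alpha_inv (ext_seq A U x)"
  by (auto simp: ext_alpha_inv_def ext_seq_def dual_map_def fun_eq_iff)

end

theorem theorem2p5:
  fixes A :: "('h::complex_hilbert_space) op set" and U :: "'h op"
  assumes "cstar_dynamical_system A U"
  shows "unital_comm_cstar_algebra (ext_algebra A U) \<and>
    partial_automorphism (ext_algebra A U) (delta U) \<and>
    partial_automorphism (ext_algebra A U) (delta_star U) \<and>
    closedin (max_ideal_space A) (ext_Y A U) \<and>
    characters A - dual_map A (delta U) ` dual_dom A (delta U) \<subseteq> ext_Y A U \<and>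
    (\<forall>x\<in>characters (ext_algebra A U). \<forall>n. ext_seq A U x n \<in> insert (zero_functional A) (characters A)) \<and>
    homeomorphic_map (max_ideal_space (ext_algebra A U)) (ext_space A U) (ext_seq A U) \<and>
    topspace (ext_space A U) = ext_M A U \<and>
    ext_seq A U ` dual_dom (ext_algebra A U) (delta U) = ext_Delta A U \<and>
    ext_seq A U ` dual_dom (ext_algebra A U) (delta_star U) = ext_Delta_star A U \<and>
    openin (ext_space A U) (ext_Delta A U) \<and>
    closedin (ext_space A U) (ext_Delta A U) \<and>
    openin (ext_space A U) (ext_Delta_star A U) \<and>
    closedin (ext_space A U) (ext_Delta_star A U) \<and>
    ext_alpha A U ` ext_Delta A U = ext_Delta_star A U \<and>
    (\<forall>x\<in>dual_dom (ext_algebra A U) (delta U).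
       ext_seq A U (dual_map (ext_algebra A U) (delta U) x) = ext_alpha A U (ext_seq A U x)) \<and>
    (\<forall>x\<in>dual_dom (ext_algebra A U) (delta_star U).
       ext_seq A U (dual_map (ext_algebra A U) (delta_star U) x) = ext_alpha_inv (ext_seq A U x)) \<and>
    homeomorphic_maps (subtopology (ext_space A U) (ext_Delta A U))
       (subtopology (ext_space A U) (ext_Delta_star A U)) (ext_alpha A U) ext_alpha_inv"
proof -
  interpret cstar_dynamics A U using assms by unfold_locales
  \<comment> \<open>The deciding scalar is coordinate 0 at \<open>delta U 1\<close> for the first
    set and coordinate 1 at the identity for the second.\<close>
  have "openin (ext_space A U) (ext_Delta A U)" "closedin (ext_space A U) (ext_Delta A U)"
    by (rule clopen_ext_space[where n = 0 and a = "delta U id_blinfun"];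
        (rule delta_mem[OF id_mem] ext_Delta_iff | erule ext_Delta_one))+
  moreover have "openin (ext_space A U) (ext_Delta_star A U)"
    "closedin (ext_space A U) (ext_Delta_star A U)"
    by (rule clopen_ext_space[where n = 1 and a = id_blinfun];
        (rule id_mem ext_Delta_star_iff | erule ext_Delta_star_one))+
  ultimately show ?thesis
    using B.comm_cstar partial_automorphism_ext_delta partial_automorphism_ext_delta_star
      closedin_ext_Y not_ext_Y_in_image ext_seq_cases homeomorphic_ext_seq topspace_ext_space
      ext_seq_dual_dom_delta ext_seq_dual_dom_delta_star ext_alpha_image
      ext_seq_dual_map_delta ext_seq_dual_map_delta_star homeomorphic_ext_alpha
    by (intro conjI ballI allI subsetI) blast+
qed

end
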